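(* Let $r\ge 2$ be an integer, let $v\colon\mathbb{S}^m\to\mathbb{S}^{n-1}\subset\mathbb{R}^n$ be an eigenmap, i.e. a smooth harmonic map with $|\nabla v|^2=\lambda$ for some constant $\lambda>0$, and let $\delta\in(0,\frac{\pi}{2})$. Then the map $q\colon\mathbb{S}^m\to\mathbb{S}^n\subset\mathbb{R}^{n+1}$ defined by $$q:=(\sin\delta\cdot v,\cos\delta)$$ is proper $r$-harmonic if and only if $\sin\delta=\frac{1}{\sqrt{r}}$. Moreover, these maps (i.e. $q$ with $\sin\delta=\frac{1}{\sqrt r}$) are unstable critical points of the $r$-energy $E_r$.
   Context: Spheres carry the round metric. A smooth map $v\colon M\to\mathbb{S}^{k}\subset\mathbb{R}^{k+1}$ is an eigenmap if all its components are eigenfunctions of the Laplace–Beltrami operator with the same eigenvalue; equivalently, $v$ is harmonic with constant $|\nabla v|^2$. For a smooth map $\phi\colon M\to N$ between Riemannian manifolds ($M$ closed), let $\bar\nabla$ be the connection on $\phi^\ast TN$, $\bar\Delta=\operatorname{Tr}(\bar\nabla\bar\nabla-\bar\nabla_\nabla)$ and $\tau(\phi)=\operatorname{Tr}\bar\nabla d\phi$ the tension field. The $r$-energy is, for $s\ge 1$, $$E_{2s}(\phi)=\int_M|\bar\Delta^{s-1}\tau(\phi)|^2\,dv,\qquad E_{2s+1}(\phi)=\int_M|\bar\nabla\bar\Delta^{s-1}\tau(\phi)|^2\,dv.$$ A map is $r$-harmonic if it is a critical point of $E_r$ (with respect to all smooth variations); it is proper if it is not harmonic, i.e. $\tau(\phi)\neq0$.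 A critical point $\phi$ of $E_r$ is unstable if there is a smooth variation $\phi_t$ of maps $M\to N$ with $\phi_0=\phi$ and $\frac{d^2}{dt^2}\big|_{t=0}E_r(\phi_t)<0$. *)

theory Defs
  imports "HOL-Analysis.Analysis"
begin

text \<open>
  Conventions.  The sphere \<open>S\<^sup>m\<close> is \<open>sphere 0 1\<close> in a Euclidean space \<open>'a\<close> with
  \<open>DIM('a) = m + 1\<close>.  Maps and sections are functions on the ambient space of which only the
  values on \<open>sphere 0 1\<close> matter; sections of the pulled back tangent bundle take values in the
  ambient space \<open>'b\<close> of the target sphere.  The round metric is the one induced by \<open>\<bullet>\<close>, so its
  Levi-Civita connection is the tangential part of the directional derivative.
\<close>

section \<open>Smooth maps\<close>

fun Ck_on :: "'a::real_normed_vector set \<Rightarrow> ('a \<Rightarrow> 'b::real_normed_vector) \<Rightarrow> nat \<Rightarrow> bool" where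
  "Ck_on U f 0 \<longleftrightarrow> continuous_on U f"
| "Ck_on U f (Suc k) \<longleftrightarrow>
     (\<forall>x\<in>U. f differentiable (at x)) \<and> (\<forall>v. Ck_on U (\<lambda>x. frechet_derivative f (at x) v) k)"

text \<open>Smoothness on an arbitrary subset: locally the restriction of a smooth function defined on
  an open set.\<close>

definition smooth_on :: "'a::real_normed_vector set \<Rightarrow> ('a \<Rightarrow> 'b::real_normed_vector) \<Rightarrow> bool" where
  "smooth_on M f \<longleftrightarrow>
     (\<forall>x\<in>M. \<exists>U g. open U \<and> x \<in> U \<and> (\<forall>k. Ck_on U g k) \<and> (\<forall>y\<in>M \<inter> U. g y = f y))"

definition smooth_sphere_map :: "('a::euclidean_space \<Rightarrow> 'b::euclidean_space) \<Rightarrow> bool" where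
  "smooth_sphere_map \<phi> \<longleftrightarrow> \<phi> ` sphere 0 1 \<subseteq> sphere 0 1 \<and> smooth_on (sphere 0 1) \<phi>"

section \<open>Geometry of the unit sphere\<close>

definition tangent_space :: "'a::euclidean_space \<Rightarrow> 'a set" where
  "tangent_space x = {X. X \<bullet> x = 0}"

definition tangent_proj :: "'a::euclidean_space \<Rightarrow> 'a \<Rightarrow> 'a" where
  "tangent_proj x w = w - (w \<bullet> x) *\<^sub>R x"

text \<open>The derivative within the sphere is unique only on \<open>tangent_space x\<close>; below it is applied to
  tangent vectors only.\<close>

definition sphere_deriv :: "('a::euclidean_space \<Rightarrow> 'b::euclidean_space) \<Rightarrow> 'a \<Rightarrow> 'a \<Rightarrow> 'b" where
  "sphere_deriv f x X = frechet_derivative f (at x within sphere 0 1) X"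

definition orthonormal_basis_of :: "'a::euclidean_space set \<Rightarrow> 'a set \<Rightarrow> bool" where
  "orthonormal_basis_of T B \<longleftrightarrow> pairwise orthogonal B \<and> (\<forall>e\<in>B. norm e = 1) \<and> span B = T"

text \<open>For a bilinear \<open>b\<close> the value does not depend on the basis chosen.\<close>

definition tangent_trace ::
    "'a::euclidean_space \<Rightarrow> ('a \<Rightarrow> 'a \<Rightarrow> 'c::real_vector) \<Rightarrow> 'c" where
  "tangent_trace x b = (\<Sum>e\<in>(SOME B. orthonormal_basis_of (tangent_space x) B). b e e)"

text \<open>\<open>pullback_conn \<phi> V x X\<close> is the covariant derivative at \<open>x\<close>, in direction \<open>X\<close>, of the section
  \<open>V\<close> of the tangent bundle of the target sphere pulled back along \<open>\<phi>\<close>.\<close>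

definition pullback_conn ::
    "('a::euclidean_space \<Rightarrow> 'b::euclidean_space) \<Rightarrow> ('a \<Rightarrow> 'b) \<Rightarrow> 'a \<Rightarrow> 'a \<Rightarrow> 'b" where
  "pullback_conn \<phi> V x X = tangent_proj (\<phi> x) (sphere_deriv V x X)"

definition levi_civita :: "('a::euclidean_space \<Rightarrow> 'a) \<Rightarrow> 'a \<Rightarrow> 'a \<Rightarrow> 'a" where
  "levi_civita Y x X = tangent_proj x (sphere_deriv Y x X)"

text \<open>In the two second order expressions below, the tangent vector \<open>Y\<close> at \<open>x\<close> is extended to the
  tangent vector field \<open>\<lambda>y. tangent_proj y Y\<close>; they are tensorial, so the choice of extension is
  immaterial.\<close>

definition second_cov_deriv ::
    "('a::euclidean_space \<Rightarrow> 'b::euclidean_space) \<Rightarrow> ('a \<Rightarrow> 'b) \<Rightarrow> 'a \<Rightarrow> 'a \<Rightarrow> 'a \<Rightarrow> 'b" where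
  "second_cov_deriv \<phi> V x X Y =
     pullback_conn \<phi> (\<lambda>y. pullback_conn \<phi> V y (tangent_proj y Y)) x X
     - pullback_conn \<phi> V x (levi_civita (\<lambda>y. tangent_proj y Y) x X)"

definition rough_laplacian ::
    "('a::euclidean_space \<Rightarrow> 'b::euclidean_space) \<Rightarrow> ('a \<Rightarrow> 'b) \<Rightarrow> 'a \<Rightarrow> 'b" where
  "rough_laplacian \<phi> V x = tangent_trace x (second_cov_deriv \<phi> V x)"

definition cov_deriv_differential ::
    "('a::euclidean_space \<Rightarrow> 'b::euclidean_space) \<Rightarrow> 'a \<Rightarrow> 'a \<Rightarrow> 'a \<Rightarrow> 'b" where
  "cov_deriv_differential \<phi> x X Y =
     pullback_conn \<phi> (\<lambda>y. sphere_deriv \<phi> y (tangent_proj y Y)) x X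
     - sphere_deriv \<phi> x (levi_civita (\<lambda>y. tangent_proj y Y) x X)"

definition tension :: "('a::euclidean_space \<Rightarrow> 'b::euclidean_space) \<Rightarrow> 'a \<Rightarrow> 'b" where
  "tension \<phi> x = tangent_trace x (cov_deriv_differential \<phi> x)"

definition differential_norm_sq :: "('a::euclidean_space \<Rightarrow> 'b::euclidean_space) \<Rightarrow> 'a \<Rightarrow> real" where
  "differential_norm_sq \<phi> x =
     tangent_trace x (\<lambda>X Y. sphere_deriv \<phi> x X \<bullet> sphere_deriv \<phi> x Y)"

definition cov_deriv_norm_sq ::
    "('a::euclidean_space \<Rightarrow> 'b::euclidean_space) \<Rightarrow> ('a \<Rightarrow> 'b) \<Rightarrow> 'a \<Rightarrow> real" where
  "cov_deriv_norm_sq \<phi> V x =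
     tangent_trace x (\<lambda>X Y. pullback_conn \<phi> V x X \<bullet> pullback_conn \<phi> V x Y)"

text \<open>The Riemannian volume measure of the unit sphere, in the form given by integration in polar
  coordinates: the measure of \<open>A\<close> is \<open>DIM('a)\<close> times the Lebesgue measure of the cone
  \<open>{t *\<^sub>R a | t a. 0 < t \<and> t < 1 \<and> a \<in> A}\<close>.\<close>

definition sphere_measure :: "'a::euclidean_space measure" where
  "sphere_measure = scale_measure (of_nat DIM('a))
     (distr (restrict_space lborel (ball 0 1 - {0})) (restrict_space borel (sphere 0 1)) sgn)"

section \<open>The r-energy and its critical points\<close>

text \<open>Meaningful for \<open>r \<ge> 2\<close>, where \<open>r = 2 * s\<close> or \<open>r = 2 * s + 1\<close> with \<open>s = r div 2 \<ge> 1\<close>.\<close>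

definition r_energy :: "nat \<Rightarrow> ('a::euclidean_space \<Rightarrow> 'b::euclidean_space) \<Rightarrow> real" where
  "r_energy r \<phi> =
     (let W = (rough_laplacian \<phi> ^^ (r div 2 - 1)) (tension \<phi>) in
      if even r then (\<integral>x. (norm (W x))\<^sup>2 \<partial>sphere_measure)
      else (\<integral>x. cov_deriv_norm_sq \<phi> W x \<partial>sphere_measure))"

definition harmonic_map :: "('a::euclidean_space \<Rightarrow> 'b::euclidean_space) \<Rightarrow> bool" where
  "harmonic_map \<phi> \<longleftrightarrow> smooth_sphere_map \<phi> \<and> (\<forall>x\<in>sphere 0 1. tension \<phi> x = 0)"

definition smooth_variation ::
    "('a::euclidean_space \<Rightarrow> 'b::euclidean_space) \<Rightarrow> (real \<Rightarrow> 'a \<Rightarrow> 'b) \<Rightarrow> bool" where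
  "smooth_variation \<phi> \<Phi> \<longleftrightarrow>
     (\<exists>\<epsilon>>0. smooth_on ({-\<epsilon><..<\<epsilon>} \<times> sphere 0 1) (\<lambda>(t, x). \<Phi> t x)
        \<and> (\<forall>t\<in>{-\<epsilon><..<\<epsilon>}. \<Phi> t ` sphere 0 1 \<subseteq> sphere 0 1))
     \<and> (\<forall>x\<in>sphere 0 1. \<Phi> 0 x = \<phi> x)"

definition r_harmonic :: "nat \<Rightarrow> ('a::euclidean_space \<Rightarrow> 'b::euclidean_space) \<Rightarrow> bool" where
  "r_harmonic r \<phi> \<longleftrightarrow> smooth_sphere_map \<phi> \<and>
     (\<forall>\<Phi>. smooth_variation \<phi> \<Phi> \<longrightarrow> ((\<lambda>t. r_energy r (\<Phi> t)) has_real_derivative 0) (at 0))"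

definition proper_r_harmonic :: "nat \<Rightarrow> ('a::euclidean_space \<Rightarrow> 'b::euclidean_space) \<Rightarrow> bool" where
  "proper_r_harmonic r \<phi> \<longleftrightarrow> r_harmonic r \<phi> \<and> \<not> harmonic_map \<phi>"

definition unstable_critical_point ::
    "nat \<Rightarrow> ('a::euclidean_space \<Rightarrow> 'b::euclidean_space) \<Rightarrow> bool" where
  "unstable_critical_point r \<phi> \<longleftrightarrow> r_harmonic r \<phi> \<and>
     (\<exists>\<Phi> E' c. smooth_variation \<phi> \<Phi>
        \<and> (\<forall>\<^sub>F t in nhds 0. ((\<lambda>t. r_energy r (\<Phi> t)) has_real_derivative E' t) (at t))
        \<and> (E' has_real_derivative c) (at 0) \<and> c < 0)"

end

theory Submission
  imports Defs "HOL-Real_Asymp.Real_Asymp"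
begin

text \<open>
  Write \<open>s = sin \<delta>\<close>, \<open>c = cos \<delta>\<close>, let \<open>q = (s v, c)\<close> be the parallel at angle \<open>\<delta>\<close>, and let
  \<open>\<eta> = (- c v, s)\<close>, a unit section along \<open>q\<close> which is, up to sign, the velocity of \<open>q\<close> when
  \<open>\<delta>\<close> moves. Since \<open>v\<close> satisfies \<open>\<Delta>v = - \<lambda>v\<close> and \<open>|\<nabla>v|\<^sup>2 = \<lambda>\<close>, the tension field of \<open>q\<close> is
  \<open>\<lambda>sc \<eta>\<close>, and \<open>\<eta>\<close> is an eigensection of the rough Laplacian with eigenvalue \<open>\<mu> = - \<lambda>c\<^sup>2\<close>
  (\<open>tension_parallel\<close>, \<open>proj_lap_parallel\<close>). Hence the iterated Laplacians of the tension field are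
  \<open>\<kappa>\<^sub>j \<eta>\<close> with \<open>\<kappa>\<^sub>j = \<lambda>sc \<mu>\<^sup>j\<close>, and the energy of the parallel at angle \<open>a\<close> is
  \<open>E(a) = \<lambda>\<^sup>r vol sin\<^sup>2 a cos\<^sup>2\<^sup>r\<^sup>-\<^sup>2 a\<close> for even and odd \<open>r\<close> alike (\<open>r_energy_parallel\<close>). On
  \<open>(0, \<pi>/2)\<close> this profile has a single critical point, \<open>r sin\<^sup>2 a = 1\<close>, and its second derivative
  is negative there. Moving \<open>\<delta>\<close> is a smooth variation, so a critical \<open>q\<close> has \<open>r s\<^sup>2 = 1\<close>, and the same
  variation shows instability.

  It remains to see that \<open>r s\<^sup>2 = 1\<close> makes \<open>q\<close> critical for every variation \<open>\<phi>\<^sub>t\<close>. Let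
  \<open>f\<^sub>t = \<langle>\<eta>, \<phi>\<^sub>t\<rangle>\<close> and let \<open>V\<^sub>t = \<eta> - f\<^sub>t \<phi>\<^sub>t\<close> be the tangential part of \<open>\<eta>\<close> along \<open>\<phi>\<^sub>t\<close>. If \<open>G\<^sub>j\<close> is
  the \<open>j\<close>-th Laplacian of the tension field of \<open>\<phi>\<^sub>t\<close>, then \<open>G\<^sub>j - \<kappa>\<^sub>j V\<^sub>t\<close> and \<open>\<Delta>V\<^sub>t - \<mu>V\<^sub>t\<close> vanish at
  \<open>t = 0\<close>, so that products of such differences are of order \<open>t\<^sup>2\<close>, uniformly on the sphere.
  Together with the symmetry of the rough Laplacian this gives, modulo \<open>O(t\<^sup>2)\<close>, a linear recursion for
  the moments \<open>\<integral>\<langle>G\<^sub>j, V\<^sub>t\<rangle>\<close> whose coefficients involve only \<open>\<integral>|V\<^sub>t|\<^sup>2\<close> and \<open>\<integral>\<langle>V\<^sub>t, \<Delta>V\<^sub>t\<rangle>\<close>.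
  Both of these and the first moment are computed by Green's formula, and the solution is
  \<open>\<kappa>\<^sub>j vol + \<beta>\<^sub>j \<integral>f\<^sub>t\<close> with \<open>\<beta>\<^sub>j = - \<lambda> \<mu>\<^sup>j (1 - 2 (j + 1) s\<^sup>2)\<close> (\<open>moment_estimate\<close>). The energies are
  integrals of \<open>\<langle>G\<^sub>j, G\<^sub>j\<rangle>\<close> or of \<open>- \<langle>G\<^sub>j, G\<^sub>j\<^sub>+\<^sub>1\<rangle>\<close>, and in both parities the coefficient of
  \<open>\<integral>f\<^sub>t\<close> comes out as a multiple of \<open>1 - r s\<^sup>2\<close> (\<open>energy_stationary\<close>). Working modulo \<open>O(t\<^sup>2)\<close> instead
  of differentiating avoids both the commutator of the Laplacian with \<open>d/dt\<close> and differentiation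
  under the integral sign.

  The intrinsic objects are made computable by replacing each function on the sphere by its
  extension that is constant along rays. For these, derivatives along tangent vectors of the
  sphere are Euclidean derivatives, radial derivatives vanish, and traces over the tangent space become
  sums over the standard basis; the rough Laplacian turns into the explicit expression
  \<open>proj_lap\<close> (\<open>rough_laplacian_radial\<close>). The divergence theorem on the sphere
  (\<open>sphere_divergence_theorem\<close>) comes from the translation invariance of Lebesgue measure.
\<close>

section \<open>Calculus of smooth functions\<close>

lemma frechet_derivative_cong_open:
  assumes "open U" "x \<in> U" "\<And>y. y \<in> U \<Longrightarrow> f y = g y"
  shows "frechet_derivative f (at x) = frechet_derivative g (at x)"
proof -
  have "(f has_derivative D) (at x) \<longleftrightarrow> (g has_derivative D) (at x)" for D
    using has_derivative_transform_within_open[OF _ assms(1,2), of f D UNIV g]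
      has_derivative_transform_within_open[OF _ assms(1,2), of g D UNIV f] assms(3) by auto
  then show ?thesis unfolding frechet_derivative_def by simp
qed

lemma differentiable_cong_open:
  assumes "open U" "x \<in> U" "\<And>y. y \<in> U \<Longrightarrow> f y = g y" "f differentiable (at x)"
  shows "g differentiable (at x)"
  using assms has_derivative_transform_within_open[OF _ assms(1,2), of f _ UNIV g]
  unfolding differentiable_def by blast

lemma Ck_on_cong:
  assumes "open U" "\<And>y. y \<in> U \<Longrightarrow> f y = g y" "Ck_on U f k"
  shows "Ck_on U g k"
  using assms
proof (induction k arbitrary: f g)
  case 0
  then show ?case using continuous_on_cong[of U U f g] by simp
next
  case (Suc k)
  have "Ck_on U (\<lambda>x. frechet_derivative g (at x) v) k" for v
    by (rule Suc.IH[of "\<lambda>x. frechet_derivative f (at x) v"])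
      (use Suc frechet_derivative_cong_open[of U _ f g] in auto)
  moreover have "g differentiable (at x)" if "x \<in> U" for x
    using differentiable_cong_open[of U x f g] Suc that by auto
  ultimately show ?case by simp
qed

lemma Ck_on_SucD: "Ck_on U f (Suc k) \<Longrightarrow> Ck_on U f k"
proof (induction k arbitrary: f)
  case 0
  then show ?case
    by (auto intro!: continuous_at_imp_continuous_on differentiable_imp_continuous_within)
next
  case (Suc k)
  then show ?case by (metis Ck_on.simps(2))
qed

lemma Ck_on_mono: "Ck_on U f k \<Longrightarrow> j \<le> k \<Longrightarrow> Ck_on U f j"
  by (induction k) (use Ck_on_SucD le_Suc_eq in blast)+

lemma Ck_on_continuous: "Ck_on U f k \<Longrightarrow> continuous_on U f"
  using Ck_on_mono[of U f k 0] by simp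

lemma Ck_on_subset: "Ck_on U f k \<Longrightarrow> V \<subseteq> U \<Longrightarrow> Ck_on V f k"
  by (induction k arbitrary: f) (auto intro: continuous_on_subset)

lemma Ck_on_local:
  assumes "\<And>x. x \<in> U \<Longrightarrow> \<exists>V. open V \<and> x \<in> V \<and> Ck_on V f k"
  shows "Ck_on U f k"
  using assms
proof (induction k arbitrary: f)
  case 0
  then show ?case
    by (metis Ck_on.simps(1) continuous_at_imp_continuous_on continuous_on_eq_continuous_at)
next
  case (Suc k)
  have "Ck_on U (\<lambda>x. frechet_derivative f (at x) v) k" for v
    by (rule Suc.IH) (metis Suc.prems Ck_on.simps(2))
  moreover have "f differentiable (at x)" if "x \<in> U" for x
    using Suc.prems[OF that] by auto
  ultimately show ?case by simp
qed

text \<open>The recursion in the definition is entered through a derivative known in closed form.\<close>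

lemma Ck_on_SucI:
  assumes "open U" "\<And>x. x \<in> U \<Longrightarrow> (f has_derivative f' x) (at x)"
    and "\<And>v. Ck_on U (\<lambda>x. f' x v) k"
  shows "Ck_on U f (Suc k)"
proof -
  have eq: "frechet_derivative f (at x) = f' x" if "x \<in> U" for x
    using frechet_derivative_at[OF assms(2)[OF that]] by simp
  have "Ck_on U (\<lambda>x. frechet_derivative f (at x) v) k" for v
    by (rule Ck_on_cong[OF assms(1) _ assms(3)[of v]]) (simp add: eq)
  then show ?thesis using assms(2) by (auto simp: differentiable_def)
qed

lemma Ck_on_Suc_has_derivative:
  "Ck_on U f (Suc k) \<Longrightarrow> x \<in> U \<Longrightarrow> (f has_derivative frechet_derivative f (at x)) (at x)"
  by (simp add: frechet_derivative_works)

lemma Ck_on_const: "open U \<Longrightarrow> Ck_on U (\<lambda>x. c) k"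
  by (induction k arbitrary: c) (auto intro!: continuous_intros)

lemma Ck_on_bounded_linear:
  assumes "open U" "bounded_linear h" "Ck_on U f k"
  shows "Ck_on U (\<lambda>x. h (f x)) k"
  using assms(3)
proof (induction k arbitrary: f)
  case 0
  then show ?case using bounded_linear.continuous_on[OF assms(2)] by simp
next
  case (Suc k)
  show ?case
    by (rule Ck_on_SucI[OF assms(1) bounded_linear.has_derivative[OF assms(2)
            Ck_on_Suc_has_derivative[OF Suc.prems]]])
      (use Suc in auto)
qed

lemma Ck_on_linear:
  assumes "open U" "bounded_linear h"
  shows "Ck_on U h k"
proof (cases k)
  case 0
  then show ?thesis using assms by (simp add: linear_continuous_on)
next
  case (Suc j)
  show ?thesis unfolding Suc
    by (rule Ck_on_SucI[OF assms(1) bounded_linear.has_derivative[OF assms(2) has_derivative_ident]])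
      (rule Ck_on_const[OF assms(1)])
qed

lemma Ck_on_add:
  assumes "open U" "Ck_on U f k" "Ck_on U g k"
  shows "Ck_on U (\<lambda>x. f x + g x) k"
  using assms(2,3)
proof (induction k arbitrary: f g)
  case 0
  then show ?case by (simp add: continuous_on_add)
next
  case (Suc k)
  show ?case
    by (rule Ck_on_SucI[OF assms(1) has_derivative_add[OF
            Ck_on_Suc_has_derivative[OF Suc.prems(1)] Ck_on_Suc_has_derivative[OF Suc.prems(2)]]])
      (use Suc in auto)
qed

lemma Ck_on_bilinear:
  assumes "open U" "bounded_bilinear p" "Ck_on U f k" "Ck_on U g k"
  shows "Ck_on U (\<lambda>x. p (f x) (g x)) k"
  using assms(3,4)
proof (induction k arbitrary: f g)
  case 0
  then show ?case using bounded_bilinear.continuous_on[OF assms(2)] by simp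
next
  case (Suc k)
  show ?case
    by (rule Ck_on_SucI[OF assms(1) bounded_bilinear.FDERIV[OF assms(2)
            Ck_on_Suc_has_derivative[OF Suc.prems(1)] Ck_on_Suc_has_derivative[OF Suc.prems(2)]]])
      (use Suc Ck_on_SucD[OF Suc.prems(1)] Ck_on_SucD[OF Suc.prems(2)] in
        \<open>auto intro!: Ck_on_add[OF assms(1)]\<close>)
qed

lemmas Ck_on_scaleR = Ck_on_bilinear[OF _ bounded_bilinear_scaleR]
  and Ck_on_inner = Ck_on_bilinear[OF _ bounded_bilinear_inner]
  and Ck_on_mult = Ck_on_bilinear[OF _ bounded_bilinear_mult]

lemma Ck_on_minus: "open U \<Longrightarrow> Ck_on U f k \<Longrightarrow> Ck_on U (\<lambda>x. - f x) k"
  using Ck_on_bounded_linear[OF _ bounded_linear_minus[OF bounded_linear_ident]] by auto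

lemma Ck_on_diff:
  "open U \<Longrightarrow> Ck_on U f k \<Longrightarrow> Ck_on U g k \<Longrightarrow> Ck_on U (\<lambda>x. f x - g x) k"
  using Ck_on_add[OF _ _ Ck_on_minus, of U f k g] by simp

lemma Ck_on_sum:
  "open U \<Longrightarrow> (\<And>i. i \<in> I \<Longrightarrow> Ck_on U (f i) k) \<Longrightarrow> Ck_on U (\<lambda>x. \<Sum>i\<in>I. f i x) k"
  by (induction I rule: infinite_finite_induct) (auto intro: Ck_on_const Ck_on_add)

lemma Ck_on_Pair:
  assumes "open U" "Ck_on U f k" "Ck_on U g k"
  shows "Ck_on U (\<lambda>x. (f x, g x)) k"
proof -
  have "Ck_on U (\<lambda>x. (f x, 0) + (0, g x)) k"
    using assms by (intro Ck_on_add Ck_on_bounded_linear[of U "\<lambda>a. (a, 0)"]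
        Ck_on_bounded_linear[of U "\<lambda>a. (0, a)"])
      (auto intro!: bounded_linear_Pair bounded_linear_ident bounded_linear_zero)
  then show ?thesis by simp
qed

text \<open>Only derivatives along fixed vectors are controlled by \<open>Ck_on\<close>. The derivative of \<open>f\<close> at \<open>g x\<close>
  is taken along a vector that moves with \<open>x\<close>, so it is expanded in a basis; this is why \<open>g\<close> takes values
  in a Euclidean space.\<close>

lemma Ck_on_compose:
  fixes g :: "'x::real_normed_vector \<Rightarrow> 'm::euclidean_space"
  assumes "open U" "g ` U \<subseteq> T" "Ck_on T f k" "Ck_on U g k"
  shows "Ck_on U (\<lambda>x. f (g x)) k"
  using assms(3,4)
proof (induction k arbitrary: f)
  case 0
  then show ?case using assms(2) continuous_on_compose2[of T f U g] by simp
next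
  case (Suc k)
  have lin: "linear (frechet_derivative f (at (g x)))" if "x \<in> U" for x
    using Suc.prems(1) assms(2) that by (auto intro: linear_frechet_derivative)
  let ?F = "\<lambda>x v. \<Sum>b\<in>Basis.
     (frechet_derivative g (at x) v \<bullet> b) *\<^sub>R frechet_derivative f (at (g x)) b"
  have "frechet_derivative f (at (g x)) w
      = (\<Sum>b\<in>Basis. (w \<bullet> b) *\<^sub>R frechet_derivative f (at (g x)) b)" if "x \<in> U" for x w
    by (subst euclidean_representation[of w, symmetric])
      (simp only: linear_sum[OF lin[OF that]] linear_scale[OF lin[OF that]])
  then have der: "((\<lambda>x. f (g x)) has_derivative ?F x) (at x)" if "x \<in> U" for x
    using has_derivative_compose[OF Ck_on_Suc_has_derivative[OF Suc.prems(2) that]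
        Ck_on_Suc_has_derivative[OF Suc.prems(1), of "g x"]] that assms(2) by auto
  show ?case
    by (rule Ck_on_SucI[OF assms(1) der])
      (use Suc Ck_on_SucD[OF Suc.prems(2)] assms(1) in
        \<open>auto intro!: Ck_on_sum Ck_on_scaleR Ck_on_inner Ck_on_const\<close>)
qed

lemma Ck_on_inverse: "Ck_on (- {0::real}) inverse k"
proof (induction k)
  case 0
  then show ?case by (auto intro!: continuous_intros)
next
  case (Suc k)
  show ?case
    by (rule Ck_on_SucI[where f' = "\<lambda>x v. - (inverse x * v * inverse x)"])
      (use Suc in \<open>auto intro!: derivative_eq_intros Ck_on_minus Ck_on_mult Ck_on_const\<close>)
qed

lemma Ck_on_sqrt: "Ck_on {0<..} sqrt k"
proof (induction k)
  case 0
  then show ?case by (auto intro!: continuous_intros)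
next
  case (Suc k)
  have "Ck_on {0<..} (\<lambda>x. v * inverse 2 * inverse (sqrt x)) k" for v
    by (intro Ck_on_mult Ck_on_const Ck_on_compose[OF _ _ Ck_on_inverse] Suc) auto
  then show ?case
    by (intro Ck_on_SucI[where f' = "\<lambda>x v. v * inverse 2 * inverse (sqrt x)"])
      (auto intro!: derivative_eq_intros simp: divide_simps)
qed

lemma Ck_on_sin_cos: "Ck_on UNIV (sin :: real \<Rightarrow> real) k \<and> Ck_on UNIV (cos :: real \<Rightarrow> real) k"
proof (induction k)
  case 0
  then show ?case by (auto intro!: continuous_intros)
next
  case (Suc k)
  show ?case
    by (intro conjI Ck_on_SucI[where f = sin and f' = "\<lambda>x v. v * cos x"]
        Ck_on_SucI[where f = cos and f' = "\<lambda>x v. - (v * sin x)"])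
      (use Suc in \<open>auto intro!: derivative_eq_intros Ck_on_mult Ck_on_minus Ck_on_const\<close>)
qed

lemma Ck_on_sgn: "Ck_on (- {0}) (sgn :: 'a::euclidean_space \<Rightarrow> 'a) k"
proof -
  have op: "open (- {0 :: 'a})" by auto
  have "Ck_on (- {0}) (\<lambda>x :: 'a. inverse (sqrt (x \<bullet> x)) *\<^sub>R x) k"
    by (intro Ck_on_scaleR op Ck_on_compose[OF op _ Ck_on_inverse] Ck_on_compose[OF op _ Ck_on_sqrt]
        Ck_on_inner Ck_on_linear bounded_linear_ident) auto
  then show ?thesis
    using Ck_on_cong[OF op, of "\<lambda>x. inverse (sqrt (x \<bullet> x)) *\<^sub>R x" sgn k]
    by (simp add: sgn_div_norm norm_eq_sqrt_inner)
qed

section \<open>Directional derivatives and radial functions\<close>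

definition Cinf_on :: "'a::real_normed_vector set \<Rightarrow> ('a \<Rightarrow> 'b::real_normed_vector) \<Rightarrow> bool" where
  "Cinf_on U f \<longleftrightarrow> (\<forall>k. Ck_on U f k)"

definition dird :: "'a::real_normed_vector \<Rightarrow> ('a \<Rightarrow> 'b::real_normed_vector) \<Rightarrow> 'a \<Rightarrow> 'b" where
  "dird e f x = frechet_derivative f (at x) e"

definition lap :: "('a::euclidean_space \<Rightarrow> 'b::real_normed_vector) \<Rightarrow> 'a \<Rightarrow> 'b" where
  "lap f x = (\<Sum>e\<in>Basis. dird e (dird e f) x)"

lemma Cinf_on_dird: "Cinf_on U f \<Longrightarrow> Cinf_on U (dird e f)"
  unfolding Cinf_on_def dird_def by (metis Ck_on.simps(2))

lemma Cinf_on_cong: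
  "open U \<Longrightarrow> (\<And>y. y \<in> U \<Longrightarrow> f y = g y) \<Longrightarrow> Cinf_on U f \<Longrightarrow> Cinf_on U g"
  unfolding Cinf_on_def by (metis Ck_on_cong)

lemma Cinf_on_has_derivative: "Cinf_on U f \<Longrightarrow> x \<in> U \<Longrightarrow> (f has_derivative (\<lambda>e. dird e f x)) (at x)"
  unfolding dird_def Cinf_on_def using Ck_on_Suc_has_derivative by blast

lemma dird_eqI: "(f has_derivative f') (at x) \<Longrightarrow> dird e f x = f' e"
  unfolding dird_def using frechet_derivative_at by fastforce

lemma dird_cong_open:
  "open U \<Longrightarrow> x \<in> U \<Longrightarrow> (\<And>y. y \<in> U \<Longrightarrow> f y = g y) \<Longrightarrow> dird e f x = dird e g x"
  unfolding dird_def using frechet_derivative_cong_open by metis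

lemma Cinf_on_continuous: "Cinf_on U f \<Longrightarrow> continuous_on U f"
  unfolding Cinf_on_def using Ck_on_continuous by blast

lemma Cinf_on_lap: "open U \<Longrightarrow> Cinf_on U f \<Longrightarrow> Cinf_on U (lap f)"
  unfolding lap_def[abs_def] using Cinf_on_dird[OF Cinf_on_dird, of U f]
  unfolding Cinf_on_def by (intro allI Ck_on_sum) auto

lemma linear_dird:
  assumes "Cinf_on U f" "x \<in> U"
  shows "linear (\<lambda>e. dird e f x)"
  using has_derivative_linear[OF Cinf_on_has_derivative[OF assms]] .

lemma dird_expand:
  assumes "Cinf_on U f" "x \<in> U"
  shows "dird w f x = (\<Sum>b\<in>Basis. (w \<bullet> b) *\<^sub>R dird b f x)"
  by (subst euclidean_representation[of w, symmetric])
    (simp only: linear_sum[OF linear_dird[OF assms]] linear_scale[OF linear_dird[OF assms]])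

lemma dird_inner:
  assumes "Cinf_on U f" "Cinf_on U g" "x \<in> U"
  shows "dird e (\<lambda>x. f x \<bullet> g x) x = f x \<bullet> dird e g x + dird e f x \<bullet> g x"
  by (rule dird_eqI[OF has_derivative_inner[OF Cinf_on_has_derivative[OF assms(1,3)]
          Cinf_on_has_derivative[OF assms(2,3)]]])

lemma dird_diff:
  assumes "Cinf_on U f" "Cinf_on U g" "x \<in> U"
  shows "dird e (\<lambda>x. f x - g x) x = dird e f x - dird e g x"
  by (rule dird_eqI[OF has_derivative_diff[OF Cinf_on_has_derivative[OF assms(1,3)]
          Cinf_on_has_derivative[OF assms(2,3)]]])

lemma dird_second_expand:
  assumes "open U" "Cinf_on U f" "x \<in> U"
  shows "dird X (dird Y f) x = (\<Sum>b\<in>Basis. (Y \<bullet> b) *\<^sub>R dird X (dird b f) x)"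
proof -
  have "dird X (dird Y f) x = dird X (\<lambda>y. \<Sum>b\<in>Basis. (Y \<bullet> b) *\<^sub>R dird b f y) x"
    by (rule dird_cong_open[OF assms(1,3)]) (rule dird_expand[OF assms(2)])
  also have "\<dots> = (\<Sum>b\<in>Basis. (Y \<bullet> b) *\<^sub>R dird X (dird b f) x)"
    by (rule dird_eqI) (auto intro!: has_derivative_sum has_derivative_scaleR_right
        Cinf_on_has_derivative[OF Cinf_on_dird[OF assms(2)] assms(3)])
  finally show ?thesis .
qed

lemma bilinear_dird_second:
  fixes f :: "'a::euclidean_space \<Rightarrow> 'b::real_normed_vector"
  assumes "open U" "Cinf_on U f" "x \<in> U"
  shows "bilinear (\<lambda>X Y. dird X (dird Y f) x)"
  unfolding bilinear_def
proof (intro conjI allI)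
  show "linear (\<lambda>X. dird X (dird Y f) x)" for Y
    by (rule linear_dird[OF Cinf_on_dird[OF assms(2)] assms(3)])
  show "linear (\<lambda>Y. dird X (dird Y f) x)" for X
    by (subst dird_second_expand[OF assms])
      (auto simp: linear_iff inner_add_left scaleR_add_left sum.distrib scaleR_sum_right)
qed

text \<open>Extensions constant along rays are the way in which functions on the sphere are differentiated.\<close>

definition radial :: "('a::euclidean_space \<Rightarrow> 'b) \<Rightarrow> bool" where
  "radial f \<longleftrightarrow> (\<forall>x. x \<noteq> 0 \<longrightarrow> f (sgn x) = f x)"

lemma radial_scaleR: "radial f \<Longrightarrow> x \<noteq> 0 \<Longrightarrow> s > 0 \<Longrightarrow> f (s *\<^sub>R x) = f x"
  using sgn_scaleR[of s x] unfolding radial_def by (metis less_irrefl scaleR_eq_0_iff sgn_pos scaleR_one)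

lemma sgn_in_sphere: "x \<noteq> 0 \<Longrightarrow> sgn x \<in> sphere (0::'a::real_normed_vector) 1"
  by (simp add: norm_sgn)

lemma sgn_sphere: "x \<in> sphere 0 1 \<Longrightarrow> sgn x = (x::'a::real_normed_vector)"
  by (simp add: sgn_div_norm)

lemma radial_sgn: "radial (\<lambda>x. f (sgn x))"
  by (simp add: radial_def sgn_sphere[OF sgn_in_sphere])

text \<open>Euler's relation in degree zero.\<close>

lemma dird_radial:
  assumes "Cinf_on (- {0}) f" "radial f" "x \<noteq> 0"
  shows "dird x f x = 0"
proof -
  have d: "(f has_derivative (\<lambda>e. dird e f x)) (at (x + 0 *\<^sub>R x))"
    using Cinf_on_has_derivative[OF assms(1)] assms(3) by simp
  have "((\<lambda>s::real. x + s *\<^sub>R x) has_derivative (\<lambda>s. s *\<^sub>R x)) (at 0)"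
    by (auto intro!: derivative_eq_intros)
  from has_derivative_compose[OF this d]
  have "((\<lambda>s. f (x + s *\<^sub>R x)) has_derivative (\<lambda>s. dird (s *\<^sub>R x) f x)) (at 0)" .
  moreover have "((\<lambda>s. f (x + s *\<^sub>R x)) has_derivative (\<lambda>s. 0)) (at 0)"
  proof (rule has_derivative_transform_within_open[where s = "{-1<..}" and f = "\<lambda>s. f x"])
    fix s :: real assume "s \<in> {-1<..}"
    then show "f x = f (x + s *\<^sub>R x)"
      using radial_scaleR[OF assms(2,3), of "1 + s"] by (simp add: algebra_simps)
  qed auto
  ultimately have "(\<lambda>s. dird (s *\<^sub>R x) f x) = (\<lambda>s. 0)"
    by (rule has_derivative_unique)
  from fun_cong[OF this, of 1] show ?thesis by simp
qed

text \<open>Euler's relation holds along the whole ray through \<open>x\<close>, so it can be differentiated along that ray.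
  It follows that the radial direction does not contribute to the Euclidean Laplacian.\<close>

lemma dird_dird_radial:
  assumes "Cinf_on (- {0}) f" "radial f" "x \<noteq> 0"
  shows "dird x (dird x f) x = 0"
proof -
  have d: "(dird x f has_derivative (\<lambda>e. dird e (dird x f) x)) (at (x + 0 *\<^sub>R x))"
    using Cinf_on_has_derivative[OF Cinf_on_dird[OF assms(1)]] assms(3) by simp
  have "((\<lambda>s::real. x + s *\<^sub>R x) has_derivative (\<lambda>s. s *\<^sub>R x)) (at 0)"
    by (auto intro!: derivative_eq_intros)
  from has_derivative_compose[OF this d]
  have "((\<lambda>s. dird x f (x + s *\<^sub>R x)) has_derivative (\<lambda>s. dird (s *\<^sub>R x) (dird x f) x)) (at 0)" .
  moreover have "((\<lambda>s. dird x f (x + s *\<^sub>R x)) has_derivative (\<lambda>s. 0)) (at 0)"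
  proof (rule has_derivative_transform_within_open[where s = "{-1<..}" and f = "\<lambda>s. 0"])
    fix s :: real assume s: "s \<in> {-1<..}"
    have nz: "(1 + s) *\<^sub>R x \<noteq> 0" using s assms(3) by auto
    have "(1 + s) *\<^sub>R dird x f ((1 + s) *\<^sub>R x) = dird ((1 + s) *\<^sub>R x) f ((1 + s) *\<^sub>R x)"
      using linear_scale[OF linear_dird[OF assms(1), of "(1 + s) *\<^sub>R x"], of "1 + s" x] nz by simp
    also have "\<dots> = 0" by (rule dird_radial[OF assms(1,2) nz])
    finally have "dird x f ((1 + s) *\<^sub>R x) = 0" using s by simp
    then show "0 = dird x f (x + s *\<^sub>R x)" by (simp add: algebra_simps)
  qed auto
  ultimately have "(\<lambda>s. dird (s *\<^sub>R x) (dird x f) x) = (\<lambda>s. 0)"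
    by (rule has_derivative_unique)
  from fun_cong[OF this, of 1] show ?thesis by simp
qed

section \<open>The geometry of the sphere in terms of radial extensions\<close>

text \<open>A derivative within the sphere is determined on tangent vectors: a great circle through \<open>x\<close>
  with velocity \<open>X\<close> stays in the sphere, so the chain rule along it sees any two candidates alike.\<close>

lemma sphere_deriv_eq:
  fixes f :: "'a::euclidean_space \<Rightarrow> 'b::euclidean_space"
  assumes g: "(g has_derivative g') (at x)" and x: "x \<in> sphere 0 1" and X: "X \<bullet> x = 0"
    and eq: "\<And>y. y \<in> sphere 0 1 \<Longrightarrow> f y = g y"
  shows "sphere_deriv f x X = g' X"
proof (cases "X = 0")
  case X0: False
  have fg': "(f has_derivative g') (at x within sphere 0 1)"
    by (rule has_derivative_transform[OF x eq has_derivative_at_withinI[OF g]])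
  then have "f differentiable (at x within sphere 0 1)"
    by (auto simp: differentiable_def)
  then have fD: "(f has_derivative sphere_deriv f x) (at x within sphere 0 1)"
    unfolding sphere_deriv_def[abs_def] by (simp add: frechet_derivative_works)
  define n where "n = norm X"
  have n: "n > 0" using X0 by (simp add: n_def)
  define c where "c s = cos (n * s) *\<^sub>R x + (sin (n * s) / n) *\<^sub>R X" for s :: real
  have nx: "x \<bullet> x = 1" "x \<bullet> X = 0" "X \<bullet> X = n\<^sup>2"
    using x X by (auto simp: dot_square_norm n_def inner_commute)
  have "c s \<bullet> c s = 1" for s
  proof -
    have "c s \<bullet> c s = (cos (n * s))\<^sup>2 + (sin (n * s) / n)\<^sup>2 * n\<^sup>2"
      by (simp add: c_def inner_simps nx X power2_eq_square)
    also have "\<dots> = 1" using n by (simp add: power_divide)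
    finally show ?thesis .
  qed
  then have cS: "c s \<in> sphere 0 1" for s by (simp add: norm_eq_1)
  have dc: "(c has_derivative (\<lambda>s. s *\<^sub>R X)) (at 0)"
    unfolding c_def using n
    by (auto intro!: derivative_eq_intros simp: fun_eq_iff)
  have c0: "c 0 = x" by (simp add: c_def)
  have "((\<lambda>s. f (c s)) has_derivative (\<lambda>s. D (s *\<^sub>R X))) (at 0)"
    if "(f has_derivative D) (at x within sphere 0 1)" for D
  proof -
    have "range c \<subseteq> sphere 0 1" using cS by blast
    then have "(f has_derivative D) (at (c 0) within range c)"
      using has_derivative_subset[OF that] c0 by simp
    from has_derivative_in_compose[OF dc this] show ?thesis .
  qed
  from has_derivative_unique[OF this[OF fD] this[OF fg']]
  have "(\<lambda>s::real. sphere_deriv f x (s *\<^sub>R X)) = (\<lambda>s. g' (s *\<^sub>R X))" .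
  from fun_cong[OF this, of 1] show ?thesis by simp
next
  case True
  have fg': "(f has_derivative g') (at x within sphere 0 1)"
    by (rule has_derivative_transform[OF x eq has_derivative_at_withinI[OF g]])
  then have "f differentiable (at x within sphere 0 1)"
    by (auto simp: differentiable_def)
  then have "linear (sphere_deriv f x)"
    unfolding sphere_deriv_def[abs_def] by (rule linear_frechet_derivative)
  then show ?thesis using True linear_0 has_derivative_linear[OF fg'] by metis
qed

text \<open>The point \<open>x\<close> completes every orthonormal basis of its tangent space to one of the whole space, and the
  trace of a bilinear form is the same in all orthonormal bases of the whole space. The form \<open>b\<close> itself
  need only agree with the bilinear \<open>\<beta>\<close> on tangent vectors.\<close>

lemma tangent_trace_eq:
  fixes x :: "'a::euclidean_space"
  assumes x: "x \<in> sphere 0 1" and b: "bilinear \<beta>" and nul: "\<beta> x x = 0"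
    and eq: "\<And>X. X \<bullet> x = 0 \<Longrightarrow> b X X = \<beta> X X"
  shows "tangent_trace x b = (\<Sum>e\<in>Basis. \<beta> e e)"
proof -
  let ?T = "tangent_space x"
  define B where "B = (SOME B. orthonormal_basis_of ?T B)"
  have "subspace ?T" unfolding tangent_space_def subspace_def by (auto simp: inner_add_left)
  from orthonormal_basis_subspace[OF this] obtain B0 where "orthonormal_basis_of ?T B0"
    unfolding orthonormal_basis_of_def by metis
  then have B: "orthonormal_basis_of ?T B" unfolding B_def by (rule someI)
  have BT: "e \<bullet> x = 0" if "e \<in> B" for e
    using B span_superset[of B] that by (auto simp: orthonormal_basis_of_def tangent_space_def)
  have xx: "x \<bullet> x = 1" using x by (simp add: dot_square_norm)
  have xB: "x \<notin> B" using BT xx by force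
  let ?C = "insert x B"
  have po: "pairwise orthogonal ?C"
    using B BT by (auto simp: pairwise_insert orthonormal_basis_of_def orthogonal_def inner_commute)
  have nm: "norm e = 1" if "e \<in> ?C" for e
    using that B x by (auto simp: orthonormal_basis_of_def)
  have "0 \<notin> ?C" using nm by force
  then have ind: "independent ?C" using po by (simp add: pairwise_orthogonal_independent)
  then have finC: "finite ?C" by (rule independent_imp_finite)
  have span: "y \<in> span ?C" for y
  proof -
    have "y - (y \<bullet> x) *\<^sub>R x \<in> ?T"
      by (simp add: tangent_space_def inner_diff_left xx)
    then have "y - (y \<bullet> x) *\<^sub>R x \<in> span B" using B by (simp add: orthonormal_basis_of_def)
    then show ?thesis by (auto simp: span_insert)
  qed
  have ex: "y = (\<Sum>e\<in>?C. (y \<bullet> e) *\<^sub>R e)" for y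
    using orthonormal_basis_expand[OF po nm span finC, of y] by (simp add: inner_commute)
  have gram: "e \<bullet> e' = (if e = e' then 1 else 0)" if "e \<in> ?C" "e' \<in> ?C" for e e'
    using po nm[OF that(1)] that by (auto simp: pairwise_def orthogonal_def dot_square_norm)
  have lin1: "linear (\<lambda>X. \<beta> X Y)" and lin2: "linear (\<beta> X)" for X Y
    using b by (auto simp: bilinear_def)
  have sl: "\<beta> (\<Sum>e\<in>A. f e) Y = (\<Sum>e\<in>A. \<beta> (f e) Y)" for A :: "'a set" and f Y
    by (rule linear_sum[OF lin1])
  have sr: "\<beta> X (\<Sum>e\<in>A. f e) = (\<Sum>e\<in>A. \<beta> X (f e))" for A :: "'a set" and f X
    by (rule linear_sum[OF lin2])
  have cl: "\<beta> (c *\<^sub>R X) Y = c *\<^sub>R \<beta> X Y" for c X Y by (rule linear_scale[OF lin1])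
  have cr: "\<beta> X (c *\<^sub>R Y) = c *\<^sub>R \<beta> X Y" for c X Y by (rule linear_scale[OF lin2])
  have "(\<Sum>i\<in>Basis. \<beta> i i) = (\<Sum>i\<in>Basis. \<Sum>e\<in>?C. \<Sum>e'\<in>?C. ((i \<bullet> e') * (i \<bullet> e)) *\<^sub>R \<beta> e e')"
  proof (rule sum.cong[OF refl])
    fix i :: 'a
    have "\<beta> i i = \<beta> (\<Sum>e\<in>?C. (i \<bullet> e) *\<^sub>R e) (\<Sum>e\<in>?C. (i \<bullet> e) *\<^sub>R e)"
      using ex[of i] by simp
    also have "\<dots> = (\<Sum>e\<in>?C. \<Sum>e'\<in>?C. ((i \<bullet> e') * (i \<bullet> e)) *\<^sub>R \<beta> e e')"
      by (simp only: sl cl, simp only: sr cr scaleR_scaleR mult.commute scaleR_sum_right)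
    finally show "\<beta> i i = \<dots>" .
  qed
  also have "\<dots> = (\<Sum>e\<in>?C. \<Sum>e'\<in>?C. (\<Sum>i\<in>Basis. (i \<bullet> e') * (i \<bullet> e)) *\<^sub>R \<beta> e e')"
    by (subst sum.swap, rule sum.cong[OF refl], subst sum.swap) (simp add: scaleR_sum_left)
  also have "\<dots> = (\<Sum>e\<in>?C. \<Sum>e'\<in>?C. (if e = e' then 1 else 0) *\<^sub>R \<beta> e e')"
  proof (intro sum.cong refl)
    fix e e' assume "e \<in> ?C" "e' \<in> ?C"
    have "(\<Sum>i\<in>Basis. (i \<bullet> e') * (i \<bullet> e)) = e \<bullet> e'"
      by (subst euclidean_inner) (simp add: inner_commute mult.commute)
    then show "(\<Sum>i\<in>Basis. (i \<bullet> e') * (i \<bullet> e)) *\<^sub>R \<beta> e e' = (if e = e' then 1 else 0) *\<^sub>R \<beta> e e'"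
      using gram \<open>e \<in> ?C\<close> \<open>e' \<in> ?C\<close> by simp
  qed
  also have "\<dots> = (\<Sum>e\<in>?C. \<beta> e e)"
    using finC by (intro sum.cong refl) (simp add: if_distrib[of "\<lambda>c. c *\<^sub>R _"] cong: if_cong)
  also have "\<dots> = (\<Sum>e\<in>B. \<beta> e e)" using finC xB nul by simp
  also have "\<dots> = (\<Sum>e\<in>B. b e e)" using eq BT by (intro sum.cong refl) simp
  finally show ?thesis unfolding tangent_trace_def B_def by simp
qed

text \<open>The rough Laplacian in terms of radial extensions: applying \<open>tangent_proj (f x)\<close> to the derivatives of
  \<open>V\<close>, differentiating again and projecting again leaves the projected Laplacian and one more term, which
  comes from the derivative of the first projection.\<close>

definition proj_lap ::
  "('a::euclidean_space \<Rightarrow> 'b::euclidean_space) \<Rightarrow> ('a \<Rightarrow> 'b) \<Rightarrow> 'a \<Rightarrow> 'b" where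
  "proj_lap f V x = tangent_proj (f x) (lap V x) - (\<Sum>e\<in>Basis. (dird e V x \<bullet> f x) *\<^sub>R dird e f x)"

definition radial_extension ::
  "('a::euclidean_space \<Rightarrow> 'b::real_normed_vector) \<Rightarrow> ('a \<Rightarrow> 'b) \<Rightarrow> bool" where
  "radial_extension f g \<longleftrightarrow> Cinf_on (- {0}) g \<and> radial g \<and> (\<forall>x\<in>sphere 0 1. f x = g x)"

lemma sphere_deriv_tangent_proj:
  assumes "radial_extension \<phi> f" "y \<in> sphere 0 1"
  shows "sphere_deriv \<phi> y (tangent_proj y Y) = dird Y f y"
proof -
  have f: "Cinf_on (- {0}) f" "radial f" "\<And>x. x \<in> sphere 0 1 \<Longrightarrow> \<phi> x = f x"
    using assms(1) by (auto simp: radial_extension_def)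
  have y: "y \<noteq> 0" "y \<bullet> y = 1" using assms(2) by (auto simp: dot_square_norm)
  have lin: "linear (\<lambda>e. dird e f y)" by (rule linear_dird[OF f(1)]) (use y in auto)
  have "sphere_deriv \<phi> y (tangent_proj y Y) = dird (tangent_proj y Y) f y"
    by (rule sphere_deriv_eq[OF Cinf_on_has_derivative[OF f(1)] assms(2) _ f(3)])
      (use y in \<open>auto simp: tangent_proj_def inner_diff_left\<close>)
  also have "\<dots> = dird Y f y"
    using linear_diff[OF lin] linear_scale[OF lin] dird_radial[OF f(1,2) y(1)]
    by (simp add: tangent_proj_def)
  finally show ?thesis .
qed

lemma sphere_deriv_radial:
  assumes "radial_extension \<phi> f" "y \<in> sphere 0 1" "Y \<bullet> y = 0"
  shows "sphere_deriv \<phi> y Y = dird Y f y"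
  using sphere_deriv_tangent_proj[OF assms(1,2), of Y] assms(3) by (simp add: tangent_proj_def)

text \<open>The extension \<open>\<lambda>y. tangent_proj y Y\<close> is parallel at \<open>x\<close>, so the correction terms in the second order
  expressions vanish.\<close>

lemma levi_civita_tangent_proj:
  assumes x: "x \<in> sphere 0 1" and "X \<bullet> x = 0" "Y \<bullet> x = 0"
  shows "levi_civita (\<lambda>y. tangent_proj y Y) x X = 0"
proof -
  have "sphere_deriv (\<lambda>y. tangent_proj y Y) x X = - ((Y \<bullet> x) *\<^sub>R X + (Y \<bullet> X) *\<^sub>R x)"
    by (rule sphere_deriv_eq[where g = "\<lambda>y. tangent_proj y Y"
          and g' = "\<lambda>X. - ((Y \<bullet> x) *\<^sub>R X + (Y \<bullet> X) *\<^sub>R x)"])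
      (use assms in \<open>auto intro!: derivative_eq_intros simp: tangent_proj_def[abs_def]\<close>)
  moreover have "x \<bullet> x = 1" using x by (simp add: dot_square_norm)
  ultimately show ?thesis
    using assms unfolding levi_civita_def by (simp add: tangent_proj_def)
qed

lemma tangent_proj_add: "tangent_proj p (a + b) = tangent_proj p a + tangent_proj p b"
  and tangent_proj_diff: "tangent_proj p (a - b) = tangent_proj p a - tangent_proj p b"
  and tangent_proj_scaleR: "tangent_proj p (c *\<^sub>R a) = c *\<^sub>R tangent_proj p a"
  by (simp_all add: tangent_proj_def algebra_simps)

lemma linear_tangent_proj: "linear (tangent_proj p)"
  by (simp add: linear_iff tangent_proj_add tangent_proj_scaleR)

lemma tangent_proj_self: "norm p = 1 \<Longrightarrow> tangent_proj p p = 0"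
  by (simp add: tangent_proj_def dot_square_norm)

lemma tangent_proj_inner: "norm p = 1 \<Longrightarrow> tangent_proj p a \<bullet> p = 0"
  by (simp add: tangent_proj_def inner_diff_left dot_square_norm)

lemma radial_unit:
  assumes "radial f" "\<And>x. x \<in> sphere 0 1 \<Longrightarrow> norm (f x) = 1" "x \<noteq> 0"
  shows "norm (f x) = 1"
  using assms by (metis radial_def sgn_in_sphere)

lemma dird_orthogonal:
  assumes "Cinf_on (- {0}) f" "Cinf_on (- {0}) g" "\<And>x. x \<noteq> 0 \<Longrightarrow> f x \<bullet> g x = c" "x \<noteq> 0"
  shows "dird e f x \<bullet> g x = - (f x \<bullet> dird e g x)"
proof -
  have "dird e (\<lambda>x. f x \<bullet> g x) x = dird e (\<lambda>x. c) x"
    by (rule dird_cong_open[of "- {0}"]) (use assms(3,4) in auto)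
  moreover have "dird e (\<lambda>x. c) x = 0" by (rule dird_eqI) simp
  ultimately show ?thesis using dird_inner[OF assms(1,2), of x e] assms(4) by simp
qed

text \<open>The derivatives of a sphere-valued map are tangent to the sphere.\<close>

lemma dird_unit_orthogonal:
  assumes "Cinf_on (- {0}) f" "\<And>x. x \<noteq> 0 \<Longrightarrow> norm (f x) = 1" "x \<noteq> 0"
  shows "dird e f x \<bullet> f x = 0"
  using dird_orthogonal[OF assms(1,1) _ assms(3), of 1 e] assms(2)
  by (simp add: dot_square_norm inner_commute)

lemma pullback_conn_tangent_proj:
  assumes "radial_extension \<phi> f" "radial_extension V g" "y \<in> sphere 0 1"
  shows "pullback_conn \<phi> V y (tangent_proj y Y) = tangent_proj (f y) (dird Y g y)"
  unfolding pullback_conn_def sphere_deriv_tangent_proj[OF assms(2,3)]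
  using assms(1,3) by (simp add: radial_extension_def)

lemma has_derivative_tangent_proj:
  assumes "Cinf_on (- {0}) f" "Cinf_on (- {0}) w" "x \<noteq> 0"
  shows "((\<lambda>y. tangent_proj (f y) (w y)) has_derivative
     (\<lambda>X. dird X w x - ((w x \<bullet> f x) *\<^sub>R dird X f x + (w x \<bullet> dird X f x + dird X w x \<bullet> f x) *\<^sub>R f x)))
     (at x)"
  unfolding tangent_proj_def
  using Cinf_on_has_derivative[OF assms(1), of x] Cinf_on_has_derivative[OF assms(2), of x] assms(3)
  by (auto intro!: derivative_eq_intros)

lemma second_cov_deriv_radial:
  assumes phi: "radial_extension \<phi> f" and V: "radial_extension V g"
    and unit: "\<And>x. x \<in> sphere 0 1 \<Longrightarrow> norm (f x) = 1"
    and x: "x \<in> sphere 0 1" and X: "X \<bullet> x = 0" and Y: "Y \<bullet> x = 0"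
  shows "second_cov_deriv \<phi> V x X Y
    = tangent_proj (f x) (dird X (dird Y g) x) - (dird Y g x \<bullet> f x) *\<^sub>R dird X f x"
proof -
  have f: "Cinf_on (- {0}) f" "radial f" "\<And>x. x \<in> sphere 0 1 \<Longrightarrow> \<phi> x = f x"
    using phi by (auto simp: radial_extension_def)
  have g: "Cinf_on (- {0}) g" "radial g" using V by (auto simp: radial_extension_def)
  have x0: "x \<noteq> 0" using x by auto
  have nf: "norm (f x) = 1" using unit x by simp
  let ?w = "dird Y g"
  have "sphere_deriv (\<lambda>y. pullback_conn \<phi> V y (tangent_proj y Y)) x X
    = dird X ?w x - ((?w x \<bullet> f x) *\<^sub>R dird X f x + (?w x \<bullet> dird X f x + dird X ?w x \<bullet> f x) *\<^sub>R f x)"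
    by (rule sphere_deriv_eq[OF has_derivative_tangent_proj[OF f(1) Cinf_on_dird[OF g(1)] x0] x X])
      (rule pullback_conn_tangent_proj[OF phi V])
  moreover have "tangent_proj (f x) (dird X f x) = dird X f x"
    using dird_unit_orthogonal[OF f(1) radial_unit[OF f(2) unit] x0, of X]
    by (simp add: tangent_proj_def)
  ultimately have *: "pullback_conn \<phi> (\<lambda>y. pullback_conn \<phi> V y (tangent_proj y Y)) x X
    = tangent_proj (f x) (dird X ?w x) - (?w x \<bullet> f x) *\<^sub>R dird X f x"
    unfolding pullback_conn_def[of _ "\<lambda>y. pullback_conn \<phi> V y (tangent_proj y Y)"]
    by (simp add: f(3)[OF x] tangent_proj_add tangent_proj_diff tangent_proj_scaleR
        tangent_proj_self[OF nf])
  have "sphere_deriv V x 0 = 0"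
    using sphere_deriv_radial[OF V x, of 0] linear_0[OF linear_dird[OF g(1), of x]] x0 by simp
  then have "pullback_conn \<phi> V x (levi_civita (\<lambda>y. tangent_proj y Y) x X) = 0"
    unfolding levi_civita_tangent_proj[OF x X Y] pullback_conn_def by (simp add: tangent_proj_def)
  then show ?thesis unfolding second_cov_deriv_def * by simp
qed

lemma rough_laplacian_radial:
  assumes phi: "radial_extension \<phi> f" and V: "radial_extension V g"
    and unit: "\<And>x. x \<in> sphere 0 1 \<Longrightarrow> norm (f x) = 1"
    and x: "x \<in> sphere 0 1"
  shows "rough_laplacian \<phi> V x = proj_lap f g x"
proof -
  have f: "Cinf_on (- {0}) f" "radial f" using phi by (auto simp: radial_extension_def)
  have g: "Cinf_on (- {0}) g" "radial g" using V by (auto simp: radial_extension_def)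
  have x0: "x \<noteq> 0" using x by auto
  let ?\<beta> = "\<lambda>X Y. tangent_proj (f x) (dird X (dird Y g) x) - (dird Y g x \<bullet> f x) *\<^sub>R dird X f x"
  have b1: "linear (\<lambda>X. dird X (dird Y g) x)" "linear (\<lambda>Y. dird X (dird Y g) x)" for X Y
    using bilinear_dird_second[OF _ g(1), of x] x0 by (auto simp: bilinear_def)
  have b2: "linear (\<lambda>X. dird X f x)" "linear (\<lambda>X. dird X g x)"
    using linear_dird[OF f(1)] linear_dird[OF g(1)] x0 by auto
  have "bilinear ?\<beta>"
    unfolding bilinear_def linear_iff
    using b1 b2
    by (auto simp: linear_iff tangent_proj_add tangent_proj_scaleR algebra_simps)
  moreover have "?\<beta> x x = 0"
    using dird_dird_radial[OF g x0] dird_radial[OF g x0] by (simp add: tangent_proj_def)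
  ultimately have "tangent_trace x (second_cov_deriv \<phi> V x) = (\<Sum>e\<in>Basis. ?\<beta> e e)"
    by (intro tangent_trace_eq[OF x]) (use second_cov_deriv_radial[OF phi V unit x] in auto)
  then show ?thesis
    unfolding rough_laplacian_def proj_lap_def lap_def linear_sum[OF linear_tangent_proj]
    by (simp add: sum_subtractf)
qed

lemma tension_radial:
  assumes phi: "radial_extension \<phi> f"
    and unit: "\<And>x. x \<in> sphere 0 1 \<Longrightarrow> norm (f x) = 1"
    and x: "x \<in> sphere 0 1"
  shows "tension \<phi> x = tangent_proj (f x) (lap f x)"
proof -
  have f: "Cinf_on (- {0}) f" "radial f" "\<And>x. x \<in> sphere 0 1 \<Longrightarrow> \<phi> x = f x"
    using phi by (auto simp: radial_extension_def)
  have x0: "x \<noteq> 0" using x by auto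
  let ?\<beta> = "\<lambda>X Y. tangent_proj (f x) (dird X (dird Y f) x)"
  have b1: "linear (\<lambda>X. dird X (dird Y f) x)" "linear (\<lambda>Y. dird X (dird Y f) x)" for X Y
    using bilinear_dird_second[OF _ f(1), of x] x0 by (auto simp: bilinear_def)
  have "bilinear ?\<beta>"
    unfolding bilinear_def linear_iff
    using b1 by (auto simp: linear_iff tangent_proj_add tangent_proj_scaleR)
  moreover have "?\<beta> x x = 0"
    using dird_dird_radial[OF f(1,2) x0] by (simp add: tangent_proj_def)
  moreover have "cov_deriv_differential \<phi> x X Y = ?\<beta> X Y" if X: "X \<bullet> x = 0" and Y: "Y \<bullet> x = 0" for X Y
  proof -
    have "sphere_deriv (\<lambda>y. sphere_deriv \<phi> y (tangent_proj y Y)) x X = dird X (dird Y f) x"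
      by (rule sphere_deriv_eq[OF Cinf_on_has_derivative[OF Cinf_on_dird[OF f(1)]] x X
            sphere_deriv_tangent_proj[OF phi]]) (use x0 in auto)
    moreover have "sphere_deriv \<phi> x 0 = 0"
      using sphere_deriv_radial[OF phi x, of 0] linear_0[OF linear_dird[OF f(1), of x]] x0 by simp
    ultimately show ?thesis
      unfolding cov_deriv_differential_def levi_civita_tangent_proj[OF x X Y] pullback_conn_def
      by (simp add: f(3)[OF x])
  qed
  ultimately have "tangent_trace x (cov_deriv_differential \<phi> x) = (\<Sum>e\<in>Basis. ?\<beta> e e)"
    by (intro tangent_trace_eq[OF x]) auto
  then show ?thesis
    unfolding tension_def lap_def linear_sum[OF linear_tangent_proj] by simp
qed

lemma differential_norm_sq_radial:
  assumes phi: "radial_extension \<phi> f" and x: "x \<in> sphere 0 1"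
  shows "differential_norm_sq \<phi> x = (\<Sum>e\<in>Basis. (norm (dird e f x))\<^sup>2)"
proof -
  have f: "Cinf_on (- {0}) f" "radial f" using phi by (auto simp: radial_extension_def)
  have x0: "x \<noteq> 0" using x by auto
  have b2: "linear (\<lambda>X. dird X f x)" using linear_dird[OF f(1)] x0 by auto
  have "tangent_trace x (\<lambda>X Y. sphere_deriv \<phi> x X \<bullet> sphere_deriv \<phi> x Y)
    = (\<Sum>e\<in>Basis. dird e f x \<bullet> dird e f x)"
  proof (rule tangent_trace_eq[OF x, where \<beta> = "\<lambda>X Y. dird X f x \<bullet> dird Y f x"])
    show "bilinear (\<lambda>X Y. dird X f x \<bullet> dird Y f x)"
      using b2 by (auto simp: bilinear_def linear_iff inner_simps)
  qed (use dird_radial[OF f x0] sphere_deriv_radial[OF phi x] in auto)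
  then show ?thesis unfolding differential_norm_sq_def by (simp add: dot_square_norm)
qed

lemma cov_deriv_norm_sq_radial:
  assumes phi: "radial_extension \<phi> f" and V: "radial_extension V g" and x: "x \<in> sphere 0 1"
  shows "cov_deriv_norm_sq \<phi> V x = (\<Sum>e\<in>Basis. (norm (tangent_proj (f x) (dird e g x)))\<^sup>2)"
proof -
  have f: "\<phi> x = f x" using phi x by (auto simp: radial_extension_def)
  have g: "Cinf_on (- {0}) g" "radial g" using V by (auto simp: radial_extension_def)
  have x0: "x \<noteq> 0" using x by auto
  have b2: "linear (\<lambda>X. dird X g x)" using linear_dird[OF g(1)] x0 by auto
  let ?P = "tangent_proj (f x)"
  have "tangent_trace x (\<lambda>X Y. pullback_conn \<phi> V x X \<bullet> pullback_conn \<phi> V x Y)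
    = (\<Sum>e\<in>Basis. ?P (dird e g x) \<bullet> ?P (dird e g x))"
  proof (rule tangent_trace_eq[OF x, where \<beta> = "\<lambda>X Y. ?P (dird X g x) \<bullet> ?P (dird Y g x)"])
    show "bilinear (\<lambda>X Y. ?P (dird X g x) \<bullet> ?P (dird Y g x))"
      using b2 by (auto simp: bilinear_def linear_iff inner_simps tangent_proj_add tangent_proj_scaleR)
    show "?P (dird x g x) \<bullet> ?P (dird x g x) = 0"
      using dird_radial[OF g x0] by (simp add: tangent_proj_def)
  qed (simp add: pullback_conn_def f sphere_deriv_radial[OF V x])
  then show ?thesis unfolding cov_deriv_norm_sq_def by (simp add: dot_square_norm)
qed

section \<open>Integration on the sphere\<close>

lemma scale_measure_eq_density: "scale_measure c M = density M (\<lambda>_. c)"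
  by (rule measure_eqI) (auto simp: emeasure_density nn_integral_cmult_indicator)

abbreviation punctured_ball :: "'a::euclidean_space set" where
  "punctured_ball \<equiv> ball 0 1 - {0}"

lemma punctured_ball_sets: "punctured_ball \<inter> space lborel \<in> sets lborel"
  by auto

lemma sgn_measurable_sphere:
  "sgn \<in> measurable (restrict_space lborel punctured_ball) (restrict_space borel (sphere (0::'a::euclidean_space) 1))"
proof (rule measurable_restrict_space2)
  show "sgn \<in> space (restrict_space lborel punctured_ball) \<rightarrow> sphere (0::'a) 1"
    by (auto simp: space_restrict_space norm_sgn)
  show "sgn \<in> borel_measurable (restrict_space lborel (punctured_ball :: 'a set))"
    by (rule measurable_restrict_space1) simp
qed

lemma space_sphere_measure: "space (sphere_measure :: 'a::euclidean_space measure) = sphere 0 1"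
  by (simp add: sphere_measure_def space_scale_measure space_restrict_space)

lemma sets_sphere_measure:
  "sets (sphere_measure :: 'a::euclidean_space measure) = sets (restrict_space borel (sphere 0 1))"
  by (simp add: sphere_measure_def)

lemma emeasure_sphere_measure:
  "emeasure (sphere_measure :: 'a::euclidean_space measure) (sphere 0 1)
    = of_nat DIM('a) * emeasure lborel (ball (0::'a) 1)"
proof -
  have "sgn -` sphere 0 1 \<inter> (punctured_ball :: 'a set) = punctured_ball"
    by (auto simp: norm_sgn)
  moreover have "emeasure lborel (punctured_ball :: 'a set) = emeasure lborel (ball (0::'a) 1)"
    by (rule emeasure_Diff_null_set) auto
  moreover have "sphere (0::'a) 1 \<in> sets (restrict_space borel (sphere 0 1))"
    by (simp add: sets_restrict_space_iff)
  ultimately show ?thesis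
    by (simp add: sphere_measure_def emeasure_distr[OF sgn_measurable_sphere]
        emeasure_restrict_space space_restrict_space)
qed

lemma finite_sphere_measure: "finite_measure (sphere_measure :: 'a::euclidean_space measure)"
  using emeasure_lborel_ball_finite[of "0::'a" 1]
  by (intro finite_measureI)
    (auto simp: space_sphere_measure emeasure_sphere_measure ennreal_mult_eq_top_iff)

definition sphere_area :: "'a::euclidean_space itself \<Rightarrow> real" where
  "sphere_area _ = measure (sphere_measure :: 'a measure) (sphere 0 1)"

lemma sphere_area_pos: "sphere_area TYPE('a::euclidean_space) > 0"
proof -
  have "sphere_area TYPE('a) = real DIM('a) * measure lborel (ball (0::'a) 1)"
    unfolding sphere_area_def measure_def emeasure_sphere_measure
    by (simp add: enn2real_mult)
  then show ?thesis using content_ball_pos[of 1 "0::'a"] by simp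
qed

lemma sphere_integral_const:
  "(\<integral>x. c \<partial>(sphere_measure :: 'a::euclidean_space measure)) = sphere_area TYPE('a) * (c::real)"
  by (simp add: sphere_area_def space_sphere_measure)

lemma sphere_measurable:
  "continuous_on (sphere 0 1) f \<Longrightarrow> (f :: 'a::euclidean_space \<Rightarrow> real) \<in> borel_measurable sphere_measure"
  by (subst measurable_cong_sets[OF sets_sphere_measure refl])
    (rule borel_measurable_continuous_on_restrict)

lemma sphere_bounded:
  assumes "continuous_on (sphere 0 1) (f :: 'a::euclidean_space \<Rightarrow> 'b::real_normed_vector)"
  obtains B where "B \<ge> 0" "\<And>x. x \<in> sphere 0 1 \<Longrightarrow> norm (f x) \<le> B"
proof -
  have "bounded (f ` sphere 0 1)"
    by (intro compact_imp_bounded compact_continuous_image assms compact_sphere)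
  then obtain B where "\<forall>x\<in>sphere 0 1. norm (f x) \<le> B" by (auto simp: bounded_iff)
  then show ?thesis by (intro that[of "max B 0"]) (auto simp: le_max_iff_disj)
qed

lemma sphere_integrable:
  assumes "continuous_on (sphere 0 1) (f :: 'a::euclidean_space \<Rightarrow> real)"
  shows "integrable sphere_measure f"
proof -
  obtain B where "\<And>x. x \<in> sphere 0 1 \<Longrightarrow> norm (f x) \<le> B" using sphere_bounded[OF assms] by metis
  then show ?thesis
    by (intro finite_measure.integrable_const_bound[OF finite_sphere_measure, where B = B]
        sphere_measurable assms) (auto simp: space_sphere_measure)
qed

lemma sphere_integral_cong:
  fixes f g :: "'a::euclidean_space \<Rightarrow> real"
  shows "(\<And>x. x \<in> sphere 0 1 \<Longrightarrow> f x = g x) \<Longrightarrow>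
    (\<integral>x. f x \<partial>sphere_measure) = (\<integral>x. g x \<partial>sphere_measure)"
  by (rule Bochner_Integration.integral_cong) (auto simp: space_sphere_measure)

lemma sphere_integral_bound:
  fixes f :: "'a::euclidean_space \<Rightarrow> real"
  assumes "\<And>x. x \<in> sphere 0 1 \<Longrightarrow> \<bar>f x\<bar> \<le> B" "continuous_on (sphere 0 1) f"
  shows "\<bar>\<integral>x. f x \<partial>sphere_measure\<bar> \<le> sphere_area TYPE('a) * B"
proof -
  have "\<bar>\<integral>x. f x \<partial>sphere_measure\<bar> \<le> (\<integral>x. \<bar>f x\<bar> \<partial>sphere_measure)"
    by (rule integral_abs_bound)
  also have "\<dots> \<le> (\<integral>x. B \<partial>(sphere_measure :: 'a measure))"
    by (rule integral_mono) (use assms in \<open>auto intro!: sphere_integrable continuous_intros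
        simp: space_sphere_measure\<close>)
  finally show ?thesis unfolding sphere_integral_const .
qed

lemma sphere_integral_eq_ball:
  fixes f :: "'a::euclidean_space \<Rightarrow> real"
  assumes "continuous_on (sphere 0 1) f"
  shows "(\<integral>x. f x \<partial>sphere_measure)
      = DIM('a) * (\<integral>x. indicator punctured_ball x *\<^sub>R f (sgn x) \<partial>lborel)"
    and "(\<lambda>x. indicator punctured_ball x *\<^sub>R f (sgn x)) \<in> borel_measurable lborel"
proof -
  let ?M = "distr (restrict_space lborel punctured_ball) (restrict_space borel (sphere (0::'a) 1)) sgn"
  have f: "f \<in> borel_measurable (restrict_space borel (sphere 0 1))"
    using assms by (rule borel_measurable_continuous_on_restrict)
  have "(\<integral>x. f x \<partial>sphere_measure) = (\<integral>x. f x \<partial>density ?M (\<lambda>_. ennreal DIM('a)))"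
    by (simp add: sphere_measure_def scale_measure_eq_density ennreal_of_nat_eq_real_of_nat)
  also have "\<dots> = (\<integral>x. DIM('a) *\<^sub>R f x \<partial>?M)"
    using f by (intro integral_density) auto
  also have "\<dots> = DIM('a) * (\<integral>x. f x \<partial>?M)" by simp
  also have "(\<integral>x. f x \<partial>?M) = (\<integral>x. f (sgn x) \<partial>restrict_space lborel punctured_ball)"
    by (rule integral_distr[OF sgn_measurable_sphere f])
  also have "\<dots> = (\<integral>x. indicator punctured_ball x *\<^sub>R f (sgn x) \<partial>lborel)"
    by (rule integral_restrict_space[OF punctured_ball_sets])
  finally show "(\<integral>x. f x \<partial>sphere_measure)
      = DIM('a) * (\<integral>x. indicator punctured_ball x *\<^sub>R f (sgn x) \<partial>lborel)" .
  show "(\<lambda>x. indicator punctured_ball x *\<^sub>R f (sgn x)) \<in> borel_measurable lborel"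
    using measurable_compose[OF sgn_measurable_sphere f]
    by (subst (asm) borel_measurable_restrict_space_iff[OF punctured_ball_sets])
qed

section \<open>The divergence theorem\<close>

lemma lborel_integral_translate:
  fixes g :: "'a::euclidean_space \<Rightarrow> real"
  assumes "integrable lborel g"
  shows "integrable lborel (\<lambda>x. g (x + c))" "(\<integral>x. g (x + c) \<partial>lborel) = (\<integral>x. g x \<partial>lborel)"
proof -
  have "integrable (distr lborel borel ((+) c)) g" using assms by (simp add: lborel_distr_plus)
  then show "integrable lborel (\<lambda>x. g (x + c))"
    using integrable_distr[of "(+) c" lborel borel g] by (simp add: add.commute)
  have "(\<integral>x. g x \<partial>lborel) = (\<integral>x. g x \<partial>distr lborel borel ((+) c))" by (simp add: lborel_distr_plus)
  also have "\<dots> = (\<integral>x. g (x + c) \<partial>lborel)"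
    using integral_distr[of "(+) c" lborel borel g] assms by (simp add: add.commute)
  finally show "(\<integral>x. g (x + c) \<partial>lborel) = (\<integral>x. g x \<partial>lborel)" by simp
qed

lemma integrable_supported_in_ball:
  fixes g :: "'a::euclidean_space \<Rightarrow> real"
  assumes "continuous_on UNIV g" "\<And>x. norm x > 1 \<Longrightarrow> g x = 0"
  shows "integrable lborel g"
proof -
  have "integrable lborel (\<lambda>x. indicator (cball 0 1) x *\<^sub>R g x)"
    using assms(1) by (intro borel_integrable_compact) (auto intro: continuous_on_subset)
  moreover have "(\<lambda>x. indicator (cball 0 1) x *\<^sub>R g x) = g"
    using assms(2) by (auto simp: indicator_def not_le fun_eq_iff)
  ultimately show ?thesis by simp
qed

text \<open>The difference quotients have integral zero because Lebesgue measure is invariant under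
  translations, and they converge dominatedly to the derivative.\<close>

lemma integral_derivative_eq_0:
  fixes g :: "'a::euclidean_space \<Rightarrow> real"
  assumes der: "\<And>x. (g has_derivative g' x) (at x)" and cont: "continuous_on UNIV (\<lambda>x. g' x e)"
    and supp: "\<And>x. 1 \<le> norm x \<Longrightarrow> g x = 0" and e: "norm e = 1"
  shows "integrable lborel (\<lambda>x. g' x e)" "(\<integral>x. g' x e \<partial>lborel) = 0"
proof -
  have supp': "g' x e = 0" if "norm x > 1" for x
  proof -
    have "open (- cball (0::'a) 1)" by auto
    then have "(g has_derivative (\<lambda>_. 0)) (at x)"
      using has_derivative_transform_within_open[of "\<lambda>_. 0" "\<lambda>_. 0" x UNIV "- cball 0 1" g] supp that
      by auto
    then show ?thesis using has_derivative_unique[OF der] by metis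
  qed
  show int': "integrable lborel (\<lambda>x. g' x e)"
    by (rule integrable_supported_in_ball[OF cont supp'])
  have contg: "continuous_on UNIV g"
    using der by (auto simp: continuous_on_eq_continuous_at intro: has_derivative_continuous)
  have int: "integrable lborel g"
    by (rule integrable_supported_in_ball[OF contg]) (simp add: supp)
  have "bounded ((\<lambda>x. g' x e) ` cball 0 1)"
    by (intro compact_imp_bounded compact_continuous_image continuous_on_subset[OF cont]) auto
  then obtain M0 where "\<forall>x\<in>cball 0 1. \<bar>g' x e\<bar> \<le> M0" by (auto simp: bounded_iff)
  then have M0: "\<And>x. norm x \<le> 1 \<Longrightarrow> \<bar>g' x e\<bar> \<le> M0" by simp
  define M where "M = max M0 0"
  have M: "\<bar>g' x e\<bar> \<le> M" for x
    using M0[of x] supp'[of x] by (cases "norm x \<le> 1") (auto simp: M_def)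
  define s where "s n = inverse (real (Suc n))" for n
  have s: "0 < s n" "s n \<le> 1" for n by (auto simp: s_def divide_simps)
  define u where "u n x = (g (x + s n *\<^sub>R e) - g x) / s n" for n x
  have line: "((\<lambda>z. g (x + z *\<^sub>R e)) has_real_derivative g' (x + z *\<^sub>R e) e) (at z)" for x z
  proof -
    have "((\<lambda>z. g (x + z *\<^sub>R e)) has_derivative (\<lambda>w. g' (x + z *\<^sub>R e) (w *\<^sub>R e))) (at z)"
      by (rule has_derivative_compose[OF _ der]) (auto intro!: derivative_eq_intros)
    then show ?thesis
      using linear_scale[OF has_derivative_linear[OF der[of "x + z *\<^sub>R e"]]]
      by (simp add: has_field_derivative_def mult_commute_abs)
  qed
  have lim: "(\<lambda>n. u n x) \<longlonglongrightarrow> g' x e" for x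
  proof -
    have "((\<lambda>h. (g (x + h *\<^sub>R e) - g x) / h) \<longlongrightarrow> g' x e) (at 0)"
      using line[of x 0] by (simp add: DERIV_def)
    moreover have "filterlim s (at 0) sequentially"
      using LIMSEQ_inverse_real_of_nat s
      by (auto simp: filterlim_at s_def[abs_def] intro!: always_eventually)
    ultimately show ?thesis unfolding u_def by (rule filterlim_compose)
  qed
  have bound: "norm (u n x) \<le> M * indicator (cball 0 2) x" for n x
  proof (cases "norm x \<le> 2")
    case True
    obtain z where "g (x + s n *\<^sub>R e) - g (x + 0 *\<^sub>R e) = (s n - 0) * g' (x + z *\<^sub>R e) e"
      using MVT2[OF s(1)[of n], of "\<lambda>z. g (x + z *\<^sub>R e)" "\<lambda>z. g' (x + z *\<^sub>R e) e"] line by blast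
    then have "u n x = g' (x + z *\<^sub>R e) e" using s(1)[of n] by (simp add: u_def)
    then show ?thesis using M True by simp
  next
    case False
    have "norm (s n *\<^sub>R e) \<le> 1" using s[of n] e by simp
    then have "norm (x + s n *\<^sub>R e) \<ge> 1" using False norm_triangle_ineq4[of "x + s n *\<^sub>R e" "s n *\<^sub>R e"]
      by simp
    then show ?thesis using False supp by (simp add: u_def)
  qed
  have "(\<lambda>n. \<integral>x. u n x \<partial>lborel) \<longlonglongrightarrow> (\<integral>x. g' x e \<partial>lborel)"
  proof (rule integral_dominated_convergence[where w = "\<lambda>x. M * indicator (cball 0 2) x"])
    show "(\<lambda>x. g' x e) \<in> borel_measurable lborel" using int' by simp
    show "u n \<in> borel_measurable lborel" for n
      unfolding u_def using lborel_integral_translate(1)[OF int, of "s n *\<^sub>R e"] int by simp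
    show "integrable lborel (\<lambda>x. M * indicator (cball (0::'a) 2) x)"
      using emeasure_lborel_cball_finite[of "0::'a" 2]
      by (intro integrable_mult_right integrable_real_indicator) auto
  qed (use lim bound in auto)
  moreover have "(\<integral>x. u n x \<partial>lborel) = 0" for n
    unfolding u_def using lborel_integral_translate[OF int, of "s n *\<^sub>R e"] int by simp
  ultimately show "(\<integral>x. g' x e \<partial>lborel) = 0" by (simp add: LIMSEQ_const_iff)
qed

lemma has_derivative_ramp:
  "((\<lambda>t. (max 0 t)\<^sup>2) has_real_derivative 2 * max 0 t) (at (t::real))"
proof -
  consider "t > 0" | "t < 0" | "t = 0" by linarith
  then show ?thesis
  proof cases
    case 1
    have "((\<lambda>t. t\<^sup>2) has_real_derivative 2 * t) (at t)" by (auto intro!: derivative_eq_intros)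
    from has_field_derivative_transform_within_open[OF this, of "{0<..}"] 1 show ?thesis by auto
  next
    case 2
    have "((\<lambda>t. 0) has_real_derivative 0) (at t)" by (auto intro!: derivative_eq_intros)
    from has_field_derivative_transform_within_open[OF this, of "{..<0}"] 2 show ?thesis by auto
  next
    case 3
    have "((\<lambda>h::real. max 0 h) \<longlongrightarrow> max 0 0) (at 0)" by (intro tendsto_intros)
    moreover have "(max 0 h)\<^sup>2 / h = max 0 h" if "h \<noteq> 0" for h :: real
      using that by (auto simp: max_def power2_eq_square)
    ultimately have "((\<lambda>h::real. (max 0 h)\<^sup>2 / h) \<longlongrightarrow> 0) (at 0)"
      by (subst Lim_cong_within[where g = "max 0"]) auto
    then show ?thesis using 3 by (simp add: DERIV_def)
  qed
qed

text \<open>Radial cut-off weights, as functions of \<open>p = (norm x)\<^sup>2\<close>: continuously differentiable,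
  vanishing near the origin and outside the unit ball, and converging to \<open>p\<close> in between.\<close>

lemma cutoff_exists:
  obtains h h' :: "nat \<Rightarrow> real \<Rightarrow> real" and d :: "nat \<Rightarrow> real"
  where "\<And>k p. (h k has_real_derivative h' k p) (at p)" "\<And>k. continuous_on UNIV (h' k)"
    "\<And>k. d k > 0" "\<And>k p. p < d k \<Longrightarrow> h k p = 0" "\<And>k p. p < d k \<Longrightarrow> h' k p = 0"
    "\<And>k p. p \<ge> 1 \<Longrightarrow> h k p = 0"
    "\<And>p. 0 < p \<Longrightarrow> p < 1 \<Longrightarrow> (\<lambda>k. h k p) \<longlonglongrightarrow> p"
    "\<And>k p. p \<ge> 0 \<Longrightarrow> \<bar>h k p\<bar> \<le> p"
proof -
  \<comment> \<open>A continuously differentiable step: zero for \<open>t \<le> 0\<close> and tending to one as \<open>t\<close> grows.\<close>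
  define T where "T t = (max 0 t)\<^sup>2 / (1 + (max 0 t)\<^sup>2)" for t :: real
  define T' where "T' t = 2 * max 0 t / (1 + (max 0 t)\<^sup>2)\<^sup>2" for t :: real
  have pos: "1 + (max 0 t)\<^sup>2 > 0" for t :: real by (simp add: add_pos_nonneg)
  have T: "(T has_real_derivative T' t) (at t)" for t
  proof -
    have "(T has_real_derivative
       (2 * max 0 t * (1 + (max 0 t)\<^sup>2) - (max 0 t)\<^sup>2 * (0 + 2 * max 0 t)) / ((1 + (max 0 t)\<^sup>2) * (1 + (max 0 t)\<^sup>2))) (at t)"
      unfolding T_def by (intro DERIV_divide DERIV_add DERIV_const has_derivative_ramp)
        (use pos[of t] in auto)
    then show ?thesis by (simp add: T'_def power2_eq_square algebra_simps)
  qed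
  have cT: "continuous_on UNIV T" and cT': "continuous_on UNIV T'"
    unfolding T_def T'_def using pos by (auto intro!: continuous_intros simp: less_imp_neq[THEN not_sym])
  have T0: "T t = 0" "T' t = 0" if "t \<le> 0" for t using that by (auto simp: T_def T'_def max_def)
  have T1: "0 \<le> T t" "T t \<le> 1" for t using pos[of t] by (auto simp: T_def)
  have lim: "(\<lambda>k. T (real (Suc k) * a - b)) \<longlonglongrightarrow> 1" if "a > 0" for a b
    unfolding T_def using that by real_asymp
  define h where "h k p = p * (T (real (Suc k) * p - 1) * T (real (Suc k) * (1 - p)))" for k p
  define h' where "h' k p = T (real (Suc k) * p - 1) * T (real (Suc k) * (1 - p))
     + (T' (real (Suc k) * p - 1) * real (Suc k) * T (real (Suc k) * (1 - p))
     - T' (real (Suc k) * (1 - p)) * real (Suc k) * T (real (Suc k) * p - 1)) * p" for k p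
  show ?thesis
  proof (rule that[of h h' "\<lambda>k. inverse (real (Suc k))"])
    show "(h k has_real_derivative h' k p) (at p)" for k p
      unfolding h_def h'_def
      by (rule derivative_eq_intros DERIV_chain2[OF T] refl)+ (simp add: algebra_simps)
    show "continuous_on UNIV (h' k)" for k
      unfolding h'_def by (intro continuous_intros continuous_on_compose2[OF cT] continuous_on_compose2[OF cT']) auto
    show "inverse (real (Suc k)) > 0" for k by simp
    fix k and p :: real
    show "h k p = 0" "h' k p = 0" if "p < inverse (real (Suc k))"
    proof -
      have "real (Suc k) * p - 1 \<le> 0" using that by (simp add: field_simps)
      then show "h k p = 0" "h' k p = 0" using T0 by (auto simp: h_def h'_def)
    qed
    show "h k p = 0" if "p \<ge> 1"
      using that T0(1)[of "real (Suc k) * (1 - p)"] by (simp add: h_def mult_nonneg_nonpos)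
    show "\<bar>h k p\<bar> \<le> p" if "p \<ge> 0"
      using that T1 by (auto simp: h_def abs_mult intro!: mult_left_le mult_le_one)
  next
    fix p :: real assume p: "0 < p" "p < 1"
    have "(\<lambda>k. p * (T (real (Suc k) * p - 1) * T (real (Suc k) * (1 - p) - 0))) \<longlonglongrightarrow> p * (1 * 1)"
      by (intro tendsto_intros lim) (use p in auto)
    then show "(\<lambda>k. h k p) \<longlonglongrightarrow> p" by (simp add: h_def)
  qed
qed

text \<open>A vector field \<open>X\<close> on the punctured space, tangent to all spheres around the origin, stays so
  when it is multiplied by a radial weight, and its divergence is multiplied by that weight. The
  integral of the divergence of a compactly supported field vanishes; the
  weights \<open>h k\<close> below turn this into a statement on the unit ball, that is, on the sphere.\<close>

lemma sphere_divergence_theorem: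
  fixes X :: "'a::euclidean_space \<Rightarrow> 'a \<Rightarrow> real"
  assumes X: "\<And>e. e \<in> Basis \<Longrightarrow> Cinf_on (- {0}) (X e)"
    and tang: "\<And>x. x \<noteq> 0 \<Longrightarrow> (\<Sum>e\<in>Basis. (x \<bullet> e) * X e x) = 0"
    and F: "continuous_on (sphere 0 1) F"
    and div: "\<And>x. x \<noteq> 0 \<Longrightarrow> (\<Sum>e\<in>Basis. dird e (X e) x) * (x \<bullet> x) = F (sgn x)"
  shows "(\<integral>x. F x \<partial>sphere_measure) = 0"
proof -
  obtain h h' :: "nat \<Rightarrow> real \<Rightarrow> real" and d :: "nat \<Rightarrow> real" where
    h: "\<And>k p. (h k has_real_derivative h' k p) (at p)" and h'c: "\<And>k. continuous_on UNIV (h' k)"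
    and d: "\<And>k. d k > 0" "\<And>k p. p < d k \<Longrightarrow> h k p = 0" "\<And>k p. p < d k \<Longrightarrow> h' k p = 0"
    and h1: "\<And>k p. p \<ge> 1 \<Longrightarrow> h k p = 0"
    and hlim: "\<And>p. 0 < p \<Longrightarrow> p < 1 \<Longrightarrow> (\<lambda>k. h k p) \<longlonglongrightarrow> p"
    and hb: "\<And>k p. p \<ge> 0 \<Longrightarrow> \<bar>h k p\<bar> \<le> p"
    by (rule cutoff_exists) blast
  define g' where "g' k e x v = (if x = 0 then 0 else
     h k (x \<bullet> x) * dird v (X e) x + (h' k (x \<bullet> x) * (2 * (x \<bullet> v))) * X e x)" for k e x v
  define w where "w k x = (if x = 0 then 0 else h k (x \<bullet> x) / (x \<bullet> x) * F (sgn x))" for k x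
  have hc: "continuous_on UNIV (h k)" for k
    using h by (auto simp: continuous_on_eq_continuous_at intro: DERIV_isCont)
  \<comment> \<open>The fields \<open>X e\<close> may be singular at the origin; there the weights are zero.\<close>
  have near0: "g' k e x v = 0" if "x \<in> ball 0 (sqrt (d k))" for k e x v
  proof -
    have "norm x < sqrt (d k)" using that by simp
    then have "x \<bullet> x < d k"
      by (metis d(1) norm_eq_sqrt_inner real_sqrt_less_iff)
    then show ?thesis using d(2,3) by (simp add: g'_def)
  qed
  have der: "((\<lambda>x. h k (x \<bullet> x) * X e x) has_derivative g' k e x) (at x)" if e: "e \<in> Basis" for k e x
  proof (cases "x = 0")
    case False
    have "((\<lambda>x. h k (x \<bullet> x)) has_derivative (\<lambda>v. h' k (x \<bullet> x) * (2 * (x \<bullet> v)))) (at x)"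
      by (rule has_derivative_eq_rhs[OF has_derivative_compose[OF has_derivative_inner[OF
              has_derivative_ident has_derivative_ident] has_field_derivative_imp_has_derivative[OF h]]])
        (auto simp: inner_commute)
    from has_derivative_mult[OF this Cinf_on_has_derivative[OF X[OF e], of x]] False
    show ?thesis by (simp add: g'_def[abs_def])
  next
    case True
    have "((\<lambda>x. h k (x \<bullet> x) * X e x) has_derivative (\<lambda>v. 0)) (at x)"
    proof (rule has_derivative_transform_within_open[where s = "ball 0 (sqrt (d k))" and f = "\<lambda>x. 0"])
      fix y :: 'a assume "y \<in> ball 0 (sqrt (d k))"
      then have "y \<bullet> y < d k" by (simp add: norm_eq_sqrt_inner)
      then show "0 = h k (y \<bullet> y) * X e y" using d(2) by simp
    qed (use True d(1) in auto)
    moreover have "g' k e x = (\<lambda>v. 0)" using True by (auto simp: g'_def)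
    ultimately show ?thesis by simp
  qed
  have cont: "continuous_on UNIV (\<lambda>x. g' k e x e)" if e: "e \<in> Basis" for k e
  proof -
    have "continuous_on (- {0}) (\<lambda>x. h k (x \<bullet> x) * dird e (X e) x + (h' k (x \<bullet> x) * (2 * (x \<bullet> e))) * X e x)"
      by (intro continuous_intros continuous_on_compose2[OF hc] continuous_on_compose2[OF h'c]
          Cinf_on_continuous[OF Cinf_on_dird[OF X[OF e]]] Cinf_on_continuous[OF X[OF e]]) auto
    then have "continuous_on (- {0}) (\<lambda>x. g' k e x e)"
      by (rule continuous_on_eq) (simp add: g'_def)
    moreover have "continuous_on (ball 0 (sqrt (d k))) (\<lambda>x. g' k e x e)"
      using continuous_on_const[of _ 0] by (rule continuous_on_eq) (simp add: near0)
    ultimately have "continuous_on (- {0} \<union> ball 0 (sqrt (d k))) (\<lambda>x. g' k e x e)"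
      by (intro continuous_on_open_Un) auto
    moreover have "- {0} \<union> ball 0 (sqrt (d k)) = (UNIV :: 'a set)" using d(1)[of k] by auto
    ultimately show ?thesis by simp
  qed
  have int: "integrable lborel (\<lambda>x. g' k e x e)" "(\<integral>x. g' k e x e \<partial>lborel) = 0"
    if e: "e \<in> Basis" for k e
  proof -
    have "h k (x \<bullet> x) * X e x = 0" if "1 \<le> norm x" for x
      using h1[of "x \<bullet> x"] that by (simp add: dot_square_norm)
    then show "integrable lborel (\<lambda>x. g' k e x e)" "(\<integral>x. g' k e x e \<partial>lborel) = 0"
      using integral_derivative_eq_0[OF der[OF e] cont[OF e]] e by auto
  qed
  \<comment> \<open>The derivative of the weight is radial, hence orthogonal to the field.\<close>
  have wsum: "w k x = (\<Sum>e\<in>Basis. g' k e x e)" for k x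
  proof (cases "x = 0")
    case False
    have "(\<Sum>e\<in>Basis. g' k e x e) = h k (x \<bullet> x) * (\<Sum>e\<in>Basis. dird e (X e) x)
        + h' k (x \<bullet> x) * 2 * (\<Sum>e\<in>Basis. (x \<bullet> e) * X e x)"
      using False by (simp add: g'_def sum.distrib sum_distrib_left mult.assoc)
    also have "\<dots> = h k (x \<bullet> x) / (x \<bullet> x) * F (sgn x)"
      using tang[OF False] False by (simp flip: div[OF False])
    finally show ?thesis using False by (simp add: w_def)
  qed (simp add: w_def g'_def)
  have wint: "integrable lborel (w k)" "(\<integral>x. w k x \<partial>lborel) = 0" for k
    unfolding wsum[abs_def] using int by (auto simp: Bochner_Integration.integral_sum)
  obtain B where B: "B \<ge> 0" "\<And>x. x \<in> sphere 0 1 \<Longrightarrow> norm (F x) \<le> B" using sphere_bounded[OF F] by metis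
  have "(\<lambda>k. \<integral>x. w k x \<partial>lborel) \<longlonglongrightarrow> (\<integral>x. indicator punctured_ball x *\<^sub>R F (sgn x) \<partial>lborel)"
  proof (rule integral_dominated_convergence[where w = "\<lambda>x. B * indicator (ball 0 1) x"])
    show "(\<lambda>x. indicator punctured_ball x *\<^sub>R F (sgn x)) \<in> borel_measurable lborel"
      by (rule sphere_integral_eq_ball[OF F])
    show "w k \<in> borel_measurable lborel" for k using wint by simp
    show "integrable lborel (\<lambda>x. B * indicator (ball (0::'a) 1) x)"
      using emeasure_lborel_ball_finite[of "0::'a" 1]
      by (intro integrable_mult_right integrable_real_indicator) auto
    show "AE x in lborel. (\<lambda>k. w k x) \<longlonglongrightarrow> indicator punctured_ball x *\<^sub>R F (sgn x)"
    proof (rule AE_I2)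
      fix x :: 'a
      show "(\<lambda>k. w k x) \<longlonglongrightarrow> indicator punctured_ball x *\<^sub>R F (sgn x)"
      proof (cases "x \<in> punctured_ball")
        case True
        then have p: "0 < x \<bullet> x" "x \<bullet> x < 1" by (auto simp: dot_square_norm power_less_one_iff)
        have "(\<lambda>k. h k (x \<bullet> x) / (x \<bullet> x) * F (sgn x)) \<longlonglongrightarrow> (x \<bullet> x) / (x \<bullet> x) * F (sgn x)"
          using p by (intro tendsto_intros hlim) auto
        then show ?thesis using True p by (auto simp: w_def)
      next
        case False
        then have "w k x = 0" for k
          using h1[of "x \<bullet> x"] by (auto simp: w_def dot_square_norm)
        then show ?thesis using False by simp
      qed
    qed
    show "AE x in lborel. norm (w k x) \<le> B * indicator (ball 0 1) x" for k
    proof (rule AE_I2)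
      fix x :: 'a
      show "norm (w k x) \<le> B * indicator (ball 0 1) x"
      proof (cases "x = 0 \<or> norm x \<ge> 1")
        case True
        then have "w k x = 0" using h1[of "x \<bullet> x"] by (auto simp: w_def dot_square_norm)
        then show ?thesis using B(1) by simp
      next
        case False
        have "\<bar>h k (x \<bullet> x) / (x \<bullet> x)\<bar> \<le> 1" using hb[of "x \<bullet> x" k] False by (simp add: abs_divide)
        moreover have "\<bar>F (sgn x)\<bar> \<le> B" using B(2)[OF sgn_in_sphere, of x] False by simp
        ultimately have "\<bar>h k (x \<bullet> x) / (x \<bullet> x)\<bar> * \<bar>F (sgn x)\<bar> \<le> 1 * B"
          by (intro mult_mono) auto
        then show ?thesis using False by (simp add: w_def abs_mult)
      qed
    qed
  qed
  then have "(\<integral>x. indicator punctured_ball x *\<^sub>R F (sgn x) \<partial>lborel) = 0"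
    unfolding wint by (simp add: LIMSEQ_const_iff)
  then show ?thesis unfolding sphere_integral_eq_ball[OF F] by simp
qed

section \<open>Green's formula\<close>

lemma dird_homogeneous:
  assumes f: "Cinf_on (- {0}) f" and x: "x \<noteq> 0" and s: "s > 0"
    and hom: "\<And>y. y \<noteq> 0 \<Longrightarrow> f (s *\<^sub>R y) = k *\<^sub>R f y"
  shows "dird e f (s *\<^sub>R x) = (k / s) *\<^sub>R dird e f x"
proof -
  have sx: "s *\<^sub>R x \<noteq> 0" using x s by simp
  have "((\<lambda>y. f (s *\<^sub>R y)) has_derivative (\<lambda>w. dird (s *\<^sub>R w) f (s *\<^sub>R x))) (at x)"
    by (rule has_derivative_compose[OF _ Cinf_on_has_derivative[OF f]])
      (use sx in \<open>auto intro!: derivative_eq_intros\<close>)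
  moreover have "((\<lambda>y. f (s *\<^sub>R y)) has_derivative (\<lambda>w. k *\<^sub>R dird w f x)) (at x)"
  proof (rule has_derivative_transform_within_open[where s = "- {0}"])
    show "((\<lambda>y. k *\<^sub>R f y) has_derivative (\<lambda>w. k *\<^sub>R dird w f x)) (at x)"
      using Cinf_on_has_derivative[OF f, of x] x by (auto intro!: derivative_eq_intros)
  qed (use x hom in auto)
  ultimately have "dird (s *\<^sub>R e) f (s *\<^sub>R x) = k *\<^sub>R dird e f x"
    using has_derivative_unique by metis
  then have "s *\<^sub>R dird e f (s *\<^sub>R x) = k *\<^sub>R dird e f x"
    using linear_scale[OF linear_dird[OF f, of "s *\<^sub>R x"], of s e] sx by simp
  then have "(1 / s) *\<^sub>R s *\<^sub>R dird e f (s *\<^sub>R x) = (1 / s) *\<^sub>R k *\<^sub>R dird e f x" by simp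
  then show ?thesis using s by simp
qed

lemma dird_radial_sgn:
  assumes "Cinf_on (- {0}) f" "radial f" "x \<noteq> 0"
  shows "dird e f (sgn x) = norm x *\<^sub>R dird e f x"
proof -
  have "dird e f (inverse (norm x) *\<^sub>R x) = (1 / inverse (norm x)) *\<^sub>R dird e f x"
    using assms(3) by (intro dird_homogeneous[OF assms(1,3)]) (auto simp: radial_scaleR[OF assms(2)])
  also have "1 / inverse (norm x) = norm x" by (metis divide_inverse inverse_inverse_eq mult_1)
  finally show ?thesis by (simp add: sgn_div_norm)
qed

lemma lap_radial_sgn:
  assumes "Cinf_on (- {0}) f" "radial f" "x \<noteq> 0"
  shows "lap f (sgn x) = (norm x)\<^sup>2 *\<^sub>R lap f x"
proof -
  have n: "sgn x = inverse (norm x) *\<^sub>R x" "inverse (norm x) > 0" using assms(3)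
    by (auto simp: sgn_div_norm)
  have "dird e (dird e f) (sgn x) = (norm x)\<^sup>2 *\<^sub>R dird e (dird e f) x" for e
  proof -
    have "dird e f (inverse (norm x) *\<^sub>R y) = norm x *\<^sub>R dird e f y" if "y \<noteq> 0" for y
      using dird_homogeneous[OF assms(1) that n(2), of 1 e]
        radial_scaleR[OF assms(2) _ n(2)] by (simp only: divide_inverse inverse_inverse_eq mult_1) simp
    then have "dird e (dird e f) (inverse (norm x) *\<^sub>R x)
        = (norm x / inverse (norm x)) *\<^sub>R dird e (dird e f) x"
      by (intro dird_homogeneous[OF Cinf_on_dird[OF assms(1)] assms(3) n(2)])
    then show ?thesis unfolding n(1) by (simp only: divide_inverse inverse_inverse_eq power2_eq_square)
  qed
  then show ?thesis unfolding lap_def by (simp add: scaleR_sum_right)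
qed

lemma sphere_subset: "sphere (0::'a::real_normed_vector) 1 \<subseteq> - {0}" by auto

lemma sphere_nz: "x \<in> sphere 0 1 \<Longrightarrow> x \<noteq> (0::'a::real_normed_vector)" by auto

lemma Cinf_on_continuous_sphere: "Cinf_on (- {0}) f \<Longrightarrow> continuous_on (sphere 0 1) f"
  using Cinf_on_continuous continuous_on_subset sphere_subset by metis

text \<open>The field with components \<open>U x \<bullet> dird e W x\<close> is tangent to all spheres because \<open>W\<close> is radial, and its
  divergence is homogeneous of degree \<open>- 2\<close>.\<close>

lemma green:
  fixes U W :: "'a::euclidean_space \<Rightarrow> 'b::euclidean_space"
  assumes U: "Cinf_on (- {0}) U" "radial U" and W: "Cinf_on (- {0}) W" "radial W"
  shows "(\<integral>x. U x \<bullet> lap W x \<partial>sphere_measure)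
      = - (\<integral>x. (\<Sum>e\<in>Basis. dird e U x \<bullet> dird e W x) \<partial>sphere_measure)"
proof -
  have op: "open (- {0::'a})" by auto
  let ?X = "\<lambda>e x. U x \<bullet> dird e W x"
  let ?F = "\<lambda>x. U x \<bullet> lap W x + (\<Sum>e\<in>Basis. dird e U x \<bullet> dird e W x)"
  have c: "continuous_on (sphere 0 1) (\<lambda>x. U x \<bullet> lap W x)"
    "continuous_on (sphere 0 1) (\<lambda>x. \<Sum>e\<in>Basis. dird e U x \<bullet> dird e W x)"
    by (intro continuous_intros Cinf_on_continuous_sphere Cinf_on_lap Cinf_on_dird U W op)+
  have "(\<integral>x. ?F x \<partial>sphere_measure) = 0"
  proof (rule sphere_divergence_theorem[where X = ?X])
    show "Cinf_on (- {0}) (?X e)" for e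
      using U(1) Cinf_on_dird[OF W(1)] op unfolding Cinf_on_def by (auto intro: Ck_on_inner)
    fix x :: 'a assume x: "x \<noteq> 0"
    have "(\<Sum>e\<in>Basis. (x \<bullet> e) * ?X e x) = U x \<bullet> dird x W x"
      using x by (subst dird_expand[OF W(1)]) (auto simp: inner_sum_right)
    then show "(\<Sum>e\<in>Basis. (x \<bullet> e) * ?X e x) = 0"
      using dird_radial[OF W x] by simp
    have "(\<Sum>e\<in>Basis. dird e (?X e) x) = ?F x"
      using dird_inner[OF U(1) Cinf_on_dird[OF W(1)], of x] x
      by (simp add: sum.distrib lap_def inner_sum_right)
    moreover have "?F (sgn x) = (x \<bullet> x) * ?F x"
      using x U(2) by (simp add: dird_radial_sgn[OF U x] dird_radial_sgn[OF W x] lap_radial_sgn[OF W x]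
        radial_def dot_square_norm power2_eq_square sum_distrib_left algebra_simps)
    ultimately show "(\<Sum>e\<in>Basis. dird e (?X e) x) * (x \<bullet> x) = ?F (sgn x)"
      by (simp add: mult.commute)
  next
    show "continuous_on (sphere 0 1) ?F" by (intro continuous_intros c)
  qed
  moreover have "(\<integral>x. ?F x \<partial>sphere_measure) = (\<integral>x. U x \<bullet> lap W x \<partial>sphere_measure)
      + (\<integral>x. (\<Sum>e\<in>Basis. dird e U x \<bullet> dird e W x) \<partial>sphere_measure)"
    by (intro Bochner_Integration.integral_add sphere_integrable c)
  ultimately show ?thesis by simp
qed

lemma lap_symmetric:
  fixes U W :: "'a::euclidean_space \<Rightarrow> 'b::euclidean_space"
  assumes "Cinf_on (- {0}) U" "radial U" "Cinf_on (- {0}) W" "radial W"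
  shows "(\<integral>x. U x \<bullet> lap W x \<partial>sphere_measure) = (\<integral>x. W x \<bullet> lap U x \<partial>sphere_measure)"
  unfolding green[OF assms] green[OF assms(3,4,1,2)] by (simp add: inner_commute)

text \<open>Differentiating \<open>U \<bullet> f = 0\<close> moves the derivative in the last term of \<open>proj_lap\<close> from \<open>U\<close> to
  \<open>f\<close>; the resulting quadratic expression is symmetric in \<open>U\<close> and \<open>W\<close>.\<close>

lemma inner_proj_lap:
  fixes f U W :: "'a::euclidean_space \<Rightarrow> 'b::euclidean_space"
  assumes f: "Cinf_on (- {0}) f"
    and U: "Cinf_on (- {0}) U" "\<And>x. x \<noteq> 0 \<Longrightarrow> U x \<bullet> f x = 0" and W: "W x \<bullet> f x = 0" and x: "x \<noteq> 0"
  shows "W x \<bullet> proj_lap f U x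
    = W x \<bullet> lap U x + (\<Sum>e\<in>Basis. (U x \<bullet> dird e f x) * (W x \<bullet> dird e f x))"
proof -
  have "W x \<bullet> tangent_proj (f x) (lap U x) = W x \<bullet> lap U x"
    using W by (simp add: tangent_proj_def inner_diff_right)
  then show ?thesis
    unfolding proj_lap_def inner_diff_right inner_sum_right
    by (simp add: dird_orthogonal[OF U(1) f U(2) x] sum_negf)
qed

lemma integral_inner_proj_lap:
  fixes f U W :: "'a::euclidean_space \<Rightarrow> 'b::euclidean_space"
  assumes f: "Cinf_on (- {0}) f"
    and U: "Cinf_on (- {0}) U" "radial U" "\<And>x. x \<noteq> 0 \<Longrightarrow> U x \<bullet> f x = 0"
    and W: "Cinf_on (- {0}) W" "radial W" "\<And>x. x \<noteq> 0 \<Longrightarrow> W x \<bullet> f x = 0"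
  shows "(\<integral>x. W x \<bullet> proj_lap f U x \<partial>sphere_measure)
    = (\<integral>x. (\<Sum>e\<in>Basis. (U x \<bullet> dird e f x) * (W x \<bullet> dird e f x)) \<partial>sphere_measure)
      - (\<integral>x. (\<Sum>e\<in>Basis. dird e U x \<bullet> dird e W x) \<partial>sphere_measure)"
proof -
  have "(\<integral>x. W x \<bullet> proj_lap f U x \<partial>sphere_measure) = (\<integral>x. W x \<bullet> lap U x
      + (\<Sum>e\<in>Basis. (U x \<bullet> dird e f x) * (W x \<bullet> dird e f x)) \<partial>sphere_measure)"
    by (rule sphere_integral_cong, rule inner_proj_lap[OF f U(1,3) W(3)]) auto
  also have "\<dots> = (\<integral>x. W x \<bullet> lap U x \<partial>sphere_measure)
      + (\<integral>x. (\<Sum>e\<in>Basis. (U x \<bullet> dird e f x) * (W x \<bullet> dird e f x)) \<partial>sphere_measure)"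
    by (intro Bochner_Integration.integral_add sphere_integrable continuous_intros
        Cinf_on_continuous_sphere Cinf_on_lap Cinf_on_dird f U W)
  finally show ?thesis unfolding green[OF W(1,2) U(1,2)] by (simp add: inner_commute)
qed

lemma proj_lap_symmetric:
  fixes f U W :: "'a::euclidean_space \<Rightarrow> 'b::euclidean_space"
  assumes f: "Cinf_on (- {0}) f"
    and U: "Cinf_on (- {0}) U" "radial U" "\<And>x. x \<noteq> 0 \<Longrightarrow> U x \<bullet> f x = 0"
    and W: "Cinf_on (- {0}) W" "radial W" "\<And>x. x \<noteq> 0 \<Longrightarrow> W x \<bullet> f x = 0"
  shows "(\<integral>x. W x \<bullet> proj_lap f U x \<partial>sphere_measure) = (\<integral>x. U x \<bullet> proj_lap f W x \<partial>sphere_measure)"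
  using integral_inner_proj_lap[OF f U W] integral_inner_proj_lap[OF f W U]
  by (simp add: inner_commute mult.commute)

lemma norm_tangent_proj_sq:
  assumes "norm p = 1"
  shows "(norm (tangent_proj p a))\<^sup>2 = a \<bullet> a - (a \<bullet> p)\<^sup>2"
proof -
  have "p \<bullet> p = 1" "p \<bullet> a = a \<bullet> p" using assms by (simp_all add: dot_square_norm inner_commute)
  then show ?thesis unfolding power2_norm_eq_inner
    by (simp add: tangent_proj_def inner_diff_left inner_diff_right power2_eq_square)
qed

lemma integral_cov_deriv_norm_sq:
  fixes f W :: "'a::euclidean_space \<Rightarrow> 'b::euclidean_space"
  assumes f: "Cinf_on (- {0}) f" "\<And>x. x \<in> sphere 0 1 \<Longrightarrow> norm (f x) = 1"
    and W: "Cinf_on (- {0}) W" "radial W" "\<And>x. x \<noteq> 0 \<Longrightarrow> W x \<bullet> f x = 0"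
  shows "(\<integral>x. (\<Sum>e\<in>Basis. (norm (tangent_proj (f x) (dird e W x)))\<^sup>2) \<partial>sphere_measure)
    = - (\<integral>x. W x \<bullet> proj_lap f W x \<partial>sphere_measure)"
proof -
  have "(\<integral>x. (\<Sum>e\<in>Basis. (norm (tangent_proj (f x) (dird e W x)))\<^sup>2) \<partial>sphere_measure)
    = (\<integral>x. (\<Sum>e\<in>Basis. dird e W x \<bullet> dird e W x)
        - (\<Sum>e\<in>Basis. (W x \<bullet> dird e f x) * (W x \<bullet> dird e f x)) \<partial>sphere_measure)"
  proof (rule sphere_integral_cong)
    fix x :: 'a assume x: "x \<in> sphere 0 1"
    then have x0: "x \<noteq> 0" by auto
    have "(norm (tangent_proj (f x) (dird e W x)))\<^sup>2
      = dird e W x \<bullet> dird e W x - (W x \<bullet> dird e f x) * (W x \<bullet> dird e f x)" for e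
    proof -
      have "dird e W x \<bullet> f x = - (W x \<bullet> dird e f x)"
        by (rule dird_orthogonal[OF W(1) f(1) W(3) x0])
      then show ?thesis unfolding norm_tangent_proj_sq[OF f(2)[OF x]] by (simp add: power2_eq_square)
    qed
    then show "(\<Sum>e\<in>Basis. (norm (tangent_proj (f x) (dird e W x)))\<^sup>2)
      = (\<Sum>e\<in>Basis. dird e W x \<bullet> dird e W x)
        - (\<Sum>e\<in>Basis. (W x \<bullet> dird e f x) * (W x \<bullet> dird e f x))"
      by (simp add: sum_subtractf)
  qed
  also have "\<dots> = (\<integral>x. (\<Sum>e\<in>Basis. dird e W x \<bullet> dird e W x) \<partial>sphere_measure)
     - (\<integral>x. (\<Sum>e\<in>Basis. (W x \<bullet> dird e f x) * (W x \<bullet> dird e f x)) \<partial>sphere_measure)"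
    by (intro Bochner_Integration.integral_diff sphere_integrable continuous_intros
        Cinf_on_continuous_sphere Cinf_on_dird f W)
  finally show ?thesis using integral_inner_proj_lap[OF f(1) W W] by simp
qed

section \<open>Smooth one-parameter families\<close>

text \<open>Smoothness is joint in the parameter and the point, which makes bounds on derivatives in the
  parameter uniform over the sphere.\<close>

definition smooth_family ::
  "real \<Rightarrow> (real \<Rightarrow> 'a::euclidean_space \<Rightarrow> 'b::real_normed_vector) \<Rightarrow> bool" where
  "smooth_family \<epsilon> F \<longleftrightarrow> Cinf_on ({-\<epsilon><..<\<epsilon>} \<times> - {0}) (\<lambda>p. F (fst p) (snd p))"

lemma open_family_domain: "open ({-\<epsilon><..<\<epsilon>::real} \<times> - {0::'a::euclidean_space})"
  by (intro open_Times) auto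

lemma smooth_family_bilinear:
  assumes "bounded_bilinear p" "smooth_family \<epsilon> F" "smooth_family \<epsilon> G"
  shows "smooth_family \<epsilon> (\<lambda>t x. p (F t x) (G t x))"
  using assms Ck_on_bilinear[OF open_family_domain assms(1)]
  unfolding smooth_family_def Cinf_on_def by blast

lemmas smooth_family_inner = smooth_family_bilinear[OF bounded_bilinear_inner]
  and smooth_family_scaleR = smooth_family_bilinear[OF bounded_bilinear_scaleR]
  and smooth_family_mult = smooth_family_bilinear[OF bounded_bilinear_mult]

lemma smooth_family_add: "smooth_family \<epsilon> F \<Longrightarrow> smooth_family \<epsilon> G \<Longrightarrow> smooth_family \<epsilon> (\<lambda>t x. F t x + G t x)"
  unfolding smooth_family_def Cinf_on_def using Ck_on_add[OF open_family_domain] by blast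

lemma smooth_family_diff: "smooth_family \<epsilon> F \<Longrightarrow> smooth_family \<epsilon> G \<Longrightarrow> smooth_family \<epsilon> (\<lambda>t x. F t x - G t x)"
  unfolding smooth_family_def Cinf_on_def using Ck_on_diff[OF open_family_domain] by blast

lemma smooth_family_sum:
  "(\<And>i. i \<in> I \<Longrightarrow> smooth_family \<epsilon> (F i)) \<Longrightarrow> smooth_family \<epsilon> (\<lambda>t x. \<Sum>i\<in>I. F i t x)"
  unfolding smooth_family_def Cinf_on_def by (auto intro!: Ck_on_sum[OF open_family_domain])

lemma smooth_family_const: "smooth_family \<epsilon> (\<lambda>t x. c)"
  unfolding smooth_family_def Cinf_on_def using Ck_on_const[OF open_family_domain] by blast

lemma smooth_family_fixed:
  assumes "Cinf_on (- {0}) f"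
  shows "smooth_family \<epsilon> (\<lambda>t. f)"
  unfolding smooth_family_def Cinf_on_def
proof
  fix k
  show "Ck_on ({-\<epsilon><..<\<epsilon>} \<times> - {0}) (\<lambda>p. f (snd p)) k"
    by (rule Ck_on_compose[where f = f and g = snd and T = "- {0}",
          OF open_family_domain _ _ Ck_on_linear[OF open_family_domain bounded_linear_snd]])
      (use assms in \<open>auto simp: Cinf_on_def\<close>)
qed

lemma smooth_family_slice:
  fixes F :: "real \<Rightarrow> 'a::euclidean_space \<Rightarrow> 'b::real_normed_vector"
  assumes "smooth_family \<epsilon> F" "\<bar>t\<bar> < \<epsilon>"
  shows "Cinf_on (- {0}) (F t)"
  unfolding Cinf_on_def
proof
  fix k
  have op: "open (- {0::'a})" by auto
  have "Ck_on (- {0}) (\<lambda>x. F (fst (t, x)) (snd (t, x))) k"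
  proof (rule Ck_on_compose[OF op, where g = "\<lambda>x. (t, x)" and f = "\<lambda>p. F (fst p) (snd p)"])
    show "Ck_on ({-\<epsilon><..<\<epsilon>} \<times> - {0}) (\<lambda>p. F (fst p) (snd p)) k"
      using assms(1) by (simp add: smooth_family_def Cinf_on_def)
    show "Ck_on (- {0}) (\<lambda>x::'a. (t, x)) k"
      by (intro Ck_on_Pair Ck_on_const Ck_on_linear bounded_linear_ident) (rule op)+
  qed (use assms(2) op in auto)
  then show "Ck_on (- {0}) (F t) k" by simp
qed

lemma smooth_family_radialize:
  fixes F :: "real \<Rightarrow> 'a::euclidean_space \<Rightarrow> 'b::real_normed_vector"
  assumes "smooth_family \<epsilon> F"
  shows "smooth_family \<epsilon> (\<lambda>t x. F t (sgn x))"
  unfolding smooth_family_def Cinf_on_def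
proof
  fix k
  let ?D = "{-\<epsilon><..<\<epsilon>} \<times> - {0::'a}"
  have "Ck_on ?D (\<lambda>p. F (fst (fst p, sgn (snd p))) (snd (fst p, sgn (snd p)))) k"
  proof (rule Ck_on_compose[OF open_family_domain, where g = "\<lambda>p. (fst p, sgn (snd p))"
        and f = "\<lambda>p. F (fst p) (snd p)"])
    show "Ck_on ?D (\<lambda>p. F (fst p) (snd p)) k" using assms by (simp add: smooth_family_def Cinf_on_def)
    show "Ck_on ?D (\<lambda>p. (fst p, sgn (snd p))) k"
      by (intro Ck_on_Pair open_family_domain Ck_on_linear bounded_linear_fst bounded_linear_snd
          Ck_on_compose[OF open_family_domain _ Ck_on_sgn]) auto
  qed (auto simp: sgn_zero_iff)
  then show "Ck_on ?D (\<lambda>p. F (fst p) (sgn (snd p))) k" by simp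
qed

lemma smooth_family_dird:
  fixes F :: "real \<Rightarrow> 'a::euclidean_space \<Rightarrow> 'b::real_normed_vector"
  assumes "smooth_family \<epsilon> F"
  shows "smooth_family \<epsilon> (\<lambda>t. dird e (F t))"
proof -
  let ?D = "{-\<epsilon><..<\<epsilon>} \<times> - {0::'a}" and ?F = "\<lambda>p. F (fst p) (snd p)"
  have eq: "dird (0, e) ?F p = dird e (F (fst p)) (snd p)" if p: "p \<in> ?D" for p
  proof -
    have "((\<lambda>x. ?F (fst p, x)) has_derivative (\<lambda>v. dird (0, v) ?F p)) (at (snd p))"
    proof (rule has_derivative_compose[where f = "\<lambda>x. (fst p, x)" and f' = "\<lambda>v. (0, v)"])
      show "(?F has_derivative (\<lambda>v. dird v ?F p)) (at (fst p, snd p))"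
        using Cinf_on_has_derivative[OF assms[unfolded smooth_family_def] p] by simp
    qed (auto intro!: derivative_eq_intros)
    then show ?thesis using dird_eqI by fastforce
  qed
  show ?thesis unfolding smooth_family_def
    by (rule Cinf_on_cong[OF open_family_domain eq])
      (use assms Cinf_on_dird in \<open>auto simp: smooth_family_def\<close>)
qed

lemma smooth_family_lap: "smooth_family \<epsilon> F \<Longrightarrow> smooth_family \<epsilon> (\<lambda>t. lap (F t))"
  unfolding lap_def[abs_def] by (intro smooth_family_sum smooth_family_dird)

lemma smooth_family_tangent_proj:
  "smooth_family \<epsilon> F \<Longrightarrow> smooth_family \<epsilon> G \<Longrightarrow> smooth_family \<epsilon> (\<lambda>t x. tangent_proj (F t x) (G t x))"
  unfolding tangent_proj_def by (intro smooth_family_diff smooth_family_scaleR smooth_family_inner)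

lemma smooth_family_proj_lap:
  "smooth_family \<epsilon> F \<Longrightarrow> smooth_family \<epsilon> G \<Longrightarrow> smooth_family \<epsilon> (\<lambda>t. proj_lap (F t) (G t))"
  unfolding proj_lap_def[abs_def]
  by (intro smooth_family_diff smooth_family_tangent_proj smooth_family_lap smooth_family_sum
      smooth_family_scaleR smooth_family_inner smooth_family_dird)

lemmas smooth_family_intros = smooth_family_inner smooth_family_scaleR smooth_family_mult
  smooth_family_add smooth_family_diff smooth_family_sum smooth_family_const
  smooth_family_dird smooth_family_lap smooth_family_tangent_proj smooth_family_proj_lap

lemma smooth_family_continuous:
  "smooth_family \<epsilon> F \<Longrightarrow> \<bar>t\<bar> < \<epsilon> \<Longrightarrow> continuous_on (sphere 0 1) (F t)"
  by (rule Cinf_on_continuous_sphere[OF smooth_family_slice])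

section \<open>Orders of vanishing in the parameter\<close>

text \<open>Integrals over the sphere are computed modulo second order terms in the parameter. A bound that is
  uniform on the sphere survives integration, and a quadratic error does not affect the derivative
  at zero.\<close>

definition vanishes ::
  "nat \<Rightarrow> (real \<Rightarrow> 'a::euclidean_space \<Rightarrow> 'b::real_normed_vector) \<Rightarrow> bool" where
  "vanishes n F \<longleftrightarrow> (\<exists>C d. d > 0 \<and> (\<forall>t x. \<bar>t\<bar> < d \<longrightarrow> x \<in> sphere 0 1 \<longrightarrow> norm (F t x) \<le> C * \<bar>t\<bar> ^ n))"

definition quadratic :: "(real \<Rightarrow> real) \<Rightarrow> bool" where
  "quadratic f \<longleftrightarrow> (\<exists>C d. d > 0 \<and> (\<forall>t. \<bar>t\<bar> < d \<longrightarrow> \<bar>f t\<bar> \<le> C * t\<^sup>2))"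

text \<open>The derivative in the parameter is bounded on a compact neighbourhood of \<open>{0} \<times> sphere 0 1\<close>, so the
  mean value inequality applies uniformly.\<close>

lemma vanishes_1I:
  fixes F :: "real \<Rightarrow> 'a::euclidean_space \<Rightarrow> 'b::real_normed_vector"
  assumes F: "smooth_family \<epsilon> F" and eps: "\<epsilon> > 0" and zero: "\<And>x. x \<in> sphere 0 1 \<Longrightarrow> F 0 x = 0"
  shows "vanishes 1 F"
proof -
  let ?D = "{-\<epsilon><..<\<epsilon>} \<times> - {0::'a}" and ?F = "\<lambda>p. F (fst p) (snd p)"
  let ?K = "{-\<epsilon>/2..\<epsilon>/2} \<times> sphere (0::'a) 1"
  have KD: "?K \<subseteq> ?D" using eps by auto
  have C: "Cinf_on ?D ?F" using F by (simp add: smooth_family_def)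
  have "compact ?K" by (intro compact_Times) auto
  moreover have "continuous_on ?K (dird (1, 0) ?F)"
    using Cinf_on_continuous[OF Cinf_on_dird[OF C]] continuous_on_subset KD by blast
  ultimately have "bounded (dird (1, 0) ?F ` ?K)"
    by (intro compact_imp_bounded compact_continuous_image)
  then obtain B where B: "\<And>p. p \<in> ?K \<Longrightarrow> norm (dird (1, 0) ?F p) \<le> B"
    by (auto simp: bounded_iff)
  have "norm (F t x) \<le> B * \<bar>t\<bar> ^ 1" if t: "\<bar>t\<bar> < \<epsilon> / 2" and x: "x \<in> sphere 0 1" for t x
  proof -
    have "norm (F t x - F 0 x) \<le> B * norm (t - 0)"
    proof (rule differentiable_bound[where S = "{-\<epsilon>/2..\<epsilon>/2}" and f' = "\<lambda>z w. w *\<^sub>R dird (1, 0) ?F (z, x)"])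
      fix z assume z: "z \<in> {-\<epsilon>/2..\<epsilon>/2}"
      have zx: "(z, x) \<in> ?K" using z x by simp
      then have zD: "(z, x) \<in> ?D" using KD by blast
      have "((\<lambda>s. ?F (s, x)) has_derivative (\<lambda>w. dird (w, 0) ?F (z, x))) (at z within {-\<epsilon>/2..\<epsilon>/2})"
        by (rule has_derivative_compose[where f = "\<lambda>s. (s, x)" and f' = "\<lambda>w. (w, 0)",
              OF _ Cinf_on_has_derivative[OF C]])
          (use zD in \<open>auto intro!: derivative_eq_intros\<close>)
      moreover have "(\<lambda>w. dird (w, 0) ?F (z, x)) = (\<lambda>w. w *\<^sub>R dird (1, 0) ?F (z, x))"
      proof
        fix w show "dird (w, 0) ?F (z, x) = w *\<^sub>R dird (1, 0) ?F (z, x)"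
          using linear_scale[OF linear_dird[OF C zD], of w "(1, 0)"] by simp
      qed
      ultimately show "((\<lambda>s. F s x) has_derivative (\<lambda>w. w *\<^sub>R dird (1, 0) ?F (z, x)))
          (at z within {-\<epsilon>/2..\<epsilon>/2})" by (simp only: fst_conv snd_conv)
      show "onorm (\<lambda>w. w *\<^sub>R dird (1, 0) ?F (z, x)) \<le> B"
        using mult_left_mono[OF B[OF zx] abs_ge_zero] by (intro onorm_le) (simp add: mult.commute)
    qed (use t eps in auto)
    then show ?thesis using zero[OF x] by simp
  qed
  then show ?thesis unfolding vanishes_def using eps by (intro exI[of _ B] exI[of _ "\<epsilon> / 2"]) auto
qed

lemma vanishes_inner:
  assumes "vanishes 1 F" "vanishes 1 G"
  shows "vanishes 2 (\<lambda>t x. F t x \<bullet> (G t x :: 'b::euclidean_space))"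
proof -
  obtain C d where C: "d > 0" "\<And>t x. \<bar>t\<bar> < d \<Longrightarrow> x \<in> sphere 0 1 \<Longrightarrow> norm (F t x) \<le> C * \<bar>t\<bar>"
    using assms(1) by (auto simp: vanishes_def)
  obtain C' d' where C': "d' > 0" "\<And>t x. \<bar>t\<bar> < d' \<Longrightarrow> x \<in> sphere 0 1 \<Longrightarrow> norm (G t x) \<le> C' * \<bar>t\<bar>"
    using assms(2) by (auto simp: vanishes_def)
  show ?thesis unfolding vanishes_def
  proof (rule exI[of _ "C * C'"], rule exI[of _ "min d d'"], intro conjI allI impI)
    fix t x assume *: "\<bar>t\<bar> < min d d'" "x \<in> sphere (0::'a) 1"
    have "\<bar>F t x \<bullet> G t x\<bar> \<le> norm (F t x) * norm (G t x)" by (rule Cauchy_Schwarz_ineq2)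
    also have "\<dots> \<le> (C * \<bar>t\<bar>) * (C' * \<bar>t\<bar>)"
      using C(2)[of t x] C'(2)[of t x] * by (intro mult_mono) (auto intro: order_trans[OF norm_ge_zero])
    finally show "norm (F t x \<bullet> G t x) \<le> C * C' * \<bar>t\<bar> ^ 2" by (simp add: power2_eq_square mult_ac)
  qed (use C C' in auto)
qed

lemma vanishes_add:
  assumes "vanishes n F" "vanishes n G"
  shows "vanishes n (\<lambda>t x. F t x + G t x)"
proof -
  obtain C d where C: "d > 0" "\<And>t x. \<bar>t\<bar> < d \<Longrightarrow> x \<in> sphere 0 1 \<Longrightarrow> norm (F t x) \<le> C * \<bar>t\<bar> ^ n"
    using assms(1) by (auto simp: vanishes_def)
  obtain C' d' where C': "d' > 0" "\<And>t x. \<bar>t\<bar> < d' \<Longrightarrow> x \<in> sphere 0 1 \<Longrightarrow> norm (G t x) \<le> C' * \<bar>t\<bar> ^ n"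
    using assms(2) by (auto simp: vanishes_def)
  show ?thesis unfolding vanishes_def
  proof (rule exI[of _ "C + C'"], rule exI[of _ "min d d'"], intro conjI allI impI)
    fix t x assume "\<bar>t\<bar> < min d d'" "x \<in> sphere (0::'a) 1"
    then show "norm (F t x + G t x) \<le> (C + C') * \<bar>t\<bar> ^ n"
      using C(2)[of t x] C'(2)[of t x] norm_triangle_le[of "F t x" "G t x"]
      by (simp add: distrib_right)
  qed (use C C' in auto)
qed

lemma vanishes_scaleR:
  assumes "vanishes n F"
  shows "vanishes n (\<lambda>t x. c *\<^sub>R F t x)"
proof -
  obtain C d where C: "d > 0" "\<And>t x. \<bar>t\<bar> < d \<Longrightarrow> x \<in> sphere 0 1 \<Longrightarrow> norm (F t x) \<le> C * \<bar>t\<bar> ^ n"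
    using assms(1) by (auto simp: vanishes_def)
  then show ?thesis unfolding vanishes_def
    by (intro exI[of _ "\<bar>c\<bar> * C"] exI[of _ d])
      (auto simp: mult.assoc intro!: mult_left_mono)
qed

lemma vanishes_cmult: "vanishes n F \<Longrightarrow> vanishes n (\<lambda>t x. c * F t x :: real)"
  using vanishes_scaleR[of n F c] by simp

lemma vanishes_mult: "vanishes 1 F \<Longrightarrow> vanishes 1 G \<Longrightarrow> vanishes 2 (\<lambda>t x. F t x * G t x :: real)"
  using vanishes_inner[of F G] by (simp add: mult.commute)

lemma vanishes_diff: "vanishes n F \<Longrightarrow> vanishes n G \<Longrightarrow> vanishes n (\<lambda>t x. F t x - G t x)"
  using vanishes_add[OF _ vanishes_scaleR[of n G "-1"], of F] by simp

lemma vanishes_sum: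
  "(\<And>i. i \<in> I \<Longrightarrow> vanishes n (F i)) \<Longrightarrow> vanishes n (\<lambda>t x. \<Sum>i\<in>I. F i t x)"
proof (induction I rule: infinite_finite_induct)
  case (insert i I)
  then show ?case using vanishes_add[of n "F i" "\<lambda>t x. \<Sum>i\<in>I. F i t x"] by simp
qed (auto simp: vanishes_def intro!: exI[of _ 0] exI[of _ 1])

lemma quadratic_integral:
  fixes F :: "real \<Rightarrow> 'a::euclidean_space \<Rightarrow> real"
  assumes "vanishes 2 F" "smooth_family \<epsilon> F" "\<epsilon> > 0"
  shows "quadratic (\<lambda>t. \<integral>x. F t x \<partial>sphere_measure)"
proof -
  obtain C d where C: "d > 0" "\<And>t x. \<bar>t\<bar> < d \<Longrightarrow> x \<in> sphere 0 1 \<Longrightarrow> norm (F t x) \<le> C * \<bar>t\<bar> ^ 2"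
    using assms(1) by (auto simp: vanishes_def)
  show ?thesis unfolding quadratic_def
  proof (rule exI[of _ "sphere_area TYPE('a) * C"], rule exI[of _ "min d \<epsilon>"], intro conjI allI impI)
    fix t assume "\<bar>t\<bar> < min d \<epsilon>"
    then have "\<bar>\<integral>x. F t x \<partial>sphere_measure\<bar> \<le> sphere_area TYPE('a) * (C * t\<^sup>2)"
      using C(2)[of t] by (intro sphere_integral_bound smooth_family_continuous[OF assms(2)]) auto
    then show "\<bar>\<integral>x. F t x \<partial>sphere_measure\<bar> \<le> sphere_area TYPE('a) * C * t\<^sup>2" by (simp add: mult.assoc)
  qed (use C assms in auto)
qed

lemma quadratic_add: "quadratic f \<Longrightarrow> quadratic g \<Longrightarrow> quadratic (\<lambda>t. f t + g t)"
proof -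
  assume "quadratic f" "quadratic g"
  then obtain C d C' d' where C: "d > 0" "\<And>t. \<bar>t\<bar> < d \<Longrightarrow> \<bar>f t\<bar> \<le> C * t\<^sup>2"
    and C': "d' > 0" "\<And>t. \<bar>t\<bar> < d' \<Longrightarrow> \<bar>g t\<bar> \<le> C' * t\<^sup>2"
    by (auto simp: quadratic_def)
  show ?thesis unfolding quadratic_def
  proof (rule exI[of _ "C + C'"], rule exI[of _ "min d d'"], intro conjI allI impI)
    fix t assume "\<bar>t\<bar> < min d d'"
    then show "\<bar>f t + g t\<bar> \<le> (C + C') * t\<^sup>2"
      using C(2)[of t] C'(2)[of t] by (simp add: distrib_right)
  qed (use C C' in auto)
qed

lemma quadratic_cmult: "quadratic f \<Longrightarrow> quadratic (\<lambda>t. c * f t)"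
proof -
  assume "quadratic f"
  then obtain C d where "d > 0" "\<And>t. \<bar>t\<bar> < d \<Longrightarrow> \<bar>f t\<bar> \<le> C * t\<^sup>2"
    by (auto simp: quadratic_def)
  then show ?thesis unfolding quadratic_def
    by (intro exI[of _ "\<bar>c\<bar> * C"] exI[of _ d])
      (auto simp: abs_mult mult.assoc intro!: mult_left_mono)
qed

lemma quadratic_cong:
  assumes "quadratic f" "\<epsilon> > 0" "\<And>t. \<bar>t\<bar> < \<epsilon> \<Longrightarrow> f t = g t"
  shows "quadratic g"
proof -
  obtain C d where C: "d > 0" "\<And>t. \<bar>t\<bar> < d \<Longrightarrow> \<bar>f t\<bar> \<le> C * t\<^sup>2"
    using assms(1) by (auto simp: quadratic_def)
  show ?thesis unfolding quadratic_def
    by (rule exI[of _ C], rule exI[of _ "min d \<epsilon>"]) (use assms C in \<open>auto simp flip: assms(3)\<close>)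
qed

lemma quadratic_imp_derivative_0:
  assumes "quadratic (\<lambda>t. f t - c)"
  shows "(f has_real_derivative 0) (at 0)"
proof -
  obtain C d where C: "d > 0" "\<And>t. \<bar>t\<bar> < d \<Longrightarrow> \<bar>f t - c\<bar> \<le> C * t\<^sup>2"
    using assms by (auto simp: quadratic_def)
  have f0: "f 0 = c" using C(2)[of 0] C(1) by simp
  have "((\<lambda>h. (f h - f 0) / h) \<longlongrightarrow> 0) (at 0)"
  proof (rule Lim_null_comparison)
    show "\<forall>\<^sub>F h in at 0. norm ((f h - f 0) / h) \<le> \<bar>C\<bar> * \<bar>h\<bar>"
      unfolding eventually_at
    proof (rule exI[of _ d], intro conjI ballI impI)
      fix h :: real assume h: "h \<noteq> 0 \<and> dist h 0 < d"
      then have "\<bar>f h - f 0\<bar> \<le> C * h\<^sup>2" using C(2)[of h] f0 by (simp add: dist_real_def)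
      also have "\<dots> \<le> \<bar>C\<bar> * \<bar>h\<bar> * \<bar>h\<bar>"
        by (simp add: power2_eq_square mult.assoc mult_right_mono)
      finally show "norm ((f h - f 0) / h) \<le> \<bar>C\<bar> * \<bar>h\<bar>"
        using h by (simp add: abs_divide divide_le_eq)
    qed (use C in auto)
    show "((\<lambda>h::real. \<bar>C\<bar> * \<bar>h\<bar>) \<longlongrightarrow> 0) (at 0)"
      by (rule tendsto_mult_right_zero) (intro tendsto_rabs_zero tendsto_ident_at)
  qed
  then show ?thesis by (simp add: DERIV_def)
qed

section \<open>Parallels of an eigenmap\<close>

text \<open>For \<open>a\<^sup>2 + b\<^sup>2 = 1\<close> this maps into a parallel of the target sphere.\<close>

definition parallel_map :: "('a \<Rightarrow> 'b::real_vector) \<Rightarrow> real \<Rightarrow> real \<Rightarrow> 'a \<Rightarrow> 'b \<times> real" where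
  "parallel_map v a b x = (a *\<^sub>R v x, b)"

lemma lap_cong: 
  assumes "\<And>y. y \<noteq> 0 \<Longrightarrow> f y = g y" "x \<noteq> 0"
  shows "lap f x = lap g x"
proof -
  have "dird e f y = dird e g y" if "y \<noteq> 0" for e y
    by (rule dird_cong_open[of "- {0}"]) (use assms that in auto)
  then have "dird e (dird e f) x = dird e (dird e g) x" for e
    by (intro dird_cong_open[of "- {0}"]) (use assms in auto)
  then show ?thesis by (simp add: lap_def)
qed

lemma proj_lap_cong:
  assumes "\<And>y. y \<noteq> 0 \<Longrightarrow> f y = f' y" "\<And>y. y \<noteq> 0 \<Longrightarrow> V y = V' y" "x \<noteq> 0"
  shows "proj_lap f V x = proj_lap f' V' x"
proof -
  have "dird e f x = dird e f' x" "dird e V x = dird e V' x" for e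
    by (rule dird_cong_open[of "- {0}"]; use assms in auto)+
  then show ?thesis using lap_cong[of V V' x] assms by (simp add: proj_lap_def)
qed

lemma proj_lap_scaleR:
  assumes V: "Cinf_on (- {0}) V" and x: "x \<noteq> 0"
  shows "proj_lap f (\<lambda>y. k *\<^sub>R V y) x = k *\<^sub>R proj_lap f V x"
proof -
  have d: "dird e (\<lambda>y. k *\<^sub>R W y) y = k *\<^sub>R dird e W y" if "Cinf_on (- {0}) W" "y \<noteq> 0"
    for e and W :: "'a \<Rightarrow> 'b" and y
    by (rule dird_eqI, rule has_derivative_scaleR_right)
      (use Cinf_on_has_derivative[OF that(1), of y] that(2) in simp)
  have "dird e (dird e (\<lambda>y. k *\<^sub>R V y)) x = k *\<^sub>R dird e (dird e V) x" for e
  proof -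
    have "dird e (dird e (\<lambda>y. k *\<^sub>R V y)) x = dird e (\<lambda>y. k *\<^sub>R dird e V y) x"
      by (rule dird_cong_open[of "- {0}"]) (use d[OF V] x in auto)
    then show ?thesis using d[OF Cinf_on_dird[OF V] x] by simp
  qed
  then have "lap (\<lambda>y. k *\<^sub>R V y) x = k *\<^sub>R lap V x" by (simp add: lap_def scaleR_sum_right)
  then show ?thesis
    by (simp add: proj_lap_def d[OF V x] tangent_proj_scaleR scaleR_diff_right scaleR_sum_right)
qed

text \<open>The iterated rough Laplacians of the tension field, extended radially.\<close>

fun lap_tension ::
  "('a::euclidean_space \<Rightarrow> 'b::euclidean_space) \<Rightarrow> nat \<Rightarrow> 'a \<Rightarrow> 'b" where
  "lap_tension f 0 x = tangent_proj (f (sgn x)) (lap f (sgn x))"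
| "lap_tension f (Suc j) x = proj_lap f (lap_tension f j) (sgn x)"

lemma radial_lap_tension: "radial (lap_tension f j)"
  by (cases j) (simp_all add: radial_def sgn_sphere[OF sgn_in_sphere])

lemma lap_tension_cong:
  assumes "\<And>y. y \<noteq> 0 \<Longrightarrow> f y = g y" "x \<noteq> 0"
  shows "lap_tension f j x = lap_tension g j x"
  using assms(2)
proof (induction j arbitrary: x)
  case (0 x)
  then show ?case using lap_cong[of f g "sgn x", OF assms(1)] assms(1) by (simp add: sgn_zero_iff)
next
  case (Suc j x)
  then show ?case
    using proj_lap_cong[of f g "lap_tension f j" "lap_tension g j" "sgn x", OF assms(1) Suc.IH]
    by (simp add: sgn_zero_iff)
qed

lemma smooth_family_lap_tension:
  assumes "smooth_family \<epsilon> F"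
  shows "smooth_family \<epsilon> (\<lambda>t. lap_tension (F t) j)"
proof (induction j)
  case 0
  have "smooth_family \<epsilon> (\<lambda>t x. tangent_proj (F t x) (lap (F t) x))"
    by (intro smooth_family_intros assms)
  from smooth_family_radialize[OF this] show ?case by (simp add: smooth_family_def)
next
  case (Suc j)
  from smooth_family_radialize[OF smooth_family_proj_lap[OF assms Suc]]
  show ?case by (simp add: smooth_family_def)
qed

lemma lap_tension_smooth:
  assumes "Cinf_on (- {0}) f"
  shows "Cinf_on (- {0}) (lap_tension f j)"
proof -
  have "smooth_family 1 (\<lambda>t. lap_tension f j)"
    by (rule smooth_family_lap_tension[OF smooth_family_fixed[OF assms]])
  from smooth_family_slice[OF this, of 0] show ?thesis by simp
qed

lemma lap_tension_tangent:
  assumes f: "Cinf_on (- {0}) f" "radial f" "\<And>x. x \<noteq> 0 \<Longrightarrow> norm (f x) = 1" and x: "x \<noteq> 0"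
  shows "lap_tension f j x \<bullet> f x = 0"
proof -
  have y: "sgn x \<noteq> 0" using x by (simp add: sgn_zero_iff)
  have "f x = f (sgn x)" using f(2) x by (simp add: radial_def)
  moreover have "dird e f (sgn x) \<bullet> f (sgn x) = 0" for e
    by (rule dird_unit_orthogonal[OF f(1,3) y])
  ultimately show ?thesis
    using tangent_proj_inner[OF f(3)[OF y]]
    by (cases j) (simp_all add: proj_lap_def inner_diff_left inner_sum_left)
qed

text \<open>The radial extension of an eigenmap. On the sphere the last two assumptions say \<open>\<Delta>v = - \<lambda>v\<close> and
  \<open>|\<nabla>v|\<^sup>2 = \<lambda>\<close>; the Euclidean expressions are homogeneous of degree \<open>- 2\<close>, which confines them to
  the sphere.\<close>

locale eigenmap =
  fixes v :: "'a::euclidean_space \<Rightarrow> 'b::euclidean_space" and lam :: real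
  assumes v_smooth: "Cinf_on (- {0}) v" and v_radial: "radial v"
    and v_unit: "\<And>x. x \<noteq> 0 \<Longrightarrow> norm (v x) = 1"
    and v_lap: "\<And>x. x \<in> sphere 0 1 \<Longrightarrow> lap v x = - lam *\<^sub>R v x"
    and v_energy: "\<And>x. x \<in> sphere 0 1 \<Longrightarrow> (\<Sum>e\<in>Basis. (norm (dird e v x))\<^sup>2) = lam"
begin

lemma parallel_smooth: "Cinf_on (- {0}) (parallel_map v a b)"
  unfolding Cinf_on_def parallel_map_def[abs_def]
proof
  fix k
  have "Ck_on (- {0}) (\<lambda>x. a *\<^sub>R v x) k"
    by (rule Ck_on_bounded_linear[OF _ bounded_linear_scaleR_right])
      (use v_smooth in \<open>auto simp: Cinf_on_def\<close>)
  then show "Ck_on (- {0}) (\<lambda>x. (a *\<^sub>R v x, b)) k" by (intro Ck_on_Pair Ck_on_const) auto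
qed

lemma parallel_radial: "radial (parallel_map v a b)"
  using v_radial by (simp add: radial_def parallel_map_def)

lemma dird_parallel: "x \<noteq> 0 \<Longrightarrow> dird e (parallel_map v a b) x = parallel_map (dird e v) a 0 x"
  unfolding parallel_map_def[abs_def]
  using Cinf_on_has_derivative[OF v_smooth, of x]
  by (intro dird_eqI) (auto intro!: derivative_eq_intros)

lemma lap_parallel:
  assumes x: "x \<in> sphere 0 1"
  shows "lap (parallel_map v a b) x = parallel_map v (- lam * a) 0 x"
proof -
  have x0: "x \<noteq> 0" using x by auto
  have "dird e (dird e (parallel_map v a b)) x = (a *\<^sub>R dird e (dird e v) x, 0)" for e
  proof -
    have "dird e (dird e (parallel_map v a b)) x = dird e (parallel_map (dird e v) a 0) x"
      by (rule dird_cong_open[of "- {0}"]) (use dird_parallel x0 in auto)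
    also have "\<dots> = (a *\<^sub>R dird e (dird e v) x, 0)"
      unfolding parallel_map_def[abs_def]
      using Cinf_on_has_derivative[OF Cinf_on_dird[OF v_smooth], of x] x0
      by (intro dird_eqI) (auto intro!: derivative_eq_intros)
    finally show ?thesis .
  qed
  then have "lap (parallel_map v a b) x = (a *\<^sub>R lap v x, 0)"
    by (simp add: lap_def sum_prod scaleR_sum_right)
  then show ?thesis by (simp add: v_lap[OF x] parallel_map_def)
qed

lemma inner_parallel:
  "x \<noteq> 0 \<Longrightarrow> parallel_map v a b x \<bullet> parallel_map v a' b' x = a * a' + b * b'"
  using v_unit[of x] by (simp add: parallel_map_def dot_square_norm)

lemma norm_parallel: "x \<noteq> 0 \<Longrightarrow> a\<^sup>2 + b\<^sup>2 = 1 \<Longrightarrow> norm (parallel_map v a b x) = 1"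
  using inner_parallel[of x a b a b] by (simp add: norm_eq_1 power2_eq_square)

lemma inner_dird_parallel:
  assumes "x \<noteq> 0"
  shows "parallel_map v a b x \<bullet> dird e (parallel_map v a' b') x = 0"
  using dird_unit_orthogonal[OF v_smooth v_unit assms, of e]
  by (simp add: dird_parallel[OF assms] parallel_map_def inner_commute)

lemma energy_parallel:
  assumes x: "x \<in> sphere 0 1"
  shows "(\<Sum>e\<in>Basis. dird e (parallel_map v a b) x \<bullet> dird e (parallel_map v a b) x) = lam * a\<^sup>2"
proof -
  have "dird e (parallel_map v a b) x \<bullet> dird e (parallel_map v a b) x = a\<^sup>2 * (norm (dird e v x))\<^sup>2" for e
    using x by (subst (1 2) dird_parallel) (auto simp: parallel_map_def dot_square_norm power2_eq_square)
  then show ?thesis by (simp add: v_energy[OF x] flip: sum_distrib_left)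
qed

text \<open>Along the parallel with coordinates \<open>s, c\<close>, the section \<open>parallel_map v (- c) s\<close> is orthogonal to the
  map and to its first derivatives. The Laplacian of the map has the direction \<open>(v, 0)\<close>, which lies in
  the plane of the map and of this section, so projecting leaves a multiple of the section. The same
  happens to the Laplacian of the section itself, which is therefore an eigensection.\<close>

lemma tension_parallel:
  assumes sc: "s\<^sup>2 + c\<^sup>2 = 1" and x: "x \<in> sphere 0 1"
  shows "tangent_proj (parallel_map v s c x) (lap (parallel_map v s c) x)
    = (lam * s * c) *\<^sub>R parallel_map v (- c) s x"
proof -
  have x0: "x \<noteq> 0" using x by auto
  have 1: "- (lam * s) + lam * s * s * s = - (lam * s * c * c)"
  proof -
    have "- (lam * s) + lam * s * s * s = - (lam * s) * (1 - s\<^sup>2)" by (simp add: power2_eq_square algebra_simps)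
    also have "1 - s\<^sup>2 = c\<^sup>2" using sc by simp
    finally show ?thesis by (simp add: power2_eq_square)
  qed
  have "tangent_proj (parallel_map v s c x) (lap (parallel_map v s c) x)
    = ((- (lam * s) + lam * s * s * s) *\<^sub>R v x, lam * s * s * c)"
    unfolding lap_parallel[OF x] tangent_proj_def inner_parallel[OF x0]
    by (simp add: parallel_map_def algebra_simps)
  then show ?thesis unfolding 1 by (simp add: parallel_map_def)
qed

lemma proj_lap_parallel:
  assumes sc: "s\<^sup>2 + c\<^sup>2 = 1" and x: "x \<in> sphere 0 1"
  shows "proj_lap (parallel_map v s c) (parallel_map v (- c) s) x
    = (- lam * c\<^sup>2) *\<^sub>R parallel_map v (- c) s x"
proof -
  have x0: "x \<noteq> 0" using x by auto
  have 1: "lam * c - lam * c * s * s = lam * c * c * c"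
  proof -
    have "lam * c - lam * c * s * s = lam * c * (1 - s\<^sup>2)" by (simp add: power2_eq_square algebra_simps)
    also have "1 - s\<^sup>2 = c\<^sup>2" using sc by simp
    finally show ?thesis by (simp add: power2_eq_square)
  qed
  have "dird e (parallel_map v (- c) s) x \<bullet> parallel_map v s c x = 0" for e
    using inner_dird_parallel[OF x0] by (simp add: inner_commute)
  then have "proj_lap (parallel_map v s c) (parallel_map v (- c) s) x
     = ((lam * c - lam * c * s * s) *\<^sub>R v x, - (lam * c * s * c))"
    unfolding proj_lap_def lap_parallel[OF x] tangent_proj_def inner_parallel[OF x0]
    by (simp add: parallel_map_def algebra_simps)
  then show ?thesis unfolding 1 by (simp add: parallel_map_def power2_eq_square)
qed

lemma lap_tension_parallel:
  assumes sc: "s\<^sup>2 + c\<^sup>2 = 1" and x: "x \<noteq> 0"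
  shows "lap_tension (parallel_map v s c) j x
    = (lam * s * c * (- lam * c\<^sup>2) ^ j) *\<^sub>R parallel_map v (- c) s x"
  using x
proof (induction j arbitrary: x)
  case (0 x)
  from tension_parallel[OF sc sgn_in_sphere[OF this]] parallel_radial 0
  show ?case by (simp add: radial_def)
next
  case (Suc j x)
  then have y: "sgn x \<noteq> 0" "sgn x \<in> sphere 0 1" using sgn_in_sphere[of x] by (auto simp: sgn_zero_iff)
  let ?k = "lam * s * c * (- lam * c\<^sup>2) ^ j"
  have "lap_tension (parallel_map v s c) (Suc j) x
      = proj_lap (parallel_map v s c) (\<lambda>y. ?k *\<^sub>R parallel_map v (- c) s y) (sgn x)"
    using proj_lap_cong[OF refl Suc.IH y(1)] by simp
  also have "\<dots> = ?k *\<^sub>R (- lam * c\<^sup>2) *\<^sub>R parallel_map v (- c) s (sgn x)"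
    by (simp only: proj_lap_scaleR[OF parallel_smooth y(1)] proj_lap_parallel[OF sc y(2)])
  also have "\<dots> = (lam * s * c * (- lam * c\<^sup>2) ^ Suc j) *\<^sub>R parallel_map v (- c) s x"
    using parallel_radial Suc.prems by (simp add: radial_def mult_ac)
  finally show ?case .
qed

end

section \<open>Variations of a parallel\<close>

text \<open>Applied to differences that vanish at parameter zero the left-hand side is of second order; the identity
  then expresses the integral of \<open>P x \<bullet> Q x\<close> through simpler ones.\<close>

lemma integral_inner_diff_expand:
  fixes P Q R :: "'a::euclidean_space \<Rightarrow> 'b::euclidean_space"
  assumes c: "continuous_on (sphere 0 1) P" "continuous_on (sphere 0 1) Q" "continuous_on (sphere 0 1) R"
  shows "(\<integral>x. (P x - k *\<^sub>R R x) \<bullet> (Q x - m *\<^sub>R R x) \<partial>sphere_measure)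
    = (\<integral>x. P x \<bullet> Q x \<partial>sphere_measure) - m * (\<integral>x. P x \<bullet> R x \<partial>sphere_measure)
      - k * (\<integral>x. R x \<bullet> Q x \<partial>sphere_measure) + k * m * (\<integral>x. R x \<bullet> R x \<partial>sphere_measure)"
proof -
  have i: "integrable sphere_measure (\<lambda>x. P x \<bullet> Q x)" "integrable sphere_measure (\<lambda>x. P x \<bullet> R x)"
    "integrable sphere_measure (\<lambda>x. R x \<bullet> Q x)" "integrable sphere_measure (\<lambda>x. R x \<bullet> R x)"
    by (intro sphere_integrable continuous_intros c)+
  have "(\<lambda>x. (P x - k *\<^sub>R R x) \<bullet> (Q x - m *\<^sub>R R x))
    = (\<lambda>x. P x \<bullet> Q x - m * (P x \<bullet> R x) - k * (R x \<bullet> Q x) + k * m * (R x \<bullet> R x))"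
    by (simp add: fun_eq_iff inner_diff_left inner_diff_right algebra_simps)
  then show ?thesis using i by simp
qed

locale parallel_variation = eigenmap v lam
  for v :: "'a::euclidean_space \<Rightarrow> 'b::euclidean_space" and lam +
  fixes s c :: real and \<phi> :: "real \<Rightarrow> 'a \<Rightarrow> 'b \<times> real" and \<epsilon> :: real
  assumes sc: "s\<^sup>2 + c\<^sup>2 = 1" and eps: "\<epsilon> > 0"
    and phi_family: "smooth_family \<epsilon> \<phi>"
    and phi_radial: "\<And>t. \<bar>t\<bar> < \<epsilon> \<Longrightarrow> radial (\<phi> t)"
    and phi_unit: "\<And>t x. \<bar>t\<bar> < \<epsilon> \<Longrightarrow> x \<noteq> 0 \<Longrightarrow> norm (\<phi> t x) = 1"
    and phi_0: "\<And>x. x \<noteq> 0 \<Longrightarrow> \<phi> 0 x = parallel_map v s c x"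
begin

text \<open>\<open>f\<close> is the normal component of \<open>\<eta>\<close> along the moving map and \<open>V\<close> its tangential part; \<open>G j\<close> is the
  \<open>j\<close>-th Laplacian of the tension field. At parameter zero \<open>V\<close> is \<open>\<eta>\<close> and \<open>G j\<close> is \<open>\<kappa> j\<close> times \<open>\<eta>\<close>, where
  \<open>\<mu>\<close> is the eigenvalue of \<open>\<eta>\<close>. The number \<open>\<beta> j\<close> is the coefficient of \<open>F\<close>, the integral of \<open>f\<close>, in the
  first order expansion of the integral of \<open>G j \<bullet> V\<close>.\<close>

abbreviation "q \<equiv> parallel_map v s c"
abbreviation "\<eta> \<equiv> parallel_map v (- c) s"

definition "f t x = \<eta> x \<bullet> \<phi> t x"
definition "V t x = \<eta> x - f t x *\<^sub>R \<phi> t x"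

abbreviation "G j t \<equiv> lap_tension (\<phi> t) j"

abbreviation integ :: "('a \<Rightarrow> real) \<Rightarrow> real" where
  "integ h \<equiv> \<integral>x. h x \<partial>sphere_measure"

definition "F t = integ (f t)"

definition "\<mu> = - lam * c\<^sup>2"
definition "\<kappa> j = lam * s * c * \<mu> ^ j"
definition "\<beta> j = - lam * \<mu> ^ j * (1 - 2 * (real j + 1) * s\<^sup>2)"

lemma q_family: "smooth_family \<epsilon> (\<lambda>t. q)" and eta_family: "smooth_family \<epsilon> (\<lambda>t. \<eta>)"
  by (intro smooth_family_fixed parallel_smooth)+

lemma f_family: "smooth_family \<epsilon> f"
  unfolding f_def[abs_def] by (intro smooth_family_intros eta_family phi_family)

lemma V_family: "smooth_family \<epsilon> V"
  unfolding V_def[abs_def] by (intro smooth_family_intros eta_family phi_family f_family)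

lemma G_family: "smooth_family \<epsilon> (G j)"
  by (rule smooth_family_lap_tension[OF phi_family])

lemmas families = phi_family q_family eta_family f_family V_family G_family

lemma phi_phi: "\<bar>t\<bar> < \<epsilon> \<Longrightarrow> x \<noteq> 0 \<Longrightarrow> \<phi> t x \<bullet> \<phi> t x = 1"
  using phi_unit by (simp add: dot_square_norm)

lemma V_tangent: "\<bar>t\<bar> < \<epsilon> \<Longrightarrow> x \<noteq> 0 \<Longrightarrow> V t x \<bullet> \<phi> t x = 0"
  using phi_phi by (simp add: V_def f_def inner_diff_left)

lemma V_radial: "\<bar>t\<bar> < \<epsilon> \<Longrightarrow> radial (V t)"
  using phi_radial[of t] parallel_radial by (simp add: radial_def V_def f_def)

lemma G_tangent: "\<bar>t\<bar> < \<epsilon> \<Longrightarrow> x \<noteq> 0 \<Longrightarrow> G j t x \<bullet> \<phi> t x = 0"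
  by (intro lap_tension_tangent smooth_family_slice[OF phi_family] phi_radial phi_unit)

lemma start:
  assumes x: "x \<noteq> 0"
  shows "f 0 x = 0" "V 0 x = \<eta> x" "G j 0 x = \<kappa> j *\<^sub>R \<eta> x"
proof -
  show f: "f 0 x = 0" unfolding f_def phi_0[OF x] inner_parallel[OF x] by simp
  then show "V 0 x = \<eta> x" by (simp add: V_def)
  show "G j 0 x = \<kappa> j *\<^sub>R \<eta> x"
    using lap_tension_cong[OF phi_0 x] lap_tension_parallel[OF sc x] by (simp add: \<kappa>_def \<mu>_def)
qed

lemma lap_eta: "x \<in> sphere 0 1 \<Longrightarrow> lap \<eta> x = (lam * c) *\<^sub>R (s *\<^sub>R q x - c *\<^sub>R \<eta> x)"
proof -
  assume x: "x \<in> sphere 0 1"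
  have "(lam * c) *\<^sub>R (s *\<^sub>R q x - c *\<^sub>R \<eta> x) = parallel_map v (lam * c * (s\<^sup>2 + c\<^sup>2)) 0 x"
    by (simp add: parallel_map_def algebra_simps power2_eq_square)
  then show ?thesis by (simp only: lap_parallel[OF x] sc) simp
qed

lemmas slice_smooth =
  smooth_family_slice[OF phi_family] smooth_family_slice[OF f_family] smooth_family_slice[OF V_family]
  smooth_family_slice[OF G_family] smooth_family_slice[OF smooth_family_proj_lap[OF phi_family V_family]]
  smooth_family_slice[OF smooth_family_proj_lap[OF phi_family G_family]]

lemmas slice_continuous =
  Cinf_on_continuous_sphere[OF slice_smooth(1)] Cinf_on_continuous_sphere[OF slice_smooth(2)]
  Cinf_on_continuous_sphere[OF slice_smooth(3)] Cinf_on_continuous_sphere[OF slice_smooth(4)]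
  Cinf_on_continuous_sphere[OF slice_smooth(5)] Cinf_on_continuous_sphere[OF slice_smooth(6)]

lemma vanishes_f: "vanishes 1 f"
  by (rule vanishes_1I[OF f_family eps]) (simp add: start[OF sphere_nz])

text \<open>Pointwise \<open>V \<bullet> V = 1 - f\<^sup>2\<close>, and \<open>f\<close> vanishes at parameter zero.\<close>

lemma V_norm_estimate: "quadratic (\<lambda>t. integ (\<lambda>x. V t x \<bullet> V t x) - sphere_area TYPE('a))"
proof (rule quadratic_cong[OF _ eps])
  show "quadratic (\<lambda>t. integ (\<lambda>x. (-1) * (f t x * f t x)))"
    by (intro quadratic_integral[OF _ _ eps] vanishes_cmult vanishes_mult vanishes_f
        smooth_family_intros families)
  fix t assume t: "\<bar>t\<bar> < \<epsilon>"
  have "integ (\<lambda>x. V t x \<bullet> V t x) = integ (\<lambda>x. 1 + (-1) * (f t x * f t x))"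
  proof (rule sphere_integral_cong)
    fix x :: 'a assume x: "x \<in> sphere 0 1"
    have "\<eta> x \<bullet> \<eta> x = 1" using inner_parallel[OF sphere_nz[OF x]] sc by (simp add: power2_eq_square add.commute)
    then show "V t x \<bullet> V t x = 1 + (-1) * (f t x * f t x)"
      using phi_phi[OF t sphere_nz[OF x]] inner_commute[of "\<phi> t x" "\<eta> x"]
      by (simp add: V_def inner_diff_left inner_diff_right f_def[symmetric])
  qed
  also have "\<dots> = sphere_area TYPE('a) + integ (\<lambda>x. (-1) * (f t x * f t x))"
    using t by (subst Bochner_Integration.integral_add)
      (auto intro!: sphere_integrable continuous_intros slice_continuous simp: sphere_area_def space_sphere_measure)
  finally show "integ (\<lambda>x. (-1) * (f t x * f t x)) = integ (\<lambda>x. V t x \<bullet> V t x) - sphere_area TYPE('a)" by simp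
qed

text \<open>With \<open>V = \<eta> - Z\<close> for \<open>Z = f \<phi>\<close>, the quadratic form of the Laplacian is
  \<open>- \<integral>|\<nabla>\<eta>|\<^sup>2 + 2 \<integral>\<langle>\<nabla>Z, \<nabla>\<eta>\<rangle>\<close> up to the second order terms \<open>S1\<close> and \<open>S2\<close>. Green's formula turns the mixed
  integral into \<open>- \<integral>\<langle>Z, \<Delta>\<eta>\<rangle>\<close>, which is \<open>- \<lambda>sc F\<close> up to the second order term \<open>R\<close>.\<close>

lemma V_energy_estimate:
  "quadratic (\<lambda>t. integ (\<lambda>x. V t x \<bullet> proj_lap (\<phi> t) (V t) x) - (\<mu> * sphere_area TYPE('a) - 2 * lam * s * c * F t))"
proof (rule quadratic_cong[OF _ eps])
  define Z where "Z t x = f t x *\<^sub>R \<phi> t x" for t x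
  define S1 where "S1 t x = (\<Sum>e\<in>Basis. (V t x \<bullet> dird e (\<phi> t) x) * (V t x \<bullet> dird e (\<phi> t) x))" for t x
  define S2 where "S2 t x = (\<Sum>e\<in>Basis. dird e (Z t) x \<bullet> dird e (Z t) x)" for t x
  define R where "R t x = f t x * (s * (\<phi> t x \<bullet> q x - 1) - c * f t x)" for t x
  have Zf: "smooth_family \<epsilon> Z" unfolding Z_def[abs_def] by (intro smooth_family_intros families)
  have S1f: "smooth_family \<epsilon> S1" unfolding S1_def[abs_def] by (intro smooth_family_intros families)
  have S2f: "smooth_family \<epsilon> S2" unfolding S2_def[abs_def] by (intro smooth_family_intros Zf)
  have Rf: "smooth_family \<epsilon> R" unfolding R_def[abs_def] by (intro smooth_family_intros families)
  have "vanishes 2 S1" unfolding S1_def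
  proof (intro vanishes_sum vanishes_mult)
    fix e :: 'a
    show "vanishes 1 (\<lambda>t x. V t x \<bullet> dird e (\<phi> t) x)"
    proof (rule vanishes_1I[OF _ eps])
      fix x :: 'a assume "x \<in> sphere 0 1"
      then have x: "x \<noteq> 0" by auto
      have "dird e (\<phi> 0) x = dird e q x"
        by (rule dird_cong_open[of "- {0}"]) (use phi_0 x in auto)
      then show "V 0 x \<bullet> dird e (\<phi> 0) x = 0" using start(2)[OF x] inner_dird_parallel[OF x] by simp
    qed (intro smooth_family_intros families)
    then show "vanishes 1 (\<lambda>t x. V t x \<bullet> dird e (\<phi> t) x)" .
  qed
  moreover have "vanishes 2 S2" unfolding S2_def
  proof (intro vanishes_sum vanishes_inner)
    fix e :: 'a
    show "vanishes 1 (\<lambda>t. dird e (Z t))"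
    proof (rule vanishes_1I[OF _ eps])
      fix x :: 'a assume "x \<in> sphere 0 1"
      then have "dird e (Z 0) x = dird e (\<lambda>x. 0) x"
        by (intro dird_cong_open[of "- {0}"]) (use start(1) in \<open>auto simp: Z_def\<close>)
      then show "dird e (Z 0) x = 0" using dird_eqI[OF has_derivative_const] by simp
    qed (intro smooth_family_intros Zf)
    then show "vanishes 1 (\<lambda>t. dird e (Z t))" .
  qed
  moreover have "vanishes 2 R" unfolding R_def
  proof (intro vanishes_mult vanishes_f vanishes_1I[OF _ eps])
    fix x :: 'a assume "x \<in> sphere 0 1"
    then have x: "x \<noteq> 0" by auto
    show "s * (\<phi> 0 x \<bullet> q x - 1) - c * f 0 x = 0"
      using start(1)[OF x] inner_parallel[OF x, of s c s c] sc phi_0[OF x] by (simp add: power2_eq_square)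
  qed (intro smooth_family_intros families)
  ultimately show "quadratic (\<lambda>t. integ (\<lambda>x. S1 t x - S2 t x - 2 * lam * c * R t x))"
    by (intro quadratic_integral[OF _ _ eps] vanishes_diff vanishes_cmult smooth_family_intros S1f S2f Rf)
  fix t assume t: "\<bar>t\<bar> < \<epsilon>"
  have Zs: "Cinf_on (- {0}) (Z t)" by (rule smooth_family_slice[OF Zf t])
  have Zr: "radial (Z t)" using phi_radial[OF t] parallel_radial by (simp add: radial_def Z_def f_def)
  note cont = slice_continuous[OF t] Cinf_on_continuous_sphere[OF parallel_smooth]
    Cinf_on_continuous_sphere[OF Cinf_on_dird[OF Zs]] Cinf_on_continuous_sphere[OF Zs]
    Cinf_on_continuous_sphere[OF Cinf_on_dird[OF parallel_smooth]]
    smooth_family_continuous[OF S1f t] smooth_family_continuous[OF S2f t] smooth_family_continuous[OF Rf t]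
  have "integ (\<lambda>x. \<Sum>e\<in>Basis. dird e (V t) x \<bullet> dird e (V t) x)
    = integ (\<lambda>x. lam * c\<^sup>2 - 2 * (\<Sum>e\<in>Basis. dird e (Z t) x \<bullet> dird e \<eta> x) + S2 t x)"
  proof (rule sphere_integral_cong)
    fix x :: 'a assume x: "x \<in> sphere 0 1"
    have dV: "dird e (V t) x = dird e \<eta> x - dird e (Z t) x" for e
      using dird_diff[OF parallel_smooth Zs, of x e] sphere_nz[OF x]
      by (simp add: V_def[abs_def] Z_def[abs_def])
    have "dird e (V t) x \<bullet> dird e (V t) x = dird e \<eta> x \<bullet> dird e \<eta> x
        - 2 * (dird e (Z t) x \<bullet> dird e \<eta> x) + dird e (Z t) x \<bullet> dird e (Z t) x" for e
      unfolding dV by (simp add: inner_diff_left inner_diff_right inner_commute)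
    then have "(\<Sum>e\<in>Basis. dird e (V t) x \<bullet> dird e (V t) x)
      = (\<Sum>e\<in>Basis. dird e \<eta> x \<bullet> dird e \<eta> x) - 2 * (\<Sum>e\<in>Basis. dird e (Z t) x \<bullet> dird e \<eta> x) + S2 t x"
      by (simp add: S2_def sum.distrib sum_subtractf sum_distrib_left)
    then show "(\<Sum>e\<in>Basis. dird e (V t) x \<bullet> dird e (V t) x)
      = lam * c\<^sup>2 - 2 * (\<Sum>e\<in>Basis. dird e (Z t) x \<bullet> dird e \<eta> x) + S2 t x"
      using energy_parallel[OF x, of "- c" s] by simp
  qed
  also have "\<dots> = sphere_area TYPE('a) * (lam * c\<^sup>2) - 2 * integ (\<lambda>x. \<Sum>e\<in>Basis. dird e (Z t) x \<bullet> dird e \<eta> x) + integ (S2 t)"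
    by (subst Bochner_Integration.integral_add Bochner_Integration.integral_diff;
        (intro sphere_integrable continuous_intros cont)?)+ (simp add: sphere_area_def space_sphere_measure)
  also have "integ (\<lambda>x. \<Sum>e\<in>Basis. dird e (Z t) x \<bullet> dird e \<eta> x) = - integ (\<lambda>x. Z t x \<bullet> lap \<eta> x)"
    using green[OF Zs Zr parallel_smooth parallel_radial, of "- c" s] by simp
  also have "integ (\<lambda>x. Z t x \<bullet> lap \<eta> x) = integ (\<lambda>x. lam * c * R t x + lam * s * c * f t x)"
  proof (rule sphere_integral_cong)
    fix x :: 'a assume x: "x \<in> sphere 0 1"
    have "\<phi> t x \<bullet> \<eta> x = f t x" by (simp add: f_def inner_commute)
    then show "Z t x \<bullet> lap \<eta> x = lam * c * R t x + lam * s * c * f t x"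
      by (simp add: lap_eta[OF x] Z_def R_def inner_diff_right algebra_simps)
  qed
  also have "\<dots> = lam * c * integ (R t) + lam * s * c * F t"
    by (subst Bochner_Integration.integral_add; (intro sphere_integrable continuous_intros cont)?)
      (simp add: F_def)
  finally have "integ (\<lambda>x. V t x \<bullet> proj_lap (\<phi> t) (V t) x) = integ (S1 t)
      - (sphere_area TYPE('a) * (lam * c\<^sup>2) + 2 * (lam * c * integ (R t) + lam * s * c * F t) + integ (S2 t))"
    using integral_inner_proj_lap[OF slice_smooth(1)[OF t] slice_smooth(3)[OF t] V_radial[OF t] V_tangent[OF t]
        slice_smooth(3)[OF t] V_radial[OF t] V_tangent[OF t]]
    by (simp add: S1_def[abs_def])
  moreover have "integ (\<lambda>x. S1 t x - S2 t x - 2 * lam * c * R t x)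
    = integ (S1 t) - integ (S2 t) - 2 * lam * c * integ (R t)"
    by (subst Bochner_Integration.integral_diff; (intro sphere_integrable continuous_intros cont)?)+ simp
  ultimately show "integ (\<lambda>x. S1 t x - S2 t x - 2 * lam * c * R t x)
    = integ (\<lambda>x. V t x \<bullet> proj_lap (\<phi> t) (V t) x) - (\<mu> * sphere_area TYPE('a) - 2 * lam * s * c * F t)"
    by (simp add: \<mu>_def algebra_simps)
qed

text \<open>By Green's formula \<open>\<integral>\<langle>\<Delta>\<phi>, V\<rangle> = \<integral>\<langle>\<phi>, \<Delta>\<eta>\<rangle> - \<integral>f \<langle>\<Delta>\<phi>, \<phi>\<rangle>\<close>. Here \<open>\<langle>\<Delta>\<phi>, \<phi>\<rangle>\<close> is \<open>- \<lambda>s\<^sup>2\<close> at parameter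
  zero, \<open>\<Delta>\<eta>\<close> is a combination of \<open>q\<close> and \<open>\<eta>\<close>, and \<open>\<langle>\<phi>, q\<rangle> = 1 - |\<phi> - q|\<^sup>2 / 2\<close>.\<close>

lemma tension_estimate:
  "quadratic (\<lambda>t. integ (\<lambda>x. G 0 t x \<bullet> V t x) - (\<kappa> 0 * sphere_area TYPE('a) + \<beta> 0 * F t))"
proof (rule quadratic_cong[OF _ eps])
  define Q where "Q t x = (\<phi> t x - q x) \<bullet> (\<phi> t x - q x)" for t x
  define R where "R t x = f t x * (lap (\<phi> t) x \<bullet> \<phi> t x + lam * s\<^sup>2)" for t x
  have Qf: "smooth_family \<epsilon> Q" unfolding Q_def[abs_def] by (intro smooth_family_intros families)
  have Rf: "smooth_family \<epsilon> R" unfolding R_def[abs_def] by (intro smooth_family_intros families)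
  have "vanishes 2 Q" unfolding Q_def
    by (intro vanishes_inner vanishes_1I[OF _ eps] smooth_family_intros families)
      (simp_all add: phi_0[OF sphere_nz])
  moreover have "vanishes 2 R" unfolding R_def
  proof (intro vanishes_mult vanishes_f vanishes_1I[OF _ eps])
    fix x :: 'a assume S: "x \<in> sphere 0 1"
    then have x: "x \<noteq> 0" by auto
    have "lap (\<phi> 0) x = lap q x" by (rule lap_cong[OF phi_0 x])
    then show "lap (\<phi> 0) x \<bullet> \<phi> 0 x + lam * s\<^sup>2 = 0"
      by (simp add: phi_0[OF x] lap_parallel[OF S] inner_parallel[OF x] power2_eq_square)
  qed (intro smooth_family_intros families)
  ultimately show "quadratic (\<lambda>t. integ (\<lambda>x. (- (lam * c * s) / 2) * Q t x - R t x))"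
    by (intro quadratic_integral[OF _ _ eps] vanishes_diff vanishes_cmult smooth_family_intros Qf Rf)
  fix t assume t: "\<bar>t\<bar> < \<epsilon>"
  note phi = slice_smooth(1)[OF t]
  have op: "open (- {0::'a})" by auto
  note cont = slice_continuous[OF t] Cinf_on_continuous_sphere[OF parallel_smooth]
    Cinf_on_continuous_sphere[OF Cinf_on_lap[OF op phi]] Cinf_on_continuous_sphere[OF Cinf_on_lap[OF op parallel_smooth]]
    smooth_family_continuous[OF Qf t] smooth_family_continuous[OF Rf t]
  have "integ (\<lambda>x. G 0 t x \<bullet> V t x) = integ (\<lambda>x. \<eta> x \<bullet> lap (\<phi> t) x - R t x + lam * s\<^sup>2 * f t x)"
  proof (rule sphere_integral_cong)
    fix x :: 'a assume x: "x \<in> sphere 0 1"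
    have "G 0 t x \<bullet> V t x = lap (\<phi> t) x \<bullet> V t x"
      using V_tangent[OF t sphere_nz[OF x]] sgn_sphere[OF x] inner_commute[of "\<phi> t x" "V t x"]
      by (simp add: tangent_proj_def inner_diff_left)
    also have "\<dots> = \<eta> x \<bullet> lap (\<phi> t) x - R t x + lam * s\<^sup>2 * f t x"
      by (simp add: V_def R_def inner_diff_right inner_commute algebra_simps)
    finally show "G 0 t x \<bullet> V t x = \<eta> x \<bullet> lap (\<phi> t) x - R t x + lam * s\<^sup>2 * f t x" .
  qed
  also have "\<dots> = integ (\<lambda>x. \<eta> x \<bullet> lap (\<phi> t) x) - integ (R t) + lam * s\<^sup>2 * F t"
    by (subst Bochner_Integration.integral_add Bochner_Integration.integral_diff;
        (intro sphere_integrable continuous_intros cont)?)+ (simp add: F_def)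
  also have "integ (\<lambda>x. \<eta> x \<bullet> lap (\<phi> t) x) = integ (\<lambda>x. \<phi> t x \<bullet> lap \<eta> x)"
    by (rule lap_symmetric[OF parallel_smooth parallel_radial phi phi_radial[OF t]])
  also have "\<dots> = integ (\<lambda>x. lam * c * s + (- (lam * c * s) / 2) * Q t x - lam * c\<^sup>2 * f t x)"
  proof (rule sphere_integral_cong)
    fix x :: 'a assume x: "x \<in> sphere 0 1"
    have "q x \<bullet> q x = 1" using inner_parallel[OF sphere_nz[OF x], of s c s c] sc by (simp add: power2_eq_square)
    then have pq: "\<phi> t x \<bullet> q x = 1 - Q t x / 2"
      using phi_phi[OF t sphere_nz[OF x]] inner_commute[of "q x" "\<phi> t x"]
      by (simp add: Q_def inner_diff_left inner_diff_right diff_divide_distrib)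
    have pe: "\<phi> t x \<bullet> \<eta> x = f t x" by (simp add: f_def inner_commute)
    show "\<phi> t x \<bullet> lap \<eta> x = lam * c * s + (- (lam * c * s) / 2) * Q t x - lam * c\<^sup>2 * f t x"
      by (simp only: lap_eta[OF x] inner_scaleR_right inner_diff_right pq pe)
        (simp add: algebra_simps power2_eq_square)
  qed
  also have "\<dots> = sphere_area TYPE('a) * (lam * c * s) + (- (lam * c * s) / 2) * integ (Q t) - lam * c\<^sup>2 * F t"
    by (subst Bochner_Integration.integral_add Bochner_Integration.integral_diff;
        (intro sphere_integrable continuous_intros cont)?)+ (simp add: F_def sphere_area_def space_sphere_measure)
  finally have 1: "integ (\<lambda>x. G 0 t x \<bullet> V t x) = sphere_area TYPE('a) * (lam * c * s) + (- (lam * c * s) / 2) * integ (Q t)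
     - lam * c\<^sup>2 * F t - integ (R t) + lam * s\<^sup>2 * F t" .
  have 2: "integ (\<lambda>x. (- (lam * c * s) / 2) * Q t x - R t x) = (- (lam * c * s) / 2) * integ (Q t) - integ (R t)"
    by (subst Bochner_Integration.integral_diff; (intro sphere_integrable continuous_intros cont)?) simp
  have c2: "c\<^sup>2 = 1 - s\<^sup>2" using sc by simp
  show "integ (\<lambda>x. (- (lam * c * s) / 2) * Q t x - R t x)
    = integ (\<lambda>x. G 0 t x \<bullet> V t x) - (\<kappa> 0 * sphere_area TYPE('a) + \<beta> 0 * F t)"
    unfolding 1 2 \<kappa>_def \<beta>_def c2 by (simp add: algebra_simps)
qed

lemma vanishes_G: "vanishes 1 (\<lambda>t x. G j t x - \<kappa> j *\<^sub>R V t x)"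
  by (rule vanishes_1I[OF _ eps], intro smooth_family_intros families)
    (simp add: start[OF sphere_nz])

text \<open>Symmetry moves the Laplacian from \<open>G j\<close> to \<open>V\<close>. Since \<open>G j - \<kappa> j V\<close> and \<open>\<Delta>V - \<mu> V\<close> both vanish at
  parameter zero, the integral of \<open>G j \<bullet> \<Delta>V\<close> reduces to those of \<open>G j \<bullet> V\<close>, \<open>V \<bullet> \<Delta>V\<close> and \<open>V \<bullet> V\<close>.\<close>

lemma moment_estimate:
  "quadratic (\<lambda>t. integ (\<lambda>x. G j t x \<bullet> V t x) - (\<kappa> j * sphere_area TYPE('a) + \<beta> j * F t))"
proof (induction j)
  case 0
  show ?case by (rule tension_estimate)
next
  case (Suc j)
  let ?H = "\<lambda>t x. (G j t x - \<kappa> j *\<^sub>R V t x) \<bullet> (proj_lap (\<phi> t) (V t) x - \<mu> *\<^sub>R V t x)"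
  have "vanishes 1 (\<lambda>t x. proj_lap (\<phi> t) (V t) x - \<mu> *\<^sub>R V t x)"
  proof (rule vanishes_1I[OF _ eps])
    fix x :: 'a assume x: "x \<in> sphere 0 1"
    have "proj_lap (\<phi> 0) (V 0) x = proj_lap q \<eta> x"
      by (rule proj_lap_cong[OF phi_0 start(2) sphere_nz[OF x]])
    then show "proj_lap (\<phi> 0) (V 0) x - \<mu> *\<^sub>R V 0 x = 0"
      using proj_lap_parallel[OF sc x] start(2)[OF sphere_nz[OF x]] by (simp add: \<mu>_def)
  qed (intro smooth_family_intros families)
  then have H: "quadratic (\<lambda>t. integ (?H t))"
    by (intro quadratic_integral[OF _ _ eps] vanishes_inner vanishes_G smooth_family_intros families)
  show ?case
  proof (rule quadratic_cong[OF quadratic_add[OF quadratic_add[OF H quadratic_cmult[OF Suc, of \<mu>]]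
          quadratic_add[OF quadratic_cmult[OF V_energy_estimate, of "\<kappa> j"]
            quadratic_cmult[OF V_norm_estimate, of "- \<kappa> j * \<mu>"]]] eps])
    fix t assume t: "\<bar>t\<bar> < \<epsilon>"
    have "integ (\<lambda>x. G (Suc j) t x \<bullet> V t x) = integ (\<lambda>x. V t x \<bullet> proj_lap (\<phi> t) (G j t) x)"
      by (rule sphere_integral_cong) (simp add: sgn_sphere inner_commute)
    also have "\<dots> = integ (\<lambda>x. G j t x \<bullet> proj_lap (\<phi> t) (V t) x)"
      using proj_lap_symmetric[OF slice_smooth(1)[OF t] slice_smooth(4)[OF t] radial_lap_tension G_tangent[OF t]
          slice_smooth(3)[OF t] V_radial[OF t] V_tangent[OF t]] by simp
    finally have 1: "integ (\<lambda>x. G (Suc j) t x \<bullet> V t x) = integ (\<lambda>x. G j t x \<bullet> proj_lap (\<phi> t) (V t) x)" .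
    have 2: "integ (?H t) = integ (\<lambda>x. G j t x \<bullet> proj_lap (\<phi> t) (V t) x)
        - \<mu> * integ (\<lambda>x. G j t x \<bullet> V t x) - \<kappa> j * integ (\<lambda>x. V t x \<bullet> proj_lap (\<phi> t) (V t) x)
        + \<kappa> j * \<mu> * integ (\<lambda>x. V t x \<bullet> V t x)"
      by (rule integral_inner_diff_expand) (intro slice_continuous[OF t])+
    have 3: "\<kappa> (Suc j) = \<mu> * \<kappa> j" by (simp add: \<kappa>_def)
    have 4: "\<beta> (Suc j) = \<mu> * \<beta> j - \<kappa> j * (2 * lam * s * c)"
      unfolding \<beta>_def \<kappa>_def \<mu>_def by (simp add: algebra_simps power2_eq_square)
    show "integ (?H t) + \<mu> * (integ (\<lambda>x. G j t x \<bullet> V t x) - (\<kappa> j * sphere_area TYPE('a) + \<beta> j * F t))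
      + (\<kappa> j * (integ (\<lambda>x. V t x \<bullet> proj_lap (\<phi> t) (V t) x) - (\<mu> * sphere_area TYPE('a) - 2 * lam * s * c * F t))
        + - \<kappa> j * \<mu> * (integ (\<lambda>x. V t x \<bullet> V t x) - sphere_area TYPE('a)))
      = integ (\<lambda>x. G (Suc j) t x \<bullet> V t x) - (\<kappa> (Suc j) * sphere_area TYPE('a) + \<beta> (Suc j) * F t)"
      unfolding 1 2 3 4 by (simp add: algebra_simps)
  qed
qed

lemma product_estimate:
  "quadratic (\<lambda>t. integ (\<lambda>x. G i t x \<bullet> G j t x) - (\<kappa> i * \<kappa> j * sphere_area TYPE('a) + (\<kappa> i * \<beta> j + \<kappa> j * \<beta> i) * F t))"
proof (rule quadratic_cong[OF _ eps])
  let ?H = "\<lambda>t x. (G i t x - \<kappa> i *\<^sub>R V t x) \<bullet> (G j t x - \<kappa> j *\<^sub>R V t x)"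
  have H: "quadratic (\<lambda>t. integ (?H t))"
    by (intro quadratic_integral[OF _ _ eps] vanishes_inner vanishes_G smooth_family_intros families)
  show "quadratic (\<lambda>t. (integ (?H t) + - (\<kappa> i * \<kappa> j) * (integ (\<lambda>x. V t x \<bullet> V t x) - sphere_area TYPE('a)))
     + (\<kappa> j * (integ (\<lambda>x. G i t x \<bullet> V t x) - (\<kappa> i * sphere_area TYPE('a) + \<beta> i * F t))
        + \<kappa> i * (integ (\<lambda>x. G j t x \<bullet> V t x) - (\<kappa> j * sphere_area TYPE('a) + \<beta> j * F t))))"
    by (intro quadratic_add H quadratic_cmult V_norm_estimate moment_estimate)
  fix t assume t: "\<bar>t\<bar> < \<epsilon>"
  have 2: "integ (?H t) = integ (\<lambda>x. G i t x \<bullet> G j t x)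
      - \<kappa> j * integ (\<lambda>x. G i t x \<bullet> V t x) - \<kappa> i * integ (\<lambda>x. V t x \<bullet> G j t x)
      + \<kappa> i * \<kappa> j * integ (\<lambda>x. V t x \<bullet> V t x)"
    by (rule integral_inner_diff_expand) (intro slice_continuous[OF t])+
  have 3: "integ (\<lambda>x. V t x \<bullet> G j t x) = integ (\<lambda>x. G j t x \<bullet> V t x)" by (simp add: inner_commute)
  show "(integ (?H t) + - (\<kappa> i * \<kappa> j) * (integ (\<lambda>x. V t x \<bullet> V t x) - sphere_area TYPE('a)))
     + (\<kappa> j * (integ (\<lambda>x. G i t x \<bullet> V t x) - (\<kappa> i * sphere_area TYPE('a) + \<beta> i * F t))
        + \<kappa> i * (integ (\<lambda>x. G j t x \<bullet> V t x) - (\<kappa> j * sphere_area TYPE('a) + \<beta> j * F t)))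
    = integ (\<lambda>x. G i t x \<bullet> G j t x) - (\<kappa> i * \<kappa> j * sphere_area TYPE('a) + (\<kappa> i * \<beta> j + \<kappa> j * \<beta> i) * F t)"
    unfolding 2 3 by (simp add: algebra_simps)
qed

text \<open>The energy is the integral of \<open>G j \<bullet> G j\<close> for \<open>r = 2 j + 2\<close>, and minus that of \<open>G j \<bullet> G (Suc j)\<close>, by
  Green's formula, for \<open>r = 2 j + 3\<close>. The coefficient of \<open>F\<close> is \<open>2 \<kappa> j \<beta> j\<close> in the first case and minus
  \<open>\<kappa> j \<beta> (Suc j) + \<kappa> (Suc j) \<beta> j\<close> in the second; both are multiples of \<open>1 - r s\<^sup>2\<close>.\<close>

lemma energy_stationary:
  assumes r: "r \<ge> 2" and crit: "real r * s\<^sup>2 = 1"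
  shows "\<exists>E. quadratic (\<lambda>t. (if even r then integ (\<lambda>x. (norm (G (r div 2 - 1) t x))\<^sup>2)
     else integ (\<lambda>x. \<Sum>e\<in>Basis. (norm (tangent_proj (\<phi> t x) (dird e (G (r div 2 - 1) t) x)))\<^sup>2)) - E)"
proof (cases "even r")
  case True
  define j where "j = r div 2 - 1"
  have "real r = 2 * (real j + 1)" using True r by (auto simp: j_def elim!: evenE)
  then have b: "\<beta> j = 0" using crit by (simp add: \<beta>_def)
  have "quadratic (\<lambda>t. integ (\<lambda>x. (norm (G j t x))\<^sup>2) - \<kappa> j * \<kappa> j * sphere_area TYPE('a))"
    using product_estimate[of j j] unfolding b by (simp add: dot_square_norm)
  then show ?thesis using True unfolding j_def by (simp only: if_True) (rule exI)
next
  case False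
  define j where "j = r div 2 - 1"
  have r3: "real r = 2 * real j + 3" using False r by (auto simp: j_def elim!: oddE)
  have "(1 - 2 * (real (Suc j) + 1) * s\<^sup>2) + (1 - 2 * (real j + 1) * s\<^sup>2) = 2 * (1 - (2 * real j + 3) * s\<^sup>2)"
    by (simp add: algebra_simps)
  also have "\<dots> = 0" using crit r3 by simp
  finally have 0: "(1 - 2 * (real (Suc j) + 1) * s\<^sup>2) = - (1 - 2 * (real j + 1) * s\<^sup>2)" by simp
  define X where "X = 1 - 2 * (real j + 1) * s\<^sup>2"
  have "\<beta> j = - lam * \<mu> ^ j * X" "\<beta> (Suc j) = - lam * \<mu> ^ Suc j * (- X)"
    unfolding \<beta>_def 0 X_def by simp_all
  then have b: "\<kappa> j * \<beta> (Suc j) + \<kappa> (Suc j) * \<beta> j = 0" by (simp add: \<kappa>_def)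
  have "quadratic (\<lambda>t. (-1) * (integ (\<lambda>x. G j t x \<bullet> G (Suc j) t x) - \<kappa> j * \<kappa> (Suc j) * sphere_area TYPE('a)))"
    using quadratic_cmult[OF product_estimate[of j "Suc j"], of "-1"] unfolding b by simp
  then have "quadratic (\<lambda>t. integ (\<lambda>x. \<Sum>e\<in>Basis. (norm (tangent_proj (\<phi> t x) (dird e (G j t) x)))\<^sup>2)
      - (- (\<kappa> j * \<kappa> (Suc j) * sphere_area TYPE('a))))"
  proof (rule quadratic_cong[OF _ eps])
    fix t assume t: "\<bar>t\<bar> < \<epsilon>"
    have "integ (\<lambda>x. \<Sum>e\<in>Basis. (norm (tangent_proj (\<phi> t x) (dird e (G j t) x)))\<^sup>2)
      = - integ (\<lambda>x. G j t x \<bullet> proj_lap (\<phi> t) (G j t) x)"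
      by (rule integral_cov_deriv_norm_sq[OF slice_smooth(1)[OF t] _ slice_smooth(4)[OF t]
            radial_lap_tension G_tangent[OF t]])
        (simp add: phi_unit[OF t sphere_nz])
    also have "integ (\<lambda>x. G j t x \<bullet> proj_lap (\<phi> t) (G j t) x) = integ (\<lambda>x. G j t x \<bullet> G (Suc j) t x)"
      by (rule sphere_integral_cong) (simp add: sgn_sphere)
    finally show "(-1) * (integ (\<lambda>x. G j t x \<bullet> G (Suc j) t x) - \<kappa> j * \<kappa> (Suc j) * sphere_area TYPE('a))
      = integ (\<lambda>x. \<Sum>e\<in>Basis. (norm (tangent_proj (\<phi> t x) (dird e (G j t) x)))\<^sup>2)
        - (- (\<kappa> j * \<kappa> (Suc j) * sphere_area TYPE('a)))" by simp
  qed
  then show ?thesis using False unfolding j_def by (simp only: if_False) (rule exI)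
qed

end

section \<open>From maps on the sphere to radial functions\<close>

lemma smooth_on_compose:
  fixes h :: "'x::real_normed_vector \<Rightarrow> 'm::euclidean_space"
  assumes D: "open D" and h: "Cinf_on D h" and hD: "h ` D \<subseteq> M" and f: "smooth_on M f"
  shows "Cinf_on D (\<lambda>x. f (h x))"
  unfolding Cinf_on_def
proof
  fix k
  show "Ck_on D (\<lambda>x. f (h x)) k"
  proof (rule Ck_on_local)
    fix x assume x: "x \<in> D"
    have "h x \<in> M" using hD x by auto
    with f have "\<exists>U g. open U \<and> h x \<in> U \<and> (\<forall>k. Ck_on U g k) \<and> (\<forall>y\<in>M \<inter> U. g y = f y)"
      unfolding smooth_on_def by (rule bspec)
    then obtain U g where "open U \<and> h x \<in> U \<and> (\<forall>k. Ck_on U g k) \<and> (\<forall>y\<in>M \<inter> U. g y = f y)"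
      by (elim exE)
    then have U: "open U" "h x \<in> U" "\<And>k. Ck_on U g k" "\<And>y. y \<in> M \<inter> U \<Longrightarrow> g y = f y"
      by simp_all
    define W where "W = D \<inter> h -` U"
    have oW: "open W"
      unfolding W_def by (rule continuous_open_preimage[OF Cinf_on_continuous[OF h] D U(1)])
    have WU: "h ` W \<subseteq> U" and WD: "W \<subseteq> D" by (auto simp: W_def)
    have "Ck_on D h k" using h by (simp add: Cinf_on_def)
    then have "Ck_on W h k" using WD by (rule Ck_on_subset)
    then have "Ck_on W (\<lambda>x. g (h x)) k" by (rule Ck_on_compose[OF oW WU U(3)])
    moreover have "g (h y) = f (h y)" if "y \<in> W" for y
      using U(4) hD WU WD that by blast
    ultimately have "Ck_on W (\<lambda>x. f (h x)) k" by (rule Ck_on_cong[OF oW, rotated])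
    moreover have "x \<in> W" using x U(2) by (simp add: W_def)
    ultimately show "\<exists>V. open V \<and> x \<in> V \<and> Ck_on V (\<lambda>x. f (h x)) k" using oW by blast
  qed
qed

lemma smooth_onI:
  assumes "open U" "Cinf_on U g" "M \<subseteq> U" "\<And>x. x \<in> M \<Longrightarrow> g x = f x"
  shows "smooth_on M f"
  unfolding smooth_on_def
proof
  fix x assume "x \<in> M"
  with assms have "open U \<and> x \<in> U \<and> (\<forall>k. Ck_on U g k) \<and> (\<forall>y\<in>M \<inter> U. g y = f y)"
    by (simp add: Cinf_on_def subset_iff)
  then show "\<exists>U g. open U \<and> x \<in> U \<and> (\<forall>k. Ck_on U g k) \<and> (\<forall>y\<in>M \<inter> U. g y = f y)"
    by (intro exI)
qed

lemma Cinf_on_sgn: "Cinf_on (- {0}) (sgn :: 'a::euclidean_space \<Rightarrow> 'a)"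
  unfolding Cinf_on_def using Ck_on_sgn by blast

lemma radial_extension_sgn:
  assumes "smooth_on (sphere 0 1) f"
  shows "radial_extension f (\<lambda>x. f (sgn x))"
  unfolding radial_extension_def
proof (intro conjI ballI radial_sgn)
  show "Cinf_on (- {0}) (\<lambda>x. f (sgn x))"
    by (rule smooth_on_compose[OF _ Cinf_on_sgn _ assms]) (auto intro: sgn_in_sphere simp del: mem_sphere)
qed (simp only: sgn_sphere)

lemma smooth_family_sgn:
  fixes \<Phi> :: "real \<Rightarrow> 'a::euclidean_space \<Rightarrow> 'b::real_normed_vector"
  assumes "smooth_on ({-\<epsilon><..<\<epsilon>} \<times> sphere 0 1) (\<lambda>(t, x). \<Phi> t x)"
  shows "smooth_family \<epsilon> (\<lambda>t x. \<Phi> t (sgn x))"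
proof -
  let ?D = "{-\<epsilon><..<\<epsilon>} \<times> - {0::'a}"
  have "Ck_on ?D (\<lambda>p. (fst p, sgn (snd p))) k" for k
    by (intro Ck_on_Pair open_family_domain Ck_on_linear bounded_linear_fst bounded_linear_snd
        Ck_on_compose[OF open_family_domain _ Ck_on_sgn]) auto
  then have "Cinf_on ?D (\<lambda>p. (fst p, sgn (snd p)))" by (simp add: Cinf_on_def)
  moreover have "(\<lambda>p. (fst p, sgn (snd p))) ` ?D \<subseteq> {-\<epsilon><..<\<epsilon>} \<times> sphere 0 1"
    by (auto simp: norm_sgn)
  ultimately have "Cinf_on ?D (\<lambda>p. (\<lambda>(t, x). \<Phi> t x) (fst p, sgn (snd p)))"
    using assms by (rule smooth_on_compose[OF open_family_domain])
  then show ?thesis by (simp add: smooth_family_def)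
qed

lemma radial_extension_iterated_laplacian:
  fixes \<phi> f :: "'a::euclidean_space \<Rightarrow> 'b::euclidean_space"
  assumes phi: "radial_extension \<phi> f" and unit: "\<And>x. x \<in> sphere 0 1 \<Longrightarrow> norm (f x) = 1"
  shows "radial_extension ((rough_laplacian \<phi> ^^ j) (tension \<phi>)) (lap_tension f j)"
proof -
  have f: "Cinf_on (- {0}) f" using phi by (simp add: radial_extension_def)
  have sgn: "sgn x = x" if "x \<in> sphere 0 1" for x :: 'a using that by (rule sgn_sphere)
  show ?thesis
  proof (induction j)
    case 0
    then show ?case
      using tension_radial[OF phi unit]
      unfolding radial_extension_def
      by (intro conjI ballI lap_tension_smooth[OF f] radial_lap_tension) (simp only: funpow_0 lap_tension.simps sgn)
  next
    case (Suc j)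
    then show ?case
      using rough_laplacian_radial[OF phi Suc unit]
      unfolding radial_extension_def
      by (intro conjI ballI lap_tension_smooth[OF f] radial_lap_tension)
        (simp only: funpow.simps o_apply lap_tension.simps sgn)
  qed
qed

lemma r_energy_radial:
  fixes \<phi> f :: "'a::euclidean_space \<Rightarrow> 'b::euclidean_space"
  assumes phi: "radial_extension \<phi> f" and unit: "\<And>x. x \<in> sphere 0 1 \<Longrightarrow> norm (f x) = 1"
  shows "r_energy r \<phi> =
    (if even r then \<integral>x. (norm (lap_tension f (r div 2 - 1) x))\<^sup>2 \<partial>sphere_measure
     else \<integral>x. (\<Sum>e\<in>Basis. (norm (tangent_proj (f x) (dird e (lap_tension f (r div 2 - 1)) x)))\<^sup>2)
       \<partial>sphere_measure)"
proof -
  define j where "j = r div 2 - 1"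
  let ?W = "(rough_laplacian \<phi> ^^ j) (tension \<phi>)"
  note ext = radial_extension_iterated_laplacian[OF phi unit, of j]
  have "(\<integral>x. (norm (?W x))\<^sup>2 \<partial>sphere_measure) = (\<integral>x. (norm (lap_tension f j x))\<^sup>2 \<partial>sphere_measure)"
    by (rule sphere_integral_cong) (use ext in \<open>simp add: radial_extension_def\<close>)
  moreover have "(\<integral>x. cov_deriv_norm_sq \<phi> ?W x \<partial>sphere_measure) =
    (\<integral>x. (\<Sum>e\<in>Basis. (norm (tangent_proj (f x) (dird e (lap_tension f j) x)))\<^sup>2) \<partial>sphere_measure)"
    by (rule sphere_integral_cong) (rule cov_deriv_norm_sq_radial[OF phi ext])
  ultimately show ?thesis unfolding r_energy_def Let_def j_def by simp
qed

text \<open>Harmonicity says that the Laplacian of \<open>v\<close> is normal to the target sphere, and differentiating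
  \<open>|v|\<^sup>2 = 1\<close> twice shows that its normal component is \<open>- |\<nabla>v|\<^sup>2\<close>.\<close>

lemma eigenmap_radial_extension:
  fixes v :: "'a::euclidean_space \<Rightarrow> 'b::euclidean_space"
  assumes "harmonic_map v" "\<forall>x\<in>sphere 0 1. differential_norm_sq v x = lam"
  shows "eigenmap (\<lambda>x. v (sgn x)) lam" "radial_extension v (\<lambda>x. v (sgn x))"
proof -
  let ?f = "\<lambda>x. v (sgn x)"
  have sm: "smooth_sphere_map v" and tens: "\<And>x. x \<in> sphere 0 1 \<Longrightarrow> tension v x = 0"
    using assms(1) by (auto simp: harmonic_map_def)
  show ext: "radial_extension v ?f"
    using sm by (intro radial_extension_sgn) (simp add: smooth_sphere_map_def)
  then have f: "Cinf_on (- {0}) ?f" by (simp add: radial_extension_def)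
  have unit: "norm (?f x) = 1" if "x \<noteq> 0" for x
    using sm sgn_in_sphere[OF that] by (auto simp: smooth_sphere_map_def image_subset_iff)
  then have unitS: "norm (?f x) = 1" if "x \<in> sphere 0 1" for x using that sphere_subset by blast
  have energy: "(\<Sum>e\<in>Basis. (norm (dird e ?f x))\<^sup>2) = lam" if "x \<in> sphere 0 1" for x
    using assms(2) differential_norm_sq_radial[OF ext that] that by simp
  have "lap ?f x = - lam *\<^sub>R ?f x" if x: "x \<in> sphere 0 1" for x
  proof -
    have x0: "x \<noteq> 0" using x by auto
    have "dird e (dird e ?f) x \<bullet> ?f x = - (norm (dird e ?f x))\<^sup>2" for e
      using dird_orthogonal[OF Cinf_on_dird[OF f] f dird_unit_orthogonal[OF f unit] x0, of e]
      by (simp add: dot_square_norm)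
    then have lv: "lap ?f x \<bullet> ?f x = - lam"
      using energy[OF x] by (simp add: lap_def inner_sum_left sum_negf)
    have "lap ?f x - (lap ?f x \<bullet> ?f x) *\<^sub>R ?f x = 0"
      using tension_radial[OF ext unitS x] tens[OF x] by (simp only: tangent_proj_def)
    then show ?thesis unfolding lv by (simp only: eq_iff_diff_eq_0[of "lap ?f x"])
  qed
  then show "eigenmap ?f lam"
    using f unit energy by unfold_locales (auto simp: radial_sgn)
qed

section \<open>The energy of the parallels\<close>

context eigenmap
begin

text \<open>In the odd case the energy is \<open>- \<integral>\<langle>G\<^sub>j, G\<^sub>j\<^sub>+\<^sub>1\<rangle>\<close> by Green's formula, so in both parities the integrand is
  a product of two constant multiples of the same unit section.\<close>

lemma r_energy_parallel:
  assumes ext: "radial_extension \<phi> (parallel_map v s c)" and sc: "s\<^sup>2 + c\<^sup>2 = 1" and r: "r \<ge> 2"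
  shows "r_energy r \<phi> = lam ^ r * sphere_area TYPE('a) * (s\<^sup>2 * c ^ (2 * r - 2))"
proof -
  let ?q = "parallel_map v s c"
  define k where "k j = lam * s * c * (- lam * c\<^sup>2) ^ j" for j
  define j where "j = r div 2 - 1"
  have prod: "(\<integral>x. lap_tension ?q i x \<bullet> lap_tension ?q l x \<partial>sphere_measure) = sphere_area TYPE('a) * (k i * k l)" for i l
  proof -
    have "(\<integral>x. lap_tension ?q i x \<bullet> lap_tension ?q l x \<partial>sphere_measure)
      = (\<integral>x. k i * k l \<partial>(sphere_measure :: 'a measure))"
    proof (rule sphere_integral_cong)
      fix x :: 'a assume "x \<in> sphere 0 1"
      then have x: "x \<noteq> 0" by auto
      have "c * c + s * s = 1" using sc by (simp add: power2_eq_square)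
      then show "lap_tension ?q i x \<bullet> lap_tension ?q l x = k i * k l"
        by (simp add: lap_tension_parallel[OF sc x] k_def inner_parallel[OF x])
    qed
    then show ?thesis by (simp add: sphere_area_def space_sphere_measure)
  qed
  have unit: "norm (?q x) = 1" if "x \<noteq> 0" for x using norm_parallel[OF that sc] .
  have "(- lam * c\<^sup>2) * (- lam * c\<^sup>2) = lam\<^sup>2 * c ^ 4" by (simp add: eval_nat_numeral)
  then have pw: "(- lam * c\<^sup>2) ^ j * (- lam * c\<^sup>2) ^ j = lam ^ (2 * j) * c ^ (4 * j)"
    by (simp only: power_mult_distrib[symmetric]) (simp add: power_mult power_mult_distrib)
  show ?thesis
  proof (cases "even r")
    case True
    then have rj: "r = 2 * j + 2" using r by (auto simp: j_def elim!: evenE)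
    have "r_energy r \<phi> = sphere_area TYPE('a) * (k j * k j)"
      using r_energy_radial[OF ext unit[OF sphere_nz], of r] True prod[of j j]
      by (simp add: j_def dot_square_norm)
    also have "k j * k j = lam ^ r * (s\<^sup>2 * c ^ (2 * r - 2))"
    proof -
      have e: "2 * r - 2 = 4 * j + 2" using rj by simp
      have "k j * k j = (lam * s * c)\<^sup>2 * ((- lam * c\<^sup>2) ^ j * (- lam * c\<^sup>2) ^ j)"
        by (simp add: k_def power2_eq_square)
      then show ?thesis unfolding pw e rj
        by (simp add: power_mult_distrib power_add power2_eq_square mult_ac)
    qed
    finally show ?thesis by simp
  next
    case False
    then have rj: "r = 2 * j + 3" using r by (auto simp: j_def elim!: oddE)
    have "r_energy r \<phi> = (\<integral>x. (\<Sum>e\<in>Basis. (norm (tangent_proj (?q x) (dird e (lap_tension ?q j) x)))\<^sup>2) \<partial>sphere_measure)"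
      using r_energy_radial[OF ext unit[OF sphere_nz], of r] False by (simp add: j_def)
    also have "\<dots> = - (\<integral>x. lap_tension ?q j x \<bullet> proj_lap ?q (lap_tension ?q j) x \<partial>sphere_measure)"
      by (rule integral_cov_deriv_norm_sq[OF parallel_smooth unit[OF sphere_nz]
            lap_tension_smooth[OF parallel_smooth] radial_lap_tension
            lap_tension_tangent[OF parallel_smooth parallel_radial unit]])
    also have "(\<integral>x. lap_tension ?q j x \<bullet> proj_lap ?q (lap_tension ?q j) x \<partial>sphere_measure)
      = (\<integral>x. lap_tension ?q j x \<bullet> lap_tension ?q (Suc j) x \<partial>sphere_measure)"
      by (rule sphere_integral_cong) (simp add: sgn_sphere)
    finally have "r_energy r \<phi> = - (sphere_area TYPE('a) * (k j * k (Suc j)))" unfolding prod .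
    also have "k j * k (Suc j) = - (lam ^ r * (s\<^sup>2 * c ^ (2 * r - 2)))"
    proof -
      have e: "2 * r - 2 = 4 * j + 4" using rj by simp
      have "k j * k (Suc j) = (lam * s * c)\<^sup>2 * (- lam * c\<^sup>2) * ((- lam * c\<^sup>2) ^ j * (- lam * c\<^sup>2) ^ j)"
        by (simp add: k_def power2_eq_square)
      then show ?thesis unfolding pw e rj
        by (simp add: power_mult_distrib power_add eval_nat_numeral mult_ac)
    qed
    finally show ?thesis by simp
  qed
qed

end

lemma parallel_variation_smooth:
  assumes ext: "radial_extension v f" and eig: "eigenmap f lam"
  shows "smooth_variation (\<lambda>x. (sin \<delta> *\<^sub>R v x, cos \<delta>)) (\<lambda>t x. (sin (\<delta> + t) *\<^sub>R v x, cos (\<delta> + t)))"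
proof -
  interpret eigenmap f lam by (rule eig)
  let ?D = "{-1<..<1::real} \<times> - {0::'a}"
  have op: "open ?D" by (rule open_family_domain)
  have lin: "Ck_on ?D (\<lambda>p. \<delta> + fst p) k" for k
    by (intro Ck_on_add op Ck_on_const Ck_on_linear bounded_linear_fst)
  have fs: "Ck_on ?D (\<lambda>p. f (snd p)) k" for k
    using smooth_family_fixed[OF v_smooth, of 1] by (simp add: smooth_family_def Cinf_on_def)
  have "Cinf_on ?D (\<lambda>p. (sin (\<delta> + fst p) *\<^sub>R f (snd p), cos (\<delta> + fst p)))"
    unfolding Cinf_on_def
    using Ck_on_sin_cos
    by (intro allI Ck_on_Pair Ck_on_scaleR op fs Ck_on_compose[OF op _ _ lin, of UNIV sin]
        Ck_on_compose[OF op _ _ lin, of UNIV cos]) auto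
  then have "smooth_on ({-1<..<1} \<times> sphere 0 1) (\<lambda>(t, x). (sin (\<delta> + t) *\<^sub>R v x, cos (\<delta> + t)))"
    by (rule smooth_onI[OF op]) (use ext in \<open>auto simp: radial_extension_def\<close>)
  moreover have "(sin (\<delta> + t) *\<^sub>R v x, cos (\<delta> + t)) \<in> sphere 0 1" if "x \<in> sphere 0 1" for t x
  proof -
    have "v x = f x" "norm (f x) = 1"
      using ext v_unit[OF sphere_nz[OF that]] that by (auto simp: radial_extension_def)
    then show ?thesis by (simp add: norm_Pair)
  qed
  ultimately show ?thesis
    unfolding smooth_variation_def
    by (intro conjI exI[of _ 1]) auto
qed

lemma r_harmonic_parallel:
  fixes v :: "'a::euclidean_space \<Rightarrow> 'b::euclidean_space"
  assumes ext: "radial_extension v f" and eig: "eigenmap f lam" and r: "r \<ge> 2"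
    and crit: "real r * (sin \<delta>)\<^sup>2 = 1"
  shows "r_harmonic r (\<lambda>x. (sin \<delta> *\<^sub>R v x, cos \<delta>))"
  unfolding r_harmonic_def
proof (intro conjI allI impI)
  let ?q = "\<lambda>x. (sin \<delta> *\<^sub>R v x, cos \<delta>)"
  interpret E: eigenmap f lam by (rule eig)
  have vf: "v x = f x" "norm (f x) = 1" if "x \<in> sphere 0 1" for x
    using ext E.v_unit[OF sphere_nz[OF that]] that by (auto simp: radial_extension_def)
  have "smooth_on (sphere 0 1) ?q"
    by (rule smooth_onI[of "- {0}", OF _ E.parallel_smooth[of "sin \<delta>" "cos \<delta>"]])
      (auto simp: parallel_map_def vf)
  then show "smooth_sphere_map ?q"
    by (auto simp: smooth_sphere_map_def norm_Pair vf)
  fix \<Phi> assume "smooth_variation ?q \<Phi>"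
  then obtain \<epsilon> where eps: "\<epsilon> > 0" and sm: "smooth_on ({-\<epsilon><..<\<epsilon>} \<times> sphere 0 1) (\<lambda>(t, x). \<Phi> t x)"
    and S: "\<And>t. t \<in> {-\<epsilon><..<\<epsilon>} \<Longrightarrow> \<Phi> t ` sphere 0 1 \<subseteq> sphere 0 1"
    and 0: "\<And>x. x \<in> sphere 0 1 \<Longrightarrow> \<Phi> 0 x = ?q x"
    unfolding smooth_variation_def by blast
  define \<phi> where "\<phi> t x = \<Phi> t (sgn x)" for t x
  have fam: "smooth_family \<epsilon> \<phi>" unfolding \<phi>_def[abs_def] by (rule smooth_family_sgn[OF sm])
  interpret parallel_variation f lam "sin \<delta>" "cos \<delta>" \<phi> \<epsilon>
  proof
    show "radial (\<phi> t)" for t unfolding \<phi>_def[abs_def] by (rule radial_sgn)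
    show "norm (\<phi> t x) = 1" if "\<bar>t\<bar> < \<epsilon>" "x \<noteq> 0" for t x
    proof -
      have "t \<in> {-\<epsilon><..<\<epsilon>}" using that(1) by auto
      from subsetD[OF S[OF this] imageI[OF sgn_in_sphere[OF that(2)]]] show ?thesis
        by (simp add: \<phi>_def)
    qed
    show "\<phi> 0 x = parallel_map f (sin \<delta>) (cos \<delta>) x" if "x \<noteq> 0" for x
      using 0[OF sgn_in_sphere[OF that]] vf(1)[OF sgn_in_sphere[OF that]] E.v_radial that
      by (simp add: \<phi>_def parallel_map_def radial_def)
  qed (use eps fam in auto)
  obtain E where E: "quadratic (\<lambda>t. (if even r then \<integral>x. (norm (lap_tension (\<phi> t) (r div 2 - 1) x))\<^sup>2 \<partial>sphere_measure
     else \<integral>x. (\<Sum>e\<in>Basis. (norm (tangent_proj (\<phi> t x) (dird e (lap_tension (\<phi> t) (r div 2 - 1)) x)))\<^sup>2)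
       \<partial>sphere_measure) - E)"
    using energy_stationary[OF r crit] by blast
  have "quadratic (\<lambda>t. r_energy r (\<Phi> t) - E)"
  proof (rule quadratic_cong[OF E eps])
    fix t assume t: "\<bar>t\<bar> < \<epsilon>"
    have "radial_extension (\<Phi> t) (\<phi> t)"
      unfolding radial_extension_def
      using smooth_family_slice[OF fam t] phi_radial[OF t] by (auto simp: \<phi>_def sgn_sphere)
    from r_energy_radial[OF this phi_unit[OF t sphere_nz]]
    show "(if even r then \<integral>x. (norm (lap_tension (\<phi> t) (r div 2 - 1) x))\<^sup>2 \<partial>sphere_measure
     else \<integral>x. (\<Sum>e\<in>Basis. (norm (tangent_proj (\<phi> t x) (dird e (lap_tension (\<phi> t) (r div 2 - 1)) x)))\<^sup>2)
       \<partial>sphere_measure) - E = r_energy r (\<Phi> t) - E" by simp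
  qed
  then show "((\<lambda>t. r_energy r (\<Phi> t)) has_real_derivative 0) (at 0)"
    by (rule quadratic_imp_derivative_0)
qed

lemma not_harmonic_parallel:
  fixes v :: "'a::euclidean_space \<Rightarrow> 'b::euclidean_space"
  assumes ext: "radial_extension v f" and eig: "eigenmap f lam"
    and pos: "lam * sin \<delta> * cos \<delta> \<noteq> 0"
  shows "\<not> harmonic_map (\<lambda>x. (sin \<delta> *\<^sub>R v x, cos \<delta>))"
proof -
  let ?q = "\<lambda>x. (sin \<delta> *\<^sub>R v x, cos \<delta>)"
  interpret E: eigenmap f lam by (rule eig)
  have extq: "radial_extension ?q (parallel_map f (sin \<delta>) (cos \<delta>))"
    using ext E.parallel_smooth E.parallel_radial
    by (auto simp: radial_extension_def parallel_map_def)
  obtain b :: 'a where "b \<in> Basis" using nonempty_Basis by blast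
  then have b: "b \<in> sphere 0 1" "b \<noteq> 0" by auto
  have "tension ?q b = (lam * sin \<delta> * cos \<delta>) *\<^sub>R parallel_map f (- cos \<delta>) (sin \<delta>) b"
    using tension_radial[OF extq E.norm_parallel[OF sphere_nz] b(1)]
      E.tension_parallel[OF _ b(1), of "sin \<delta>" "cos \<delta>"] by simp
  moreover have "parallel_map f (- cos \<delta>) (sin \<delta>) b \<noteq> 0"
    using E.norm_parallel[OF b(2), of "- cos \<delta>" "sin \<delta>"] by (metis norm_zero power2_minus sin_cos_squared_add2 zero_neq_one)
  ultimately have "tension ?q b \<noteq> 0" using pos by simp
  then show ?thesis using b(1) unfolding harmonic_map_def by blast
qed

lemma r_energy_family:
  fixes v :: "'a::euclidean_space \<Rightarrow> 'b::euclidean_space"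
  assumes ext: "radial_extension v f" and eig: "eigenmap f lam" and r: "r \<ge> 2"
  shows "r_energy r (\<lambda>x. (sin a *\<^sub>R v x, cos a))
    = lam ^ r * sphere_area TYPE('a) * ((sin a)\<^sup>2 * cos a ^ (2 * r - 2))"
proof -
  interpret E: eigenmap f lam by (rule eig)
  show ?thesis
    by (rule E.r_energy_parallel[OF _ _ r])
      (use ext E.parallel_smooth E.parallel_radial in \<open>auto simp: radial_extension_def parallel_map_def\<close>)
qed

lemma has_derivative_energy_profile:
  assumes r: "r \<ge> 2"
  shows "((\<lambda>t. K * ((sin (\<delta> + t))\<^sup>2 * cos (\<delta> + t) ^ (2 * r - 2))) has_real_derivative
     2 * K * sin (\<delta> + t) * cos (\<delta> + t) ^ (2 * r - 3) * (1 - real r * (sin (\<delta> + t))\<^sup>2)) (at t)"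
proof -
  obtain k where k: "r = k + 2" using r by (metis add.commute le_Suc_ex)
  let ?s = "sin (\<delta> + t)" and ?c = "cos (\<delta> + t)"
  have s: "((\<lambda>t. (sin (\<delta> + t))\<^sup>2) has_real_derivative 2 * ?s * ?c) (at t)"
    by (auto intro!: derivative_eq_intros)
  have "((\<lambda>t. cos (\<delta> + t)) has_real_derivative - ?s) (at t)"
    by (auto intro!: derivative_eq_intros)
  from DERIV_power_Suc[OF this, of "2 * k + 1"]
  have c: "((\<lambda>t. cos (\<delta> + t) ^ (2 * k + 2)) has_real_derivative
      - (2 * real k + 2) * ?s * ?c ^ (2 * k + 1)) (at t)" by (simp add: algebra_simps)
  have der: "((\<lambda>t. K * ((sin (\<delta> + t))\<^sup>2 * cos (\<delta> + t) ^ (2 * k + 2))) has_real_derivative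
     K * (2 * ?s * ?c * ?c ^ (2 * k + 2) + - (2 * real k + 2) * ?s * ?c ^ (2 * k + 1) * ?s\<^sup>2)) (at t)"
    by (intro DERIV_cmult DERIV_mult s c)
  have pyth: "?c\<^sup>2 - (real k + 1) * ?s\<^sup>2 = 1 - real r * ?s\<^sup>2"
    unfolding k cos_squared_eq by (simp add: algebra_simps)
  have eq: "K * (2 * ?s * ?c * ?c ^ (2 * k + 2) + - (2 * real k + 2) * ?s * ?c ^ (2 * k + 1) * ?s\<^sup>2)
    = 2 * K * ?s * ?c ^ (2 * k + 1) * (?c\<^sup>2 - (real k + 1) * ?s\<^sup>2)"
    by (simp add: power2_eq_square algebra_simps)
  have "2 * r - 2 = 2 * k + 2" "2 * r - 3 = 2 * k + 1" using k by auto
  then show ?thesis using der unfolding eq pyth by (simp only:)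
qed

theorem theorem5p2:
  fixes v :: "'a::euclidean_space \<Rightarrow> 'b::euclidean_space"
    and q :: "'a \<Rightarrow> 'b \<times> real"
    and r :: nat and lam \<delta> :: real
  assumes "r \<ge> 2"
    and "harmonic_map v"
    and "\<forall>x\<in>sphere 0 1. differential_norm_sq v x = lam"
    and "lam > 0"
    and "0 < \<delta>" and "\<delta> < pi / 2"
    and "q = (\<lambda>x. (sin \<delta> *\<^sub>R v x, cos \<delta>))"
  shows "(proper_r_harmonic r q \<longleftrightarrow> sin \<delta> = 1 / sqrt (real r)) \<and>
         (sin \<delta> = 1 / sqrt (real r) \<longrightarrow> unstable_critical_point r q)"
proof -
  let ?f = "\<lambda>x. v (sgn x)"
  have eig: "eigenmap ?f lam" and ext: "radial_extension v ?f"
    using eigenmap_radial_extension[OF assms(2,3)] by auto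
  have s: "sin \<delta> > 0" and c: "cos \<delta> > 0"
    using assms(5,6) by (auto intro!: sin_gt_zero cos_gt_zero)
  have crit: "sin \<delta> = 1 / sqrt (real r) \<longleftrightarrow> real r * (sin \<delta>)\<^sup>2 = 1"
  proof
    assume "sin \<delta> = 1 / sqrt (real r)"
    then show "real r * (sin \<delta>)\<^sup>2 = 1" using assms(1) by (simp add: power_divide)
  next
    assume "real r * (sin \<delta>)\<^sup>2 = 1"
    then have "(sin \<delta>)\<^sup>2 = (1 / sqrt (real r))\<^sup>2" using assms(1) by (simp add: power_divide field_simps)
    then show "sin \<delta> = 1 / sqrt (real r)" using s by (simp add: power2_eq_iff_nonneg)
  qed
  define \<Psi> where "\<Psi> t x = (sin (\<delta> + t) *\<^sub>R v x, cos (\<delta> + t))" for t x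
  define K where "K = lam ^ r * sphere_area TYPE('a)"
  define E' where "E' t = 2 * K * sin (\<delta> + t) * cos (\<delta> + t) ^ (2 * r - 3) * (1 - real r * (sin (\<delta> + t))\<^sup>2)"
    for t
  have K: "K > 0" unfolding K_def using assms(4) by (simp add: sphere_area_pos)
  have var: "smooth_variation q \<Psi>"
    unfolding assms(7) \<Psi>_def[abs_def] by (rule parallel_variation_smooth[OF ext eig])
  have der: "((\<lambda>t. r_energy r (\<Psi> t)) has_real_derivative E' t) (at t)" for t
    unfolding \<Psi>_def[abs_def] r_energy_family[OF ext eig assms(1)] K_def[symmetric] E'_def
    by (rule has_derivative_energy_profile[OF assms(1)])
  have harm: "r_harmonic r q \<longleftrightarrow> real r * (sin \<delta>)\<^sup>2 = 1"
  proof
    assume "r_harmonic r q"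
    then have "((\<lambda>t. r_energy r (\<Psi> t)) has_real_derivative 0) (at 0)"
      using var unfolding r_harmonic_def by blast
    then have "E' 0 = 0" using der[of 0] DERIV_unique by blast
    then show "real r * (sin \<delta>)\<^sup>2 = 1" using K s c by (simp add: E'_def)
  next
    assume "real r * (sin \<delta>)\<^sup>2 = 1"
    then show "r_harmonic r q"
      unfolding assms(7) by (rule r_harmonic_parallel[OF ext eig assms(1)])
  qed
  have "\<not> harmonic_map q"
    unfolding assms(7) by (rule not_harmonic_parallel[OF ext eig]) (use assms(4) s c in simp)
  then have "proper_r_harmonic r q \<longleftrightarrow> sin \<delta> = 1 / sqrt (real r)"
    unfolding proper_r_harmonic_def harm crit by simp
  moreover have "unstable_critical_point r q" if "sin \<delta> = 1 / sqrt (real r)"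
  proof -
    have h: "real r * (sin \<delta>)\<^sup>2 = 1" using that crit by simp
    \<comment> \<open>The factor \<open>1 - r sin\<^sup>2\<close> of \<open>E'\<close> vanishes at zero, so the derivative of the other factor drops out.\<close>
    define u where "u t = 2 * K * sin (\<delta> + t) * cos (\<delta> + t) ^ (2 * r - 3)" for t
    define u' where "u' = 2 * K * (cos \<delta> * cos \<delta> ^ (2 * r - 3)
      + real (2 * r - 3) * (cos \<delta> ^ (2 * r - 3 - Suc 0) * - sin \<delta>) * sin \<delta>)"
    have "(u has_real_derivative u') (at 0)"
      unfolding u_def u'_def by (auto intro!: derivative_eq_intros simp: algebra_simps)
    moreover have "((\<lambda>t. 1 - real r * (sin (\<delta> + t))\<^sup>2) has_real_derivative
        - (2 * real r * sin \<delta> * cos \<delta>)) (at 0)"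
      by (auto intro!: derivative_eq_intros)
    ultimately have "(E' has_real_derivative u' * (1 - real r * (sin (\<delta> + 0))\<^sup>2)
        + - (2 * real r * sin \<delta> * cos \<delta>) * u 0) (at 0)"
      unfolding E'_def[abs_def] u_def[symmetric] by (rule DERIV_mult)
    then have "(E' has_real_derivative - (2 * real r * sin \<delta> * cos \<delta>) * u 0) (at 0)"
      using h by simp
    moreover have "- (2 * real r * sin \<delta> * cos \<delta>) * u 0 < 0"
      using K s c assms(1) by (simp add: u_def)
    ultimately show ?thesis
      unfolding unstable_critical_point_def using harm h var der by (blast intro: always_eventually)
  qed
  ultimately show ?thesis by blast
qed

end
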